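(* Let $\Delta$ be a finite simplicial complex with $\operatorname{depth}\Delta=d-1$, and let $r$ be an integer with $2\le r\le (d+1)/2$. Let $\mathcal{A},\mathcal{B}$ be nonempty cross-intersecting families, where $\mathcal{A}$ consists of $(r-1)$-element faces of $\Delta$ and $\mathcal{B}$ consists of $r$-element faces of $\Delta$, and suppose $\partial\mathcal{B}\subseteq\mathcal{A}$. If $\Delta$ is shifted with respect to $\{v_1<\cdots<v_r\}$, then \[|\mathcal{A}|+|\mathcal{B}|\le f_{r-1}(\Delta)-\gamma+1,\] where $\gamma$ is the number of $(r-1)$-element faces of $\Delta$ containing no element of $\{v_1,\dots,v_r\}$.
   Context: A simplicial complex is a nonempty finite family of sets closed under subsets; $f_k(\Delta)$ is the number of $k$-element faces; $\operatorname{link}_\Delta A=\{B\in\Delta:A\cap B=\emptyset,A\cup B\in\Delta\}$. Fix a field $\mathbb{F}$. A complex $\Gamma$ is Cohen-Macaulay if $\tilde H_i(\operatorname{link}_\Gamma A;\mathbb{F})=0$ for all faces $A$ (including $\emptyset$) and all $i<\dim\operatorname{link}_\Gamma A$ (a face $A$ has dimension $|A|-1$). The depth of $\Delta$ is the largest $k$ such that the subcomplex of faces of dimension at most $k$ is Cohen-Macaulay. $\Delta$ is shifted with respect to $\{v_1<\cdots<v_t\}$ if for every $i\le t$, every face $B$, and every $w\in B$ with $w\notin\{v_1,\dots,v_i\}$ and $v_i\notin B$, the set $(B\setminus\{w\})\cup\{v_i\}$ is a face. Families $\mathcal{A},\mathcal{B}$ are cross-intersecting if $A\cap B\ne\emptyset$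 for all $A\in\mathcal{A},B\in\mathcal{B}$. The shadow $\partial\mathcal{B}$ of a family of $r$-element sets is the family of all $(r-1)$-element sets contained in at least one member of $\mathcal{B}$. *)

theory Defs
  imports Main
begin

definition simplicial_complex :: "'a set set \<Rightarrow> bool" where
  "simplicial_complex \<Delta> \<longleftrightarrow> finite \<Delta> \<and> \<Delta> \<noteq> {} \<and> (\<forall>B\<in>\<Delta>. \<forall>A. A \<subseteq> B \<longrightarrow> A \<in> \<Delta>)"

definition fcount :: "nat \<Rightarrow> 'a set set \<Rightarrow> nat" where
  "fcount k \<Delta> = card {F \<in> \<Delta>. card F = k}"

definition link :: "'a set set \<Rightarrow> 'a set \<Rightarrow> 'a set set" where
  "link \<Delta> A = {B \<in> \<Delta>. A \<inter> B = {} \<and> A \<union> B \<in> \<Delta>}"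

definition cdim :: "'a set set \<Rightarrow> int" where
  "cdim \<Delta> = int (Max (card ` \<Delta>)) - 1"

text \<open>Simplicial chains with n vertices per simplex (i.e. dimension n-1), including the
  empty face in dimension -1 (augmented / reduced chain complex), coefficients in a field.\<close>
definition is_chain :: "'a set set \<Rightarrow> nat \<Rightarrow> ('a set \<Rightarrow> 'k::field) \<Rightarrow> bool" where
  "is_chain \<Gamma> n c \<longleftrightarrow> (\<forall>F. c F \<noteq> 0 \<longrightarrow> F \<in> \<Gamma> \<and> card F = n)"

text \<open>Simplicial boundary map, orientation induced by the linear order on vertices.\<close>
definition bd :: "'a::linorder set set \<Rightarrow> ('a set \<Rightarrow> 'k::field) \<Rightarrow> 'a set \<Rightarrow> 'k" where
  "bd \<Gamma> c F = (\<Sum>v\<in>{v. v \<notin> F \<and> insert v F \<in> \<Gamma>}.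
      (-1) ^ card {u \<in> F. u < v} * c (insert v F))"

definition red_hom_zero :: "'k::field itself \<Rightarrow> 'a::linorder set set \<Rightarrow> int \<Rightarrow> bool" where
  "red_hom_zero K \<Gamma> i \<longleftrightarrow> i < -1 \<or>
     (\<forall>c :: 'a set \<Rightarrow> 'k. is_chain \<Gamma> (nat (i + 1)) c \<and> (\<forall>F. bd \<Gamma> c F = 0) \<longrightarrow>
        (\<exists>b :: 'a set \<Rightarrow> 'k. is_chain \<Gamma> (nat (i + 2)) b \<and> bd \<Gamma> b = c))"

definition cohen_macaulay :: "'k::field itself \<Rightarrow> 'a::linorder set set \<Rightarrow> bool" where
  "cohen_macaulay K \<Gamma> \<longleftrightarrow>
     (\<forall>A\<in>\<Gamma>. \<forall>i::int. i < cdim (link \<Gamma> A) \<longrightarrow> red_hom_zero K (link \<Gamma> A) i)"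

definition skeleton :: "int \<Rightarrow> 'a set set \<Rightarrow> 'a set set" where
  "skeleton k \<Delta> = {F \<in> \<Delta>. int (card F) - 1 \<le> k}"

definition depth :: "'k::field itself \<Rightarrow> 'a::linorder set set \<Rightarrow> int" where
  "depth K \<Delta> = (GREATEST k. -1 \<le> k \<and> k \<le> cdim \<Delta> \<and> cohen_macaulay K (skeleton k \<Delta>))"

text \<open>Shifted with respect to v_1 < ... < v_t, given as the list vs = [v_1,...,v_t].\<close>
definition shifted_wrt :: "'a set set \<Rightarrow> 'a list \<Rightarrow> bool" where
  "shifted_wrt \<Delta> vs \<longleftrightarrow> (\<forall>i < length vs. \<forall>B\<in>\<Delta>. \<forall>w\<in>B.
      w \<notin> set (take (Suc i) vs) \<and> vs ! i \<notin> B \<longrightarrow> insert (vs ! i) (B - {w}) \<in> \<Delta>)"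

definition cross_intersecting :: "'a set set \<Rightarrow> 'a set set \<Rightarrow> bool" where
  "cross_intersecting \<A> \<B> \<longleftrightarrow> (\<forall>A\<in>\<A>. \<forall>B\<in>\<B>. A \<inter> B \<noteq> {})"

definition shadow :: "'a set set \<Rightarrow> 'a set set" where
  "shadow \<B> = {S. \<exists>B\<in>\<B>. S \<subseteq> B \<and> card S + 1 = card B}"

end

theory Submission
  imports Defs "HOL-Library.Function_Algebras" "HOL-Computational_Algebra.Polynomial"
    "HOL-Computational_Algebra.Fraction_Field"
begin

text \<open>
  Let V be the set of the vertices v_1, ..., v_r. Compressing both families towards V keeps their
  sizes, the cross-intersection and the shadow condition, and brings V into the family of r-sets;
  from then on every member of that family meets V. A Cohen-Macaulay skeleton is pure, so by
  shiftedness the faces of size at most r that meet V are the unions of a nonempty subset T of V and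
  a face W of the link of V.

  For fixed T, the chains supported on the corresponding sets W form a subspace of the chains of the
  link. These subspaces inherit the hypotheses: wedge products vanish for disjoint T, and contractions
  send the pieces of the second family into those of the first. Shifting, which moves a contraction by a
  vertex of the link into a new position or exchanges two positions, does not decrease the weighted
  total dimension. In a stable pair the positions of the nonzero pieces are pairwise 2-intersecting,
  which bounds the pieces with many positions combinatorially. The others gain a position by
  splitting them into the kernel and the image of the contraction with a generic linear form, and
  the acyclicity of the links makes the sequence of these contractions exact.
\<close>

section \<open>Dimensions of spaces of functions\<close>

text \<open>The complex is shifted only towards V, so the parts of faces outside V cannot be shifted
  by moving vertices. Linear algebra supplies the missing moves: sums of subspaces replace unions,
  preimages replace intersections, dimension replaces cardinality. The number 2 r - 1 explains the
  hypotheses. In the last stage there are 2 r - 1 positions, r from V and r - 1 generic forms; the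
  complement of an r-set of positions is then an (r-1)-set, the borderline case of the combinatorial
  bound. Exactness of r - 1 successive forms needs a Cohen-Macaulay link of V whose facets have at
  least r - 1 vertices, hence a Cohen-Macaulay skeleton whose facets have at least 2 r - 1 vertices;
  this is 2 r \<le> d + 1. The ground field may be finite, so generic forms are taken over the
  rational functions: for an injective labelling \<alpha> of the vertices, the j-th form has
  coefficients \<open>\<alpha> v ^ j\<close>. The summand 1 in the bound is V itself: if V is a
  face, the pair of {V} and all (r-1)-faces meeting V attains equality.\<close>

lemma (in vector_space) span_disjoint_independent:
  assumes "independent B" "B1 \<subseteq> B" "B2 \<subseteq> B" "B1 \<inter> B2 = {}" "x \<in> span B1" "x \<in> span B2"
  shows "x = 0"
proof -
  have "x \<in> span B" using assms span_mono by blast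
  have "representation B x b = 0" for b
  proof (rule ccontr)
    assume "representation B x b \<noteq> 0"
    then have "representation B1 x b \<noteq> 0" "representation B2 x b \<noteq> 0"
      using representation_extend[OF assms(1) assms(5) assms(2)] representation_extend[OF assms(1) assms(6) assms(3)] by simp_all
    then have "b \<in> B1" "b \<in> B2" using representation_ne_zero by blast+
    then show False using assms(4) by blast
  qed
  then show ?thesis
    using sum_nonzero_representation_eq[OF assms(1) \<open>x \<in> span B\<close>] by simp
qed

text \<open>The ambient function spaces may be infinite-dimensional; the finite spanning set
  \<open>B\<close> keeps all bases finite. A basis of the kernel is extended to one of
  \<open>X\<close>, and the added vectors map to a basis of the image.\<close>

lemma (in vector_space_pair) dim_kernel_image:
  assumes f: "Vector_Spaces.linear s1 s2 f" and X: "vs1.subspace X" and B: "finite B" "X \<subseteq> vs1.span B"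
  shows "vs1.dim X = vs1.dim {x \<in> X. f x = 0} + vs2.dim (f ` X)"
proof -
  interpret f: Vector_Spaces.linear s1 s2 f by (rule f)
  let ?K = "{x \<in> X. f x = 0}"
  obtain B0 where B0: "B0 \<subseteq> ?K" "vs1.independent B0" "?K \<subseteq> vs1.span B0" "card B0 = vs1.dim ?K"
    using vs1.basis_exists by blast
  obtain B1 where B1: "B0 \<subseteq> B1" "B1 \<subseteq> X" "vs1.independent B1" "X \<subseteq> vs1.span B1"
    using vs1.maximal_independent_subset_extend[of B0 X] B0 by blast
  have fin: "finite B1"
    using vs1.independent_span_bound[OF B(1) B1(3)] B1(2) B(2) by blast
  have inj: "inj_on f (vs1.span (B1 - B0))"
  proof (subst linear_inj_on_iff_eq_0[OF f vs1.subspace_span], safe)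
    fix x assume x: "x \<in> vs1.span (B1 - B0)" "f x = 0"
    have "x \<in> X" using x(1) vs1.span_minimal[OF _ X, of "B1 - B0"] B1(2) by blast
    then have "x \<in> vs1.span B0" using x(2) B0(3) by blast
    then show "x = 0"
      using vs1.span_disjoint_independent[OF B1(3), of "B1 - B0" B0 x] B1(1) x(1) by blast
  qed
  have ind: "vs2.independent (f ` (B1 - B0))"
    by (rule linear_independent_injective_image[OF f _ inj])
      (use B1(3) vs1.independent_mono in blast)
  have "f ` X \<subseteq> vs2.span (f ` (B1 - B0))"
  proof -
    have "f ` B1 \<subseteq> vs2.span (f ` (B1 - B0))"
    proof safe
      fix b assume "b \<in> B1"
      show "f b \<in> vs2.span (f ` (B1 - B0))"
      proof (cases "b \<in> B0")
        case True
        then have "f b = 0" using B0(1) by blast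
        then show ?thesis by (simp add: vs2.span_zero)
      next
        case False
        then show ?thesis using \<open>b \<in> B1\<close> by (intro vs2.span_base) simp
      qed
    qed
    then have "vs2.span (f ` B1) \<subseteq> vs2.span (f ` (B1 - B0))"
      by (rule vs2.span_minimal) (rule vs2.subspace_span)
    then show ?thesis using B1(4) linear_span_image[OF f, of B1] by blast
  qed
  then have "vs2.dim (f ` X) = card (f ` (B1 - B0))"
    by (intro vs2.dim_unique[of "f ` (B1 - B0)"]) (use B1(2) ind in auto)
  also have "\<dots> = card (B1 - B0)"
    by (intro card_image inj_on_subset[OF inj] vs1.span_superset)
  finally have "vs2.dim (f ` X) = card (B1 - B0)" .
  moreover have "vs1.dim X = card B1" by (rule vs1.dim_unique[OF B1(2,4,3) refl])
  moreover have "card B1 = card B0 + card (B1 - B0)"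
    using card_Diff_subset[OF finite_subset[OF B1(1) fin] B1(1)] card_mono[OF fin B1(1)] by linarith
  ultimately show ?thesis using B0(4) by simp
qed

interpretation fs: vector_space "\<lambda>(a::'f::field) (c::'b \<Rightarrow> 'f) x. a * c x"
  by unfold_locales (auto simp: fun_eq_iff algebra_simps)

interpretation fsp: vector_space_pair
  "\<lambda>(a::'f::field) (c::'b \<Rightarrow> 'f) x. a * c x" "\<lambda>(a::'f::field) (c::'c \<Rightarrow> 'f) x. a * c x"
  by unfold_locales

definition lin :: "(('b \<Rightarrow> 'f::field) \<Rightarrow> ('c \<Rightarrow> 'f)) \<Rightarrow> bool" where
  "lin g \<longleftrightarrow> (\<forall>x y. g (x + y) = g x + g y) \<and> (\<forall>a x. g (\<lambda>u. a * x u) = (\<lambda>u. a * g x u))"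

lemma lin_linear: "lin g \<longleftrightarrow> Vector_Spaces.linear (\<lambda>a c x. a * c x) (\<lambda>a c x. a * c x) g"
  unfolding lin_def Vector_Spaces.linear_iff by (simp add: fs.vector_space_axioms)

lemma lin_0: "lin g \<Longrightarrow> g 0 = 0"
  unfolding lin_linear by (rule fsp.linear_0)

lemma sum_fun_def: "sum f A = (\<lambda>x. \<Sum>a\<in>A. f a x)"
  by (induction A rule: infinite_finite_induct) (auto simp: fun_eq_iff)

definition supp_on :: "'b set \<Rightarrow> ('b \<Rightarrow> 'f::field) set" where
  "supp_on M = {c. \<forall>x. c x \<noteq> 0 \<longrightarrow> x \<in> M}"

lemma subspace_supp_on: "fs.subspace (supp_on M)"
  unfolding fs.subspace_def supp_on_def by (auto, force)

definition delta :: "'b \<Rightarrow> 'b \<Rightarrow> 'f::field" where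
  "delta x y = (if y = x then 1 else 0)"

lemma supp_on_span:
  assumes "finite M" shows "supp_on M \<subseteq> fs.span (delta ` M :: ('b \<Rightarrow> 'f::field) set)"
proof
  fix c :: "'b \<Rightarrow> 'f" assume "c \<in> supp_on M"
  then have "c = (\<Sum>x\<in>M. (\<lambda>y. c x * delta x y))"
    unfolding fun_eq_iff sum_fun_def delta_def supp_on_def using assms by (auto simp: if_distrib[of "(*) _"] cong: if_cong)
  also have "\<dots> \<in> fs.span (delta ` M)"
    by (intro fs.span_sum fs.span_scale fs.span_base) auto
  finally show "c \<in> fs.span (delta ` M)" .
qed

lemma dim_supp_on:
  assumes "finite M" shows "fs.dim (supp_on M :: ('b \<Rightarrow> 'f::field) set) = card M"
proof -
  have inj: "inj_on (delta :: 'b \<Rightarrow> 'b \<Rightarrow> 'f) M"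
  proof (rule inj_onI)
    fix x y assume "(delta x :: 'b \<Rightarrow> 'f) = delta y"
    then have "(delta x x :: 'f) = delta y x" by simp
    then show "x = y" by (auto simp: delta_def split: if_splits)
  qed
  have ind: "fs.independent (delta ` M :: ('b \<Rightarrow> 'f) set)"
  proof (subst fs.independent_explicit_finite_subsets, safe)
    fix A :: "('b \<Rightarrow> 'f) set" and u a
    assume A: "A \<subseteq> delta ` M" "finite A" "(\<Sum>v\<in>A. (\<lambda>x. u v * v x)) = 0" and a: "a \<in> A"
    then obtain y where y: "y \<in> M" "a = delta y" by blast
    have "0 = (\<Sum>v\<in>A. u v * v y)" using fun_cong[OF A(3), of y] by (simp add: sum_fun_def)
    also have "\<dots> = (\<Sum>v\<in>A. if v = a then u a else 0)"
    proof (rule sum.cong[OF refl])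
      fix v assume "v \<in> A"
      then obtain z where "z \<in> M" "v = delta z" using A(1) by blast
      then show "u v * v y = (if v = a then u a else 0)"
        using y inj unfolding inj_on_def by (auto simp: delta_def)
    qed
    also have "\<dots> = u a" using A(2) a by simp
    finally show "u a = 0" by simp
  qed
  show ?thesis
    by (rule fs.dim_unique[of "delta ` M"])
      (use ind inj supp_on_span[OF assms] in \<open>auto simp: supp_on_def delta_def card_image split: if_splits\<close>)
qed

lemma supp_on_mono: "M \<subseteq> N \<Longrightarrow> supp_on M \<subseteq> supp_on N"
  unfolding supp_on_def by blast

lemma dim_kernel_image:
  assumes "lin g" "fs.subspace X" "finite M" "X \<subseteq> supp_on M"
  shows "fs.dim X = fs.dim {x \<in> X. g x = 0} + fs.dim (g ` X)"
  using fsp.dim_kernel_image[of g X "delta ` M"] assms supp_on_span[of M] lin_linear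
  by blast

lemma dim_zero: "fs.dim {0 :: 'b \<Rightarrow> 'f::field} = 0"
proof -
  have "supp_on {} = {0 :: 'b \<Rightarrow> 'f}" by (auto simp: supp_on_def fun_eq_iff)
  then show ?thesis using dim_supp_on[of "{} :: 'b set", where 'f = 'f] by simp
qed

lemma dim_inj_image:
  assumes "lin g" "fs.subspace X" "finite M" "X \<subseteq> supp_on M" "\<And>x. x \<in> X \<Longrightarrow> g x = 0 \<Longrightarrow> x = 0"
  shows "fs.dim (g ` X) = fs.dim X"
proof -
  have "{x \<in> X. g x = 0} = {0}"
    by (intro equalityI subsetI) (simp_all add: assms(5) fs.subspace_0[OF assms(2)] lin_0[OF assms(1)])
  then show ?thesis using dim_kernel_image[OF assms(1-4)] by (simp only: dim_zero)
qed

lemma dim_mono: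
  assumes "X \<subseteq> Y" "Y \<subseteq> supp_on M" "finite M"
  shows "fs.dim X \<le> fs.dim Y"
proof -
  obtain B where B: "B \<subseteq> X" "fs.independent B" "X \<subseteq> fs.span B" "card B = fs.dim X"
    using fs.basis_exists by blast
  obtain C where C: "B \<subseteq> C" "C \<subseteq> Y" "fs.independent C" "Y \<subseteq> fs.span C"
    using fs.maximal_independent_subset_extend[of B Y] B assms(1) by blast
  have "finite C"
    using fs.independent_span_bound[of "delta ` M" C] C(2,3) supp_on_span[OF assms(3)] assms(2,3) by blast
  moreover have "fs.dim Y = card C" by (rule fs.dim_unique[OF C(2,4,3) refl])
  ultimately show ?thesis using B(4) card_mono C(1) by metis
qed

lemma dim_strict_mono:
  assumes "fs.subspace X" "X \<subset> Y" "Y \<subseteq> supp_on M" "finite M"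
  shows "fs.dim X < fs.dim Y"
proof -
  obtain B where B: "B \<subseteq> X" "fs.independent B" "X \<subseteq> fs.span B" "card B = fs.dim X"
    using fs.basis_exists by blast
  obtain C where C: "B \<subseteq> C" "C \<subseteq> Y" "fs.independent C" "Y \<subseteq> fs.span C"
    using fs.maximal_independent_subset_extend[of B Y] B assms(2) by blast
  have "finite C"
    using fs.independent_span_bound[of "delta ` M" C] C(2,3) supp_on_span[OF assms(4)] assms(3,4) by blast
  moreover have "fs.dim Y = card C" by (rule fs.dim_unique[OF C(2,4,3) refl])
  moreover have "B \<noteq> C"
    using C(4) fs.span_minimal[OF B(1) assms(1)] assms(2) by blast
  ultimately show ?thesis using B(4) psubset_card_mono C(1) by (metis psubsetI)
qed

text \<open>The two sides count the dimension of the subspace X + Y of the direct sum, by the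
  projection to the first factor and by the map (x, y) to g x + y.\<close>
lemma dim_shift:
  fixes g :: "('b \<Rightarrow> 'f::field) \<Rightarrow> ('c \<Rightarrow> 'f)"
  assumes g: "lin g" and X: "fs.subspace X" "X \<subseteq> supp_on M" "finite M"
    and Y: "fs.subspace Y" "Y \<subseteq> supp_on N" "finite N"
  shows "fs.dim {x \<in> X. g x \<in> Y} + fs.dim {g x + y |x y. x \<in> X \<and> y \<in> Y} = fs.dim X + fs.dim Y"
proof -
  define Z where "Z = {z :: 'b + 'c \<Rightarrow> 'f. z \<circ> Inl \<in> X \<and> z \<circ> Inr \<in> Y}"
  have cs: "(case_sum x y \<circ> Inl) = x" "(case_sum x y \<circ> Inr) = y"
    for x :: "'b \<Rightarrow> 'f" and y :: "'c \<Rightarrow> 'f" by auto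
  have add: "(z + w) \<circ> Inl = (z \<circ> Inl) + (w \<circ> Inl)" "(z + w) \<circ> Inr = (z \<circ> Inr) + (w \<circ> Inr)"
    for z w :: "'b + 'c \<Rightarrow> 'f" by auto
  have sc: "(\<lambda>u. a * z u) \<circ> Inl = (\<lambda>u. a * (z \<circ> Inl) u)" "(\<lambda>u. a * z u) \<circ> Inr = (\<lambda>u. a * (z \<circ> Inr) u)"
    for a and z :: "'b + 'c \<Rightarrow> 'f" by auto
  have z0: "(0 :: 'b + 'c \<Rightarrow> 'f) \<circ> Inl = 0" "(0 :: 'b + 'c \<Rightarrow> 'f) \<circ> Inr = 0" by auto
  have Z: "fs.subspace Z"
    unfolding fs.subspace_def Z_def mem_Collect_eq add sc z0
    using fs.subspace_0[OF X(1)] fs.subspace_0[OF Y(1)] fs.subspace_add[OF X(1)] fs.subspace_add[OF Y(1)]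
      fs.subspace_scale[OF X(1)] fs.subspace_scale[OF Y(1)] by (simp add: o_def)
  let ?MN = "Inl ` M \<union> Inr ` N"
  have finMN: "finite ?MN" using X(3) Y(3) by simp
  have ZM: "Z \<subseteq> supp_on ?MN"
  proof
    fix z assume "z \<in> Z"
    then have "z \<circ> Inl \<in> supp_on M" "z \<circ> Inr \<in> supp_on N" using X(2) Y(2) by (auto simp: Z_def)
    then show "z \<in> supp_on ?MN"
      unfolding supp_on_def
    proof safe
      fix u assume a: "\<forall>x. (z \<circ> Inl) x \<noteq> 0 \<longrightarrow> x \<in> M" "\<forall>x. (z \<circ> Inr) x \<noteq> 0 \<longrightarrow> x \<in> N"
        and u: "z u \<noteq> 0" "u \<notin> Inr ` N"
      then show "u \<in> Inl ` M" by (cases u) auto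
    qed
  qed
  have l1: "lin (\<lambda>z :: 'b + 'c \<Rightarrow> 'f. z \<circ> Inl)" "lin (\<lambda>z :: 'b + 'c \<Rightarrow> 'f. z \<circ> Inr)"
    unfolding lin_def add sc by simp_all
  have l2: "lin (\<lambda>z :: 'b + 'c \<Rightarrow> 'f. g (z \<circ> Inl) + (z \<circ> Inr))"
    unfolding lin_def
  proof (intro conjI allI)
    fix x y :: "'b + 'c \<Rightarrow> 'f"
    show "g (x + y \<circ> Inl) + (x + y \<circ> Inr) = g (x \<circ> Inl) + (x \<circ> Inr) + (g (y \<circ> Inl) + (y \<circ> Inr))"
      unfolding add using g by (simp add: lin_def)
  next
    fix a and z :: "'b + 'c \<Rightarrow> 'f"
    have "g (\<lambda>u. a * (z \<circ> Inl) u) = (\<lambda>u. a * g (z \<circ> Inl) u)" using g unfolding lin_def by blast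
    then show "g ((\<lambda>u. a * z u) \<circ> Inl) + ((\<lambda>u. a * z u) \<circ> Inr) = (\<lambda>u. a * (g (z \<circ> Inl) + (z \<circ> Inr)) u)"
      unfolding sc by (simp only: fun_eq_iff plus_fun_apply distrib_left) simp
  qed
  have zz: "z = 0" if "z \<circ> Inl = 0" "z \<circ> Inr = 0" for z :: "'b + 'c \<Rightarrow> 'f"
  proof
    fix u show "z u = 0 u" using that by (cases u) (auto simp: fun_eq_iff)
  qed
  have "fs.dim Z = fs.dim {z \<in> Z. z \<circ> Inl = 0} + fs.dim ((\<lambda>z. z \<circ> Inl) ` Z)"
    by (rule dim_kernel_image[OF l1(1) Z finMN ZM])
  moreover have "(\<lambda>z. z \<circ> Inl) ` Z = X"
  proof (intro equalityI subsetI)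
    fix x assume "x \<in> X"
    then have "case_sum x 0 \<in> Z" using fs.subspace_0[OF Y(1)] by (simp add: Z_def cs)
    then show "x \<in> (\<lambda>z. z \<circ> Inl) ` Z" by (rule rev_image_eqI) (simp add: cs)
  qed (auto simp: Z_def)
  moreover have "fs.dim {z \<in> Z. z \<circ> Inl = 0} = fs.dim Y"
  proof -
    have sub: "fs.subspace {z \<in> Z. z \<circ> Inl = 0}"
      using fs.subspace_inter[OF Z fsp.linear_subspace_kernel[OF l1(1)[unfolded lin_linear]]] by (simp add: Int_def)
    have im: "(\<lambda>z. z \<circ> Inr) ` {z \<in> Z. z \<circ> Inl = 0} = Y"
    proof safe
      fix y assume "y \<in> Y"
      then have "case_sum 0 y \<in> {z \<in> Z. z \<circ> Inl = 0}" using fs.subspace_0[OF X(1)] by (simp add: Z_def cs)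
      then show "y \<in> (\<lambda>z. z \<circ> Inr) ` {z \<in> Z. z \<circ> Inl = 0}" by (rule rev_image_eqI) (simp add: cs)
    qed (auto simp: Z_def)
    show ?thesis
      by (subst im[symmetric], rule dim_inj_image[OF l1(2) sub finMN, symmetric]) (use ZM zz in auto)
  qed
  moreover have "fs.dim Z = fs.dim {z \<in> Z. g (z \<circ> Inl) + (z \<circ> Inr) = 0}
      + fs.dim ((\<lambda>z. g (z \<circ> Inl) + (z \<circ> Inr)) ` Z)"
    by (rule dim_kernel_image[OF l2 Z finMN ZM])
  moreover have "(\<lambda>z. g (z \<circ> Inl) + (z \<circ> Inr)) ` Z = {g x + y |x y. x \<in> X \<and> y \<in> Y}"
  proof safe
    fix x y assume "x \<in> X" "y \<in> Y"
    then have "case_sum x y \<in> Z" by (simp add: Z_def cs)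
    then show "g x + y \<in> (\<lambda>z. g (z \<circ> Inl) + (z \<circ> Inr)) ` Z"
      by (rule rev_image_eqI) (simp add: cs)
  qed (auto simp: Z_def)
  \<comment> \<open>The kernel is the graph of \<open>- g\<close> over
    \<open>{x \<in> X. g x \<in> Y}\<close>, so the first projection identifies the two.\<close>
  moreover have "fs.dim {z \<in> Z. g (z \<circ> Inl) + (z \<circ> Inr) = 0} = fs.dim {x \<in> X. g x \<in> Y}"
  proof -
    have sub: "fs.subspace {z \<in> Z. g (z \<circ> Inl) + (z \<circ> Inr) = 0}"
    proof -
      have "Vector_Spaces.linear (\<lambda>a c x. a * c x) (\<lambda>a c x. a * c x) (\<lambda>z. g (z \<circ> Inl) + (z \<circ> Inr))"
        using l2 by (simp add: lin_linear)
      from fs.subspace_inter[OF Z fsp.linear_subspace_kernel[OF this]]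
      show ?thesis by (simp add: Int_def)
    qed
    have im: "(\<lambda>z. z \<circ> Inl) ` {z \<in> Z. g (z \<circ> Inl) + (z \<circ> Inr) = 0} = {x \<in> X. g x \<in> Y}" (is "?L = ?R")
    proof
      show "?L \<subseteq> ?R"
      proof safe
        fix z assume z: "z \<in> Z" "g (z \<circ> Inl) + (z \<circ> Inr) = 0"
        then show "z \<circ> Inl \<in> X" by (simp add: Z_def)
        have "g (z \<circ> Inl) = - (z \<circ> Inr)" using z(2) by (simp add: eq_neg_iff_add_eq_0)
        then show "g (z \<circ> Inl) \<in> Y" using z(1) fs.subspace_neg[OF Y(1)] by (simp add: Z_def)
      qed
      show "?R \<subseteq> ?L"
      proof safe
        fix x assume x: "x \<in> X" "g x \<in> Y"
        show "x \<in> ?L" unfolding image_iff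
          by (rule bexI[of _ "case_sum x (- g x)"])
            (use x fs.subspace_neg[OF Y(1) x(2)] in \<open>auto simp: cs Z_def\<close>)
      qed
    qed
    have inj: "z = 0" if "z \<in> {z \<in> Z. g (z \<circ> Inl) + (z \<circ> Inr) = 0}" "z \<circ> Inl = 0" for z
      using that lin_0[OF g] by (intro zz) simp_all
    show ?thesis
      by (subst im[symmetric], rule dim_inj_image[OF l1(1) sub finMN _ inj, symmetric]) (use ZM in auto)
  qed
  ultimately show ?thesis by simp
qed

section \<open>Contractions and wedge products\<close>

text \<open>The sign of moving \<open>v\<close> past the smaller vertices of \<open>F\<close>, as in
  the oriented simplicial boundary.\<close>

definition esign :: "'a::linorder \<Rightarrow> 'a set \<Rightarrow> 'f::field" where
  "esign v F = (-1) ^ card {u \<in> F. u < v}"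

text \<open>Chains are read as elements of an exterior algebra with the vertices as basis; this is
  the interior product by the dual vector of \<open>v\<close>. Infinite \<open>F\<close> get the
  value 0 because the sign uses a cardinality.\<close>

definition cont :: "'a::linorder \<Rightarrow> ('a set \<Rightarrow> 'f::field) \<Rightarrow> 'a set \<Rightarrow> 'f" where
  "cont v c F = (if v \<in> F \<or> infinite F then 0 else esign v F * c (insert v F))"

text \<open>Interior product by the linear form with coefficients \<open>\<alpha>\<close>; all
  coefficients 1 give the simplicial boundary.\<close>

definition fcon :: "'a::linorder set \<Rightarrow> ('a \<Rightarrow> 'f::field) \<Rightarrow> ('a set \<Rightarrow> 'f) \<Rightarrow> 'a set \<Rightarrow> 'f" where
  "fcon Y \<alpha> c F = (\<Sum>v\<in>Y. \<alpha> v * cont v c F)"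

definition homog :: "nat \<Rightarrow> ('a set \<Rightarrow> 'f::field) \<Rightarrow> bool" where
  "homog s c \<longleftrightarrow> (\<forall>W. c W \<noteq> 0 \<longrightarrow> finite W \<and> card W = s)"

text \<open>The sign that sorts \<open>W\<close> followed by \<open>U\<close>: it counts the
  inversions between them.\<close>

definition wsign :: "'a::linorder set \<Rightarrow> 'a set \<Rightarrow> 'f::field" where
  "wsign W U = (-1) ^ card {(w, u). w \<in> W \<and> u \<in> U \<and> u < w}"

definition wedge :: "('a::linorder set \<Rightarrow> 'f::field) \<Rightarrow> ('a set \<Rightarrow> 'f) \<Rightarrow> 'a set \<Rightarrow> 'f" where
  "wedge b a F = (if finite F then \<Sum>W\<in>Pow F. wsign W (F - W) * b W * a (F - W) else 0)"

lemma esign_square [simp]: "esign v F * esign v F = 1"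
  unfolding esign_def by (simp flip: power_add mult_2)

lemma esign_square' [simp]: "esign v F * (esign v F * x) = x"
  by (simp flip: mult.assoc)

lemma esign_nonzero [simp]: "esign v F \<noteq> 0"
  unfolding esign_def by simp

lemma esign_insert:
  assumes "finite F" "u \<notin> F"
  shows "esign v (insert u F) = (if u < v then - esign v F else esign v F)"
proof -
  have "{w \<in> insert u F. w < v} = (if u < v then insert u {w \<in> F. w < v} else {w \<in> F. w < v})" by auto
  then show ?thesis using assms unfolding esign_def by auto
qed

lemma lin_cont: "lin (cont v)"
  unfolding lin_def cont_def by (auto simp: fun_eq_iff algebra_simps)

lemma cont_add: "cont v (x + y) = cont v x + cont v y"
  and cont_scale: "cont v (\<lambda>u. a * x u) = (\<lambda>u. a * cont v x u)"
  using lin_cont unfolding lin_def by blast+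

lemma lin_fcon: "lin (fcon Y \<alpha>)"
proof -
  have *: "fcon Y \<alpha> c = (\<lambda>F. \<Sum>v\<in>Y. \<alpha> v * cont v c F)" for c by (simp add: fcon_def fun_eq_iff)
  show ?thesis
    unfolding lin_def *
    by (simp add: cont_add cont_scale fun_eq_iff sum.distrib sum_distrib_left algebra_simps)
qed

lemma fcon_add: "fcon Y \<alpha> (x + y) = fcon Y \<alpha> x + fcon Y \<alpha> y"
  and fcon_scale: "fcon Y \<alpha> (\<lambda>u. a * x u) = (\<lambda>u. a * fcon Y \<alpha> x u)"
  using lin_fcon unfolding lin_def by blast+

lemma cont_0 [simp]: "cont v 0 = 0" by (rule lin_0[OF lin_cont])
lemma fcon_0 [simp]: "fcon Y \<alpha> 0 = 0" by (rule lin_0[OF lin_fcon])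

lemma cont_neg: "cont v (- x) = - cont v x"
  and cont_diff: "cont v (x - y) = cont v x - cont v y"
  by (auto simp: cont_def fun_eq_iff algebra_simps)

lemma fcon_neg: "fcon Y \<alpha> (- x) = - fcon Y \<alpha> x"
  and fcon_diff: "fcon Y \<alpha> (x - y) = fcon Y \<alpha> x - fcon Y \<alpha> y"
  by (auto simp: fcon_def cont_neg cont_diff fun_eq_iff algebra_simps sum_subtractf simp flip: sum_negf)

lemma cont_cont_same [simp]: "cont v (cont v c) = 0"
  unfolding cont_def by (auto simp: fun_eq_iff)

lemma cont_anticomm: "cont u (cont v c) = - cont v (cont u c)"
proof (cases "u = v")
  case False
  then show ?thesis
    unfolding cont_def fun_eq_iff
    by (cases "u < v") (auto simp: esign_insert insert_commute)
qed simp

lemma fcon_empty [simp]: "fcon {} \<alpha> c = 0"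
  by (simp add: fcon_def fun_eq_iff)

lemma fcon_insert:
  "finite Y \<Longrightarrow> y \<notin> Y \<Longrightarrow> fcon (insert y Y) \<alpha> c = (\<lambda>F. \<alpha> y * cont y c F) + fcon Y \<alpha> c"
  by (simp add: fcon_def fun_eq_iff)

lemma cont_fcon: "cont v (fcon Y \<alpha> c) = - fcon Y \<alpha> (cont v c)"
proof (induction Y rule: infinite_finite_induct)
  case (insert y Y)
  show ?case
    unfolding fcon_insert[OF insert.hyps(1,2)] cont_add cont_scale insert.IH cont_anticomm[of v y c]
    by (simp add: fun_eq_iff)
qed (simp_all add: fcon_def fun_eq_iff cont_def)

text \<open>Contractions anticommute, so the mixed terms cancel. This puts the image of a form into
  its kernel, which \<open>adjoin_form\<close> relies on.\<close>

lemma fcon_fcon_same [simp]: "fcon Y \<alpha> (fcon Y \<alpha> c) = 0"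
proof (induction Y arbitrary: c rule: infinite_finite_induct)
  case (insert y Y)
  have "fcon (insert y Y) \<alpha> (fcon (insert y Y) \<alpha> c)
    = (\<lambda>F. \<alpha> y * cont y (\<lambda>F. \<alpha> y * cont y c F) F) + (\<lambda>F. \<alpha> y * cont y (fcon Y \<alpha> c) F)
      + (fcon Y \<alpha> (\<lambda>F. \<alpha> y * cont y c F) + fcon Y \<alpha> (fcon Y \<alpha> c))"
    using insert.hyps by (simp add: fcon_insert cont_add fcon_add fun_eq_iff algebra_simps)
  also have "\<dots> = 0"
    using insert.IH by (simp add: cont_scale fcon_scale cont_fcon fun_eq_iff)
  finally show ?case .
qed (simp_all add: fcon_def fun_eq_iff)

lemma homog_0_cont:
  assumes "homog 0 c" shows "cont v c = 0"
proof
  fix F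
  have "c (insert v F) = 0" if "finite F"
  proof (rule ccontr)
    assume "c (insert v F) \<noteq> 0"
    then have "card (insert v F) = 0" using assms by (simp add: homog_def)
    then show False using that by simp
  qed
  then show "cont v c F = 0 F" by (simp add: cont_def)
qed

lemma wsign_insert_left:
  assumes "finite W" "finite U" "v \<notin> W"
  shows "wsign (insert v W) U = wsign W U * (esign v U :: 'f::field)"
proof -
  have "{(w, u). w \<in> insert v W \<and> u \<in> U \<and> u < w}
    = {(w, u). w \<in> W \<and> u \<in> U \<and> u < w} \<union> Pair v ` {u \<in> U. u < v}" by auto
  moreover have "finite {(w, u). w \<in> W \<and> u \<in> U \<and> u < w}"
    by (rule finite_subset[of _ "W \<times> U"]) (use assms in auto)
  ultimately have "card {(w, u). w \<in> insert v W \<and> u \<in> U \<and> u < w}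
    = card {(w, u). w \<in> W \<and> u \<in> U \<and> u < w} + card (Pair v ` {u \<in> U. u < v})"
    using assms by (simp, subst card_Un_disjoint) auto
  also have "card (Pair v ` {u \<in> U. u < v}) = card {u \<in> U. u < v}"
    by (rule card_image) (auto simp: inj_on_def)
  finally show ?thesis unfolding wsign_def esign_def by (simp add: power_add)
qed

lemma wsign_insert_right:
  assumes "finite W" "finite U" "v \<notin> U"
  shows "wsign W (insert v U) = wsign W U * (-1 :: 'f::field) ^ card {w \<in> W. v < w}"
proof -
  have "{(w, u). w \<in> W \<and> u \<in> insert v U \<and> u < w}
    = {(w, u). w \<in> W \<and> u \<in> U \<and> u < w} \<union> (\<lambda>w. (w, v)) ` {w \<in> W. v < w}" by auto
  moreover have "finite {(w, u). w \<in> W \<and> u \<in> U \<and> u < w}"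
    by (rule finite_subset[of _ "W \<times> U"]) (use assms in auto)
  ultimately have "card {(w, u). w \<in> W \<and> u \<in> insert v U \<and> u < w}
    = card {(w, u). w \<in> W \<and> u \<in> U \<and> u < w} + card ((\<lambda>w. (w, v)) ` {w \<in> W. v < w})"
    using assms by (simp, subst card_Un_disjoint) auto
  also have "card ((\<lambda>w. (w, v)) ` {w \<in> W. v < w}) = card {w \<in> W. v < w}"
    by (rule card_image) (auto simp: inj_on_def)
  finally show ?thesis unfolding wsign_def by (simp add: power_add)
qed

lemma esign_above:
  assumes "finite W" "v \<notin> W"
  shows "(-1) ^ card {w \<in> W. v < w} = (-1) ^ card W * (esign v W :: 'f::field)"
proof -
  have "W = {w \<in> W. w < v} \<union> {w \<in> W. v < w}" using assms(2) by (auto, metis antisym_conv3)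
  then have "card W = card ({w \<in> W. w < v} \<union> {w \<in> W. v < w})" by simp
  also have "\<dots> = card {w \<in> W. w < v} + card {w \<in> W. v < w}"
    by (rule card_Un_disjoint) (use assms in auto)
  finally show ?thesis unfolding esign_def
    by (simp add: power_add)
qed

lemma esign_Un:
  assumes "finite W" "finite U" "W \<inter> U = {}"
  shows "esign v (W \<union> U) = esign v W * (esign v U :: 'f::field)"
proof -
  have "{w \<in> W \<union> U. w < v} = {w \<in> W. w < v} \<union> {w \<in> U. w < v}" by auto
  then show ?thesis unfolding esign_def
    using assms by (simp, subst card_Un_disjoint) (auto simp: power_add)
qed

lemma sum_Pow_insert:
  assumes "finite G" "v \<notin> G"
  shows "(\<Sum>W\<in>Pow (insert v G). h W) = (\<Sum>W\<in>Pow G. h W) + (\<Sum>W\<in>Pow G. h (insert v W))"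
proof -
  have "(\<Sum>W\<in>Pow (insert v G). h W) = (\<Sum>W\<in>Pow G. h W) + (\<Sum>W\<in>insert v ` Pow G. h W)"
    unfolding Pow_insert by (rule sum.union_disjoint) (use assms in auto)
  also have "(\<Sum>W\<in>insert v ` Pow G. h W) = (\<Sum>W\<in>Pow G. h (insert v W))"
    by (subst sum.reindex) (use assms in \<open>auto simp: inj_on_def\<close>)
  finally show ?thesis .
qed

text \<open>The graded Leibniz rule. For \<open>v\<close> outside \<open>F\<close>, the subsets of
  \<open>insert v F\<close> that contain \<open>v\<close> give the first term and the others the
  second; the power of -1 comes from moving \<open>v\<close> past the \<open>p\<close> vertices of
  the left factor.\<close>

lemma cont_wedge:
  assumes b: "homog p b"
  shows "cont v (wedge b a) F = wedge (cont v b) a F + (-1) ^ p * wedge b (cont v a) F"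
proof (cases "finite F")
  case False
  then show ?thesis by (simp add: cont_def wedge_def)
next
  case fin: True
  show ?thesis
  proof (cases "v \<in> F")
    case False
    have D: "insert v F - W = insert v (F - W)" "F - insert v W = F - W" if "W \<in> Pow F" for W
      using that False by auto
    have e1: "cont v (wedge b a) F = (\<Sum>W\<in>Pow F. esign v F * (wsign W (insert v (F - W)) * b W * a (insert v (F - W))))
        + (\<Sum>W\<in>Pow F. esign v F * (wsign (insert v W) (F - W) * b (insert v W) * a (F - W)))"
    proof -
      have "wedge b a (insert v F) = (\<Sum>W\<in>Pow F. wsign W (insert v (F - W)) * b W * a (insert v (F - W)))
        + (\<Sum>W\<in>Pow F. wsign (insert v W) (F - W) * b (insert v W) * a (F - W))"
        unfolding wedge_def sum_Pow_insert[OF fin False] using fin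
        by simp (intro arg_cong2[of _ _ _ _ "(+)"] sum.cong refl, simp_all only: D)
      then show ?thesis using fin False by (simp add: cont_def distrib_left sum_distrib_left)
    qed
    have e2: "esign v F * (wsign (insert v W) (F - W) * b (insert v W) * a (F - W))
        = wsign W (F - W) * cont v b W * a (F - W)" if "W \<in> Pow F" for W
    proof -
      have W: "finite W" "finite (F - W)" "v \<notin> W" "W \<inter> (F - W) = {}" "W \<union> (F - W) = F"
        using that fin False finite_subset by auto
      show ?thesis
        using wsign_insert_left[OF W(1-3), where 'f = 'b] esign_Un[OF W(1,2,4), of v, where 'f = 'b] W
        by (simp add: cont_def mult_ac)
    qed
    have e3: "esign v F * (wsign W (insert v (F - W)) * b W * a (insert v (F - W)))
        = (-1) ^ p * (wsign W (F - W) * b W * cont v a (F - W))" if "W \<in> Pow F" for W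
    proof (cases "b W = 0")
      case bW: False
      then have "card W = p" using b by (auto simp: homog_def)
      moreover have W: "finite W" "finite (F - W)" "v \<notin> W" "v \<notin> F - W" "W \<inter> (F - W) = {}" "W \<union> (F - W) = F"
        using that fin False finite_subset by auto
      ultimately show ?thesis
        using wsign_insert_right[OF W(1,2,4), where 'f = 'b] esign_Un[OF W(1,2,5), of v, where 'f = 'b]
          esign_above[OF W(1,3), where 'f = 'b] W
        by (simp add: cont_def mult_ac)
    qed simp
    show ?thesis
      using e1 sum.cong[OF refl e2, of "Pow F"] sum.cong[OF refl e3, of "Pow F"] fin
      by (simp add: wedge_def sum_distrib_left)
  next
    \<comment> \<open>Here the left side vanishes by definition. On the right, the summand of the
      first product at \<open>W\<close> cancels that of the second product at
      \<open>insert v W\<close>.\<close>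
    case True
    define G where "G = F - {v}"
    have G: "finite G" "v \<notin> G" "F = insert v G" using fin True by (auto simp: G_def)
    have D: "insert v G - W = insert v (G - W)" "insert v G - insert v W = G - W" "v \<notin> W"
      if "W \<in> Pow G" for W
      using that G by auto
    have "wedge (cont v b) a F = (\<Sum>W\<in>Pow G. wsign W (insert v (G - W)) * cont v b W * a (insert v (G - W)))"
    proof -
      have "(\<Sum>W\<in>Pow G. wsign (insert v W) (insert v G - insert v W) * cont v b (insert v W) * a (insert v G - insert v W)) = 0"
        by (rule sum.neutral) (simp add: cont_def)
      moreover have "(\<Sum>W\<in>Pow G. wsign W (insert v G - W) * cont v b W * a (insert v G - W))
          = (\<Sum>W\<in>Pow G. wsign W (insert v (G - W)) * cont v b W * a (insert v (G - W)))"
        by (intro sum.cong refl) (simp only: D)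
      ultimately show ?thesis
        unfolding wedge_def G(3) sum_Pow_insert[OF G(1,2)] using G(1) by (simp only: if_True finite_insert add_0_right)
    qed
    moreover have "wedge b (cont v a) F = (\<Sum>W\<in>Pow G. wsign (insert v W) (G - W) * b (insert v W) * cont v a (G - W))"
    proof -
      have "(\<Sum>W\<in>Pow G. wsign W (insert v G - W) * b W * cont v a (insert v G - W)) = 0"
        by (rule sum.neutral) (use D(3) in \<open>simp add: cont_def\<close>)
      moreover have "(\<Sum>W\<in>Pow G. wsign (insert v W) (insert v G - insert v W) * b (insert v W) * cont v a (insert v G - insert v W))
          = (\<Sum>W\<in>Pow G. wsign (insert v W) (G - W) * b (insert v W) * cont v a (G - W))"
        by (intro sum.cong refl) (simp only: D)
      ultimately show ?thesis
        unfolding wedge_def G(3) sum_Pow_insert[OF G(1,2)] using G(1) by (simp only: if_True finite_insert add_0_left)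
    qed
    moreover have "wsign W (insert v (G - W)) * cont v b W * a (insert v (G - W))
        = - ((-1) ^ p * (wsign (insert v W) (G - W) * b (insert v W) * cont v a (G - W)))" if "W \<in> Pow G" for W
    proof (cases "b (insert v W) = 0")
      case bW: False
      have W: "finite W" "finite (G - W)" "v \<notin> W" "v \<notin> G - W"
        using that G finite_subset by auto
      have "card (insert v W) = p" using b bW by (auto simp: homog_def)
      then have "p = Suc (card W)" using W by simp
      then show ?thesis
        using wsign_insert_right[OF W(1,2,4), where 'f = 'b] wsign_insert_left[OF W(1-3), where 'f = 'b]
          esign_above[OF W(1,3), where 'f = 'b] W
        by (simp add: cont_def mult_ac)
    qed (use that G finite_subset[of W G] in \<open>auto simp: cont_def\<close>)
    ultimately have "wedge (cont v b) a F = - ((-1) ^ p * wedge b (cont v a) F)"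
      by (simp only: sum_distrib_left sum_negf cong: sum.cong)
    then show ?thesis using True by (simp add: cont_def)
  qed
qed

lemma lin_wedge_left: "lin (\<lambda>b. wedge b a)"
  unfolding lin_def
proof (intro conjI allI ext)
  fix x y :: "'a set \<Rightarrow> 'b" and F show "wedge (x + y) a F = (wedge x a + wedge y a) F"
    by (simp add: wedge_def distrib_left distrib_right sum.distrib)
next
  fix s and x :: "'a set \<Rightarrow> 'b" and F show "wedge (\<lambda>u. s * x u) a F = s * wedge x a F"
    by (auto simp add: wedge_def sum_distrib_left mult_ac intro!: sum.cong)
qed

lemma lin_wedge_right: "lin (wedge b)"
  unfolding lin_def
proof (intro conjI allI ext)
  fix x y :: "'a set \<Rightarrow> 'b" and F show "wedge b (x + y) F = (wedge b x + wedge b y) F"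
    by (simp add: wedge_def distrib_left distrib_right sum.distrib)
next
  fix s and x :: "'a set \<Rightarrow> 'b" and F show "wedge b (\<lambda>u. s * x u) F = s * wedge b x F"
    by (auto simp add: wedge_def sum_distrib_left mult_ac intro!: sum.cong)
qed

lemma wedge_add_left: "wedge (x + y) a = wedge x a + wedge y a"
  and wedge_scale_left: "wedge (\<lambda>u. s * x u) a = (\<lambda>u. s * wedge x a u)"
  using lin_wedge_left[of a] unfolding lin_def by blast+

lemma wedge_add_right: "wedge b (x + y) = wedge b x + wedge b y"
  and wedge_scale_right: "wedge b (\<lambda>u. s * x u) = (\<lambda>u. s * wedge b x u)"
  using lin_wedge_right[of b] unfolding lin_def by blast+

lemma wedge_0_left [simp]: "wedge 0 a = 0" by (rule lin_0[OF lin_wedge_left])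
lemma wedge_0_right [simp]: "wedge b 0 = 0" by (rule lin_0[OF lin_wedge_right])

lemma fcon_wedge:
  assumes "homog p b"
  shows "fcon Y \<alpha> (wedge b a) = wedge (fcon Y \<alpha> b) a + (\<lambda>F. (-1) ^ p * wedge b (fcon Y \<alpha> a) F)"
proof (induction Y rule: infinite_finite_induct)
  case (insert y Y)
  show ?case
    unfolding fcon_insert[OF insert.hyps(1,2)] wedge_add_left wedge_add_right wedge_scale_left
      wedge_scale_right insert.IH
    by (simp add: fun_eq_iff cont_wedge[OF assms, of y a] algebra_simps)
qed (simp_all add: fcon_def fun_eq_iff wedge_def)

lemma wedge_unit_left:
  assumes "homog 0 b" "finite F"
  shows "wedge b a F = b {} * a F"
proof -
  have z: "b W = 0" if "W \<in> Pow F - {{}}" for W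
    using that assms unfolding homog_def by (metis DiffD2 card_eq_0_iff insertI1)
  have "wedge b a F = (\<Sum>W\<in>{{}}. wsign W (F - W) * b W * a (F - W))"
    unfolding wedge_def if_P[OF assms(2)] by (rule sum.mono_neutral_right) (use assms z in auto)
  then show ?thesis by (simp add: wsign_def)
qed

lemma wedge_unit_right:
  assumes "homog 0 a" "finite F"
  shows "wedge b a F = b F * a {}"
proof -
  have z: "a (F - W) = 0" if "W \<in> Pow F - {F}" for W
  proof (rule ccontr)
    assume "a (F - W) \<noteq> 0"
    then have "F - W = {}" using assms unfolding homog_def by (metis card_eq_0_iff)
    then show False using that by blast
  qed
  have "wedge b a F = (\<Sum>W\<in>{F}. wsign W (F - W) * b W * a (F - W))"
    unfolding wedge_def if_P[OF assms(2)] by (rule sum.mono_neutral_right) (use assms z in auto)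
  then show ?thesis by (simp add: wsign_def)
qed

section \<open>Exactness of generic linear forms\<close>

definition linear_functional :: "('f::field poly \<Rightarrow> 'f) \<Rightarrow> bool" where
  "linear_functional l \<longleftrightarrow> (\<forall>p q. l (p + q) = l p + l q) \<and> (\<forall>a p. l (smult a p) = a * l p)"

text \<open>Homogeneous polynomial functions of degree k in the coefficients of a polynomial.\<close>
inductive poly_form :: "nat \<Rightarrow> ('f::field poly \<Rightarrow> 'f) \<Rightarrow> bool" where
  const: "poly_form 0 (\<lambda>_. a)"
| add: "poly_form k g \<Longrightarrow> poly_form k h \<Longrightarrow> poly_form k (\<lambda>p. g p + h p)"
| mul: "linear_functional l \<Longrightarrow> poly_form k g \<Longrightarrow> poly_form (Suc k) (\<lambda>p. l p * g p)"

lemma linear_functional_poly: "linear_functional (\<lambda>p. poly p x)"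
  and linear_functional_coeff: "linear_functional (\<lambda>p. coeff p i)"
  by (auto simp: linear_functional_def)

lemma linear_functional_scale: "linear_functional l \<Longrightarrow> linear_functional (\<lambda>p. a * l p)"
  by (auto simp: linear_functional_def algebra_simps)

lemma poly_form_zero: "poly_form k (\<lambda>_. 0)"
proof (induction k)
  case (Suc k)
  then show ?case using poly_form.mul[OF linear_functional_coeff[of 0] Suc] by simp
qed (rule poly_form.const)

lemma poly_form_scale: "poly_form k g \<Longrightarrow> poly_form k (\<lambda>p. a * g p)"
proof (induction rule: poly_form.induct)
  case (const b)
  then show ?case by (rule poly_form.const)
next
  case (add k g h)
  then show ?case using poly_form.add[OF add.IH] by (simp add: distrib_left)
next
  case (mul l k g)
  then show ?case using poly_form.mul[OF mul.hyps(1) mul.IH] by (simp add: mult.left_commute)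
qed

lemma poly_form_diff: "poly_form k g \<Longrightarrow> poly_form k h \<Longrightarrow> poly_form k (\<lambda>p. g p - h p)"
  using poly_form.add[of k g "\<lambda>p. - 1 * h p"] poly_form_scale[of k h "- 1"] by simp

lemma poly_form_sum: "(\<And>x. x \<in> A \<Longrightarrow> poly_form k (g x)) \<Longrightarrow> poly_form k (\<lambda>p. \<Sum>x\<in>A. g x p)"
  by (induction A rule: infinite_finite_induct) (auto intro: poly_form_zero poly_form.add)

lemma poly_form_comp:
  assumes "\<And>p q. T (p + q) = T p + T q" "\<And>a p. T (smult a p) = smult a (T p)"
  shows "poly_form k g \<Longrightarrow> poly_form k (\<lambda>p. g (T p))"
proof (induction rule: poly_form.induct)
  case (mul l k g)
  have "linear_functional (\<lambda>p. l (T p))" using mul.hyps(1) assms by (simp add: linear_functional_def)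
  then show ?case using mul.IH by (rule poly_form.mul)
qed (auto intro: poly_form.intros)

lemma poly_form_at_0: "poly_form k g \<Longrightarrow> k > 0 \<Longrightarrow> g 0 = 0"
proof (induction rule: poly_form.induct)
  case (mul l k g)
  have "l (smult 0 0) = 0 * l 0" using mul.hyps(1) unfolding linear_functional_def by blast
  then show ?case by simp
qed auto

lemma poly_form_0_const: "poly_form k g \<Longrightarrow> k = 0 \<Longrightarrow> g p = g q"
  by (induction rule: poly_form.induct) auto

text \<open>Subtracting the constant \<open>poly p x\<close> projects onto the hyperplane of
  polynomials vanishing at \<open>x\<close>. For a linear functional the difference is
  \<open>poly p x * l 1\<close>, and products follow by telescoping. Consequently a form that
  vanishes on the hyperplane is divisible by evaluation at \<open>x\<close>.\<close>

lemma poly_form_division: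
  "poly_form k g \<Longrightarrow> \<exists>g'. poly_form (k - 1) g' \<and> (\<forall>p. g p - g (p - [:poly p x:]) = poly p x * g' p)"
proof (induction rule: poly_form.induct)
  case (const a)
  then show ?case by (intro exI[of _ "\<lambda>_. 0"]) (auto intro: poly_form_zero)
next
  case (add k g h)
  from add.IH(1) obtain g' where g': "poly_form (k - 1) g'" "\<forall>p. g p - g (p - [:poly p x:]) = poly p x * g' p"
    by blast
  from add.IH(2) obtain h' where h': "poly_form (k - 1) h'" "\<forall>p. h p - h (p - [:poly p x:]) = poly p x * h' p"
    by blast
  have "g p + h p - (g (p - [:poly p x:]) + h (p - [:poly p x:])) = poly p x * (g' p + h' p)" for p
    using spec[OF g'(2), of p] spec[OF h'(2), of p] by (simp only: distrib_left add_diff_add)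
  then show ?case using poly_form.add[OF g'(1) h'(1)] by blast
next
  case (mul l k g)
  then obtain g' where g': "poly_form (k - 1) g'" "\<And>p. g p - g (p - [:poly p x:]) = poly p x * g' p" by blast
  have ladd: "l (p + q) = l p + l q" and lsc: "l (smult a p) = a * l p" for p q a
    using mul.hyps(1) by (auto simp: linear_functional_def)
  have l: "l p = l (p - [:poly p x:]) + poly p x * l 1" for p
  proof -
    have "l p = l ((p - [:poly p x:]) + smult (poly p x) 1)" by (simp add: one_pCons)
    then show ?thesis by (simp only: ladd lsc)
  qed
  have R: "poly_form k (\<lambda>p. l 1 * g (p - [:poly p x:]))"
    by (intro poly_form_scale poly_form_comp[of "\<lambda>p. p - [:poly p x:]"]) (auto intro: mul.hyps simp: algebra_simps smult_diff_right)
  show ?case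
  proof (cases k)
    \<comment> \<open>With truncated subtraction \<open>g'\<close> would have degree 0 and
      \<open>l p * g' p\<close> the wrong degree 1; but \<open>g\<close> is constant here, so that
      term is absent.\<close>
    case 0
    have "g p = g (p - [:poly p x:])" for p using poly_form_0_const[OF mul.hyps(2) 0] .
    then have "l p * g p - l (p - [:poly p x:]) * g (p - [:poly p x:])
        = poly p x * (l 1 * g (p - [:poly p x:]))" for p
    proof -
      have "l p * g p - l (p - [:poly p x:]) * g (p - [:poly p x:])
          = (l p - l (p - [:poly p x:])) * g (p - [:poly p x:])"
        by (subst poly_form_0_const[OF mul.hyps(2) 0, of p "p - [:poly p x:]"]) (simp add: left_diff_distrib)
      also have "l p - l (p - [:poly p x:]) = poly p x * l 1" using l[of p] by simp
      finally show ?thesis by simp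
    qed
    then show ?thesis using R 0 by (intro exI[of _ "\<lambda>p. l 1 * g (p - [:poly p x:])"]) simp
  next
    case (Suc j)
    have "poly_form k (\<lambda>p. l p * g' p)" using poly_form.mul[OF mul.hyps(1) g'(1)] Suc by simp
    moreover have "l p * g p - l (p - [:poly p x:]) * g (p - [:poly p x:])
        = poly p x * (l p * g' p + l 1 * g (p - [:poly p x:]))" for p
    proof -
      have "l p * g p - l (p - [:poly p x:]) * g (p - [:poly p x:])
          = l p * (g p - g (p - [:poly p x:])) + (l p - l (p - [:poly p x:])) * g (p - [:poly p x:])"
        by (simp add: algebra_simps)
      also have "l p - l (p - [:poly p x:]) = poly p x * l 1" using l[of p] by simp
      finally show ?thesis unfolding g'(2) by (simp add: algebra_simps)
    qed
    ultimately show ?thesis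
      using R by (intro exI[of _ "\<lambda>p. l p * g' p + l 1 * g (p - [:poly p x:])"]) (auto intro: poly_form.add)
  qed
qed

lemma poly_form_line: "poly_form k g \<Longrightarrow> \<exists>P. \<forall>t. g (p + smult t q) = poly P t"
proof (induction rule: poly_form.induct)
  case (const a)
  then show ?case by (intro exI[of _ "[:a:]"]) simp
next
  case (add k g h)
  then show ?case by (metis poly_add)
next
  case (mul l k g)
  then obtain P where P: "\<And>t. g (p + smult t q) = poly P t" by blast
  have "l (p + smult t q) = poly [:l p, l q:] t" for t using mul.hyps(1) by (simp add: linear_functional_def)
  then show ?case using P by (intro exI[of _ "[:l p, l q:] * P"] allI) (simp only: poly_mult)
qed

definition polys_below :: "nat \<Rightarrow> 'f::field poly set" where
  "polys_below m = {p. \<forall>i\<ge>m. coeff p i = 0}"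

text \<open>Along the line \<open>p + smult t 1\<close> the evaluation at \<open>x\<close> vanishes
  for a single \<open>t\<close>, while \<open>y\<close> is a polynomial in \<open>t\<close>. Over an
  infinite field it has too many roots to be nonzero.\<close>

lemma poly_form_cancel:
  fixes y :: "'f::field poly \<Rightarrow> 'f"
  assumes inf: "infinite (UNIV :: 'f set)" and y: "poly_form k y"
    and z: "\<And>p. p \<in> polys_below (Suc m) \<Longrightarrow> poly p x * y p = 0" and p: "p \<in> polys_below (Suc m)"
  shows "y p = 0"
proof -
  obtain P where P: "\<And>t. y (p + smult t 1) = poly P t" using poly_form_line[OF y] by blast
  have "poly P t = 0" if "t \<noteq> - poly p x" for t
  proof -
    have "p + smult t 1 \<in> polys_below (Suc m)" using p by (auto simp: polys_below_def one_pCons coeff_pCons split: nat.splits)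
    from z[OF this] have "poly (p + smult t 1) x * poly P t = 0" by (simp only: P)
    then have "(poly p x + t) * poly P t = 0" by simp
    moreover have "poly p x + t \<noteq> 0" using that by (metis add_eq_0_iff add.commute)
    ultimately show ?thesis by simp
  qed
  then have "UNIV - {- poly p x} \<subseteq> {t. poly P t = 0}" by auto
  then have "infinite {t. poly P t = 0}"
    using inf by (meson finite_Diff2 finite_insert finite.emptyI infinite_super)
  then have "P = 0" using poly_roots_finite by blast
  then show ?thesis using P[of 0] by simp
qed

text \<open>Linearity allows \<open>synthetic_div\<close> to be substituted into a
  \<open>poly_form\<close>. As a left inverse of multiplication by \<open>[:- c, 1:]\<close> it
  extends data from the hyperplane of polynomials vanishing at \<open>c\<close> to all
  polynomials.\<close>

lemma synthetic_div_add: "synthetic_div (p + q) c = synthetic_div p c + synthetic_div q c"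
proof -
  have "(p + q) + smult c (synthetic_div p c + synthetic_div q c)
      = (p + smult c (synthetic_div p c)) + (q + smult c (synthetic_div q c))"
    by (simp add: smult_add_right add_ac)
  also have "\<dots> = pCons (poly p c + poly q c) (synthetic_div p c + synthetic_div q c)"
    by (simp only: synthetic_div_correct add_pCons)
  finally show ?thesis using synthetic_div_unique by metis
qed

lemma synthetic_div_smult: "synthetic_div (smult a p) c = smult a (synthetic_div p c)"
proof -
  have "smult a p + smult c (smult a (synthetic_div p c)) = smult a (p + smult c (synthetic_div p c))"
    by (simp add: smult_add_right mult.commute)
  also have "\<dots> = pCons (a * poly p c) (smult a (synthetic_div p c))"
    by (simp only: synthetic_div_correct smult_pCons)
  finally show ?thesis using synthetic_div_unique by metis
qed

lemma synthetic_div_mult: "synthetic_div ([:- c, 1:] * p) c = (p :: 'f::field poly)"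
proof -
  have "[:- c, 1:] * p + smult c p = pCons 0 p" by (simp add: smult_minus_left)
  then show ?thesis using synthetic_div_unique by metis
qed

lemma polys_below_mult: "p \<in> polys_below m \<Longrightarrow> [:- c, 1:] * p \<in> polys_below (Suc m)"
  by (auto simp: polys_below_def coeff_pCons split: nat.splits)

lemma polys_below_synthetic_div: "p \<in> polys_below (Suc m) \<Longrightarrow> synthetic_div p c \<in> polys_below m"
proof -
  assume p: "p \<in> polys_below (Suc m)"
  have "degree p \<le> m" using p by (intro degree_le) (auto simp: polys_below_def)
  then have "degree (synthetic_div p c) < m \<or> synthetic_div p c = 0"
    by (metis degree_synthetic_div diff_is_0_eq diff_less le_0_eq less_le_trans less_one
        nat_less_le not_less synthetic_div_eq_0_iff zero_less_diff zero_less_one)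
  then show ?thesis by (auto simp: polys_below_def intro: coeff_eq_0)
qed

text \<open>For \<open>U = {}\<close> and \<open>\<kappa> = 1\<close> the weights at
  \<open>p\<close> are those of the combination, with the coefficients of \<open>p\<close>, of the
  forms \<open>\<alpha> v ^ l\<close>; a monomial picks out one of them. The factors
  \<open>\<kappa>\<close> collect what arises on restriction to hyperplanes.\<close>

definition pairing_weight :: "'a set \<Rightarrow> ('a \<Rightarrow> 'f::field) \<Rightarrow> ('a \<Rightarrow> 'f) \<Rightarrow> 'f poly \<Rightarrow> 'a \<Rightarrow> 'f" where
  "pairing_weight U \<kappa> \<alpha> p v = (if v \<in> U then 1 else \<kappa> v * poly p (\<alpha> v))"

text \<open>The primitive is required to be given by a linear operator H, because H can then be applied to
  chains that depend polynomially on parameters.\<close>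
definition acyclic_at :: "'f::field itself \<Rightarrow> 'a::linorder set \<Rightarrow> 'a set set \<Rightarrow> nat \<Rightarrow> bool" where
  "acyclic_at _ Y \<Gamma> q \<longleftrightarrow> (\<exists>H :: 'a set \<Rightarrow> 'a set \<Rightarrow> 'f.
     (\<forall>W W'. H W W' \<noteq> 0 \<longrightarrow> W \<in> \<Gamma> \<and> card W = Suc q) \<and>
     (\<forall>c. (\<forall>W. c W \<noteq> 0 \<longrightarrow> W \<in> \<Gamma> \<and> card W = q) \<and> fcon Y (\<lambda>_. 1) c = 0 \<longrightarrow>
        fcon Y (\<lambda>_. 1) (\<lambda>W. \<Sum>W'\<in>\<Gamma>. H W W' * c W') = c))"

lemma fcon_cong: "(\<And>v. v \<in> Y \<Longrightarrow> \<alpha> v = \<beta> v) \<Longrightarrow> fcon Y \<alpha> c = fcon Y \<beta> c"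
  by (simp add: fcon_def fun_eq_iff)

text \<open>Scaling the basis vector of \<open>v\<close> by \<open>l\<close> turns its weight from
  \<open>l\<close> into 1. For \<open>l = 0\<close> this still holds but cannot be undone, which is
  why divisibility becomes an issue in \<open>exact_pairing\<close>.\<close>

lemma fcon_scale_vertex:
  assumes "v \<in> Y" "finite Y"
  shows "fcon Y (\<alpha>(v := 1)) (\<lambda>W. if v \<in> W then l * x W else x W) F
    = (if v \<in> F then l * fcon Y (\<alpha>(v := l)) x F else fcon Y (\<alpha>(v := l)) x F)"
proof (cases "v \<in> F")
  case True
  then show ?thesis
    unfolding fcon_def by (auto simp: sum_distrib_left cont_def intro!: sum.cong)
next
  case False
  then show ?thesis
    unfolding fcon_def by (auto simp: cont_def intro!: sum.cong)
qed

lemma fcon_split: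
  assumes "v \<in> Y" "finite Y"
  shows "fcon Y \<alpha> x F = \<alpha> v * cont v x F + fcon (Y - {v}) \<alpha> x F"
  unfolding fcon_def using assms by (simp add: sum.remove)

text \<open>The reason for the grading \<open>i + card (W \<inter> U)\<close>: removing a vertex
  outside \<open>U\<close> costs a weight of degree 1, removing one in \<open>U\<close> lowers the
  cardinality by 1, so the contraction always raises \<open>i\<close> by exactly 1.\<close>

lemma poly_form_fcon:
  fixes b :: "'a::linorder set \<Rightarrow> 'f::field poly \<Rightarrow> 'f"
  assumes Y: "finite Y"
    and b: "\<And>W. W \<subseteq> Y \<Longrightarrow> poly_form (i + card (W \<inter> U)) (b W)" and F: "F \<subseteq> Y"
  shows "poly_form (Suc i + card (F \<inter> U)) (\<lambda>p. fcon Y (pairing_weight U \<kappa> \<alpha> p) (\<lambda>W. b W p) F)"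
  unfolding fcon_def
proof (rule poly_form_sum)
  fix v assume v: "v \<in> Y"
  have fin: "finite F" using F Y finite_subset by blast
  show "poly_form (Suc i + card (F \<inter> U)) (\<lambda>p. pairing_weight U \<kappa> \<alpha> p v * cont v (\<lambda>W. b W p) F)"
  proof (cases "v \<in> F")
    case True
    then show ?thesis by (simp add: cont_def poly_form_zero)
  next
    case vF: False
    have bv: "poly_form (i + card (insert v F \<inter> U)) (\<lambda>p. esign v F * b (insert v F) p)"
      by (rule poly_form_scale, rule b) (use F v in auto)
    show ?thesis
    proof (cases "v \<in> U")
      case True
      then show ?thesis using bv vF fin by (simp add: cont_def pairing_weight_def)
    next
      case False
      then have "poly_form (Suc (i + card (F \<inter> U))) (\<lambda>p. (\<kappa> v * poly p (\<alpha> v)) * (esign v F * b (insert v F) p))"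
        using bv by (intro poly_form.mul linear_functional_scale linear_functional_poly) simp
      then show ?thesis using False vF fin by (simp add: cont_def pairing_weight_def)
    qed
  qed
qed

lemma link_link:
  assumes "\<forall>B\<in>\<Gamma>. \<forall>A. A \<subseteq> B \<longrightarrow> A \<in> \<Gamma>" "A \<in> link \<Gamma> B"
  shows "link (link \<Gamma> B) A = link \<Gamma> (B \<union> A)"
proof -
  have *: "D \<in> \<Gamma>" if "(B \<union> A) \<union> C \<in> \<Gamma>" "D \<subseteq> (B \<union> A) \<union> C" for C D
    using assms(1) that by blast
  have "C \<in> \<Gamma> \<and> B \<union> C \<in> \<Gamma> \<and> A \<union> C \<in> \<Gamma>" if "(B \<union> A) \<union> C \<in> \<Gamma>" for C
    using *[OF that, of C] *[OF that, of "B \<union> C"] *[OF that, of "A \<union> C"] by blast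
  then have "C \<in> link (link \<Gamma> B) A \<longleftrightarrow> C \<in> link \<Gamma> (B \<union> A)" for C
    using assms(2) unfolding link_def mem_Collect_eq Un_assoc Int_Un_distrib2 Int_Un_distrib Un_empty by blast
  then show ?thesis by blast
qed

lemma link_down:
  assumes "\<forall>B\<in>\<Gamma>. \<forall>A. A \<subseteq> B \<longrightarrow> A \<in> \<Gamma>" "C \<in> link \<Gamma> B" "A \<subseteq> C"
  shows "A \<in> link \<Gamma> B"
proof -
  have C: "C \<in> \<Gamma>" "B \<inter> C = {}" "B \<union> C \<in> \<Gamma>" using assms(2) by (auto simp: link_def)
  have "A \<in> \<Gamma>" using assms(1) C(1) assms(3) by blast
  moreover have "B \<union> A \<in> \<Gamma>" using assms(1) C(3) Un_mono[OF order_refl assms(3), of B] by blast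
  ultimately show ?thesis using C(2) assms(3) unfolding link_def by blast
qed

lemma link_vertex:
  assumes "\<forall>B\<in>\<Gamma>. \<forall>A. A \<subseteq> B \<longrightarrow> A \<in> \<Gamma>"
  shows "W \<in> link \<Gamma> {v} \<longleftrightarrow> v \<notin> W \<and> insert v W \<in> \<Gamma>"
proof -
  have "W \<in> \<Gamma>" if "insert v W \<in> \<Gamma>" using assms that subset_insertI[of W v] by blast
  then show ?thesis by (auto simp: link_def)
qed

text \<open>The vertices in U have weight 1 and the others are linear forms in general position. Turning the
  weight of a vertex v into a unit enlarges the complex by a complex on the link of v over the
  hyperplane where that form vanishes; the polynomials there are [:- \<alpha> v, 1:] * p, so that it is
  again of the same kind, with one variable less.\<close>
lemma exact_pairing:
  fixes \<Gamma> :: "'a::linorder set set" and c :: "'a set \<Rightarrow> 'f::field poly \<Rightarrow> 'f"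
  assumes inf: "infinite (UNIV :: 'f set)" and Y: "finite Y"
  shows "\<lbrakk>finite (Y - U); \<Gamma> \<subseteq> Pow Y; \<forall>B\<in>\<Gamma>. \<forall>A. A \<subseteq> B \<longrightarrow> A \<in> \<Gamma>;
      \<forall>A\<in>\<Gamma>. card A < m \<longrightarrow> acyclic_at TYPE('f) Y (link \<Gamma> A) q;
      inj_on \<alpha> Y; \<forall>v\<in>Y. \<kappa> v \<noteq> 0;
      \<forall>W. poly_form (Suc i + card (W \<inter> U)) (c W);
      \<forall>W p. c W p \<noteq> 0 \<longrightarrow> W \<in> \<Gamma> \<and> card W = q;
      \<forall>p\<in>polys_below m. fcon Y (pairing_weight U \<kappa> \<alpha> p) (\<lambda>W. c W p) = 0\<rbrakk>
    \<Longrightarrow> \<exists>b. (\<forall>W. poly_form (i + card (W \<inter> U)) (b W)) \<and>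
      (\<forall>W p. b W p \<noteq> 0 \<longrightarrow> W \<in> \<Gamma> \<and> card W = Suc q) \<and>
      (\<forall>p\<in>polys_below m. fcon Y (pairing_weight U \<kappa> \<alpha> p) (\<lambda>W. b W p) = (\<lambda>W. c W p))"
proof (induction "card (Y - U)" arbitrary: U \<Gamma> m \<kappa> c rule: less_induct)
  case less
  note \<Gamma>Y = less.prems(2) and down = less.prems(3) and acyc = less.prems(4) and inj = less.prems(5)
    and \<kappa> = less.prems(6) and hpc = less.prems(7) and suppc = less.prems(8) and closed = less.prems(9)
  have finsub: "finite W" if "W \<subseteq> Y" for W using that Y finite_subset by blast
  show ?case
  proof (cases m)
    \<comment> \<open>Only the zero polynomial remains, and \<open>c\<close> vanishes there because
      its degree is positive.\<close>
    case 0
    have "c W 0 = 0" for W by (rule poly_form_at_0[OF hpc[rule_format]]) simp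
    moreover have "p = 0" if "p \<in> polys_below m" for p :: "'f poly"
      using that 0 by (simp add: polys_below_def poly_eq_iff)
    ultimately have "c W p = 0" if "p \<in> polys_below m" for W p
      using that by blast
    moreover have "fcon Y \<beta> (\<lambda>W. 0) = (\<lambda>W. 0 :: 'f)" for \<beta>
      by (auto simp: fcon_def cont_def fun_eq_iff intro!: sum.neutral)
    ultimately show ?thesis
      by (intro exI[of _ "\<lambda>_ _. 0"]) (simp add: poly_form_zero fun_eq_iff)
  next
    case (Suc m')
    show ?thesis
    proof (cases "Y \<subseteq> U")
      case True
      show ?thesis
      proof (cases "{} \<in> \<Gamma>")
        case False
        then have "\<Gamma> = {}" using down by blast
        then have "c W p = 0" for W p using suppc by blast
        then show ?thesis
          by (intro exI[of _ "\<lambda>_ _. 0"]) (auto simp: poly_form_zero fcon_def cont_def fun_eq_iff intro!: sum.neutral)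
      next
        case e: True
        have "link \<Gamma> {} = \<Gamma>" by (auto simp: link_def)
        then have "acyclic_at TYPE('f) Y \<Gamma> q" using acyc e Suc by fastforce
        then obtain H :: "'a set \<Rightarrow> 'a set \<Rightarrow> 'f" where H: "\<And>W W'. H W W' \<noteq> 0 \<Longrightarrow> W \<in> \<Gamma> \<and> card W = Suc q"
          "\<And>c. (\<forall>W. c W \<noteq> 0 \<longrightarrow> W \<in> \<Gamma> \<and> card W = q) \<Longrightarrow> fcon Y (\<lambda>_. 1) c = 0 \<Longrightarrow>
            fcon Y (\<lambda>_. 1) (\<lambda>W. \<Sum>W'\<in>\<Gamma>. H W W' * c W') = c"
          unfolding acyclic_at_def by blast
        have wt: "fcon Y (pairing_weight U \<kappa> \<alpha> p) x = fcon Y (\<lambda>_. 1) x" for p and x :: "'a set \<Rightarrow> 'f"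
          by (rule fcon_cong) (use True in \<open>auto simp: pairing_weight_def\<close>)
        \<comment> \<open>All weights are 1, so one linear operator \<open>H\<close> serves every
          \<open>p\<close>. The degrees agree because \<open>i + Suc q = Suc i + q\<close>.\<close>
        define b where "b = (\<lambda>W p. \<Sum>W'\<in>\<Gamma>. H W W' * c W' p)"
        have "poly_form (i + card (W \<inter> U)) (b W)" for W
        proof (cases "W \<in> \<Gamma> \<and> card W = Suc q")
          case W: True
          then have WU: "W \<inter> U = W" using \<Gamma>Y True by blast
          show ?thesis unfolding b_def
          proof (rule poly_form_sum)
            fix W' assume "W' \<in> \<Gamma>"
            show "poly_form (i + card (W \<inter> U)) (\<lambda>p. H W W' * c W' p)"
            proof (cases "card W' = q")
              case True
              have "W' \<inter> U = W'" using \<Gamma>Y \<open>W' \<in> \<Gamma>\<close> \<open>Y \<subseteq> U\<close> by blast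
              then show ?thesis using hpc[rule_format, of W'] True W WU by (auto intro: poly_form_scale)
            next
              case False
              then have "c W' p = 0" for p using suppc by blast
              then show ?thesis by (simp add: poly_form_zero)
            qed
          qed
        next
          case False
          then have "H W W' = 0" for W' using H(1) by blast
          then show ?thesis unfolding b_def by (simp add: poly_form_zero)
        qed
        moreover have "W \<in> \<Gamma> \<and> card W = Suc q" if "b W p \<noteq> 0" for W p
        proof -
          from that obtain W' where "H W W' \<noteq> 0" unfolding b_def by (metis (no_types, lifting) mult_zero_left sum.neutral)
          then show ?thesis by (rule H(1))
        qed
        moreover have "fcon Y (pairing_weight U \<kappa> \<alpha> p) (\<lambda>W. b W p) = (\<lambda>W. c W p)" if "p \<in> polys_below m" for p
          unfolding wt b_def using H(2)[of "\<lambda>W. c W p"] suppc closed that unfolding wt by blast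
        ultimately show ?thesis by blast
      qed
    next
      case False
      then obtain v where v: "v \<in> Y" "v \<notin> U" by blast
      define U' where "U' = insert v U"
      have less': "card (Y - U') < card (Y - U)"
        unfolding U'_def by (rule psubset_card_mono) (use Y v in auto)
      have finU': "finite (Y - U')" using Y by simp
      define ell where "ell p = \<kappa> v * poly p (\<alpha> v)" for p
      have wtU': "pairing_weight U' \<kappa> \<alpha> p = (pairing_weight U \<kappa> \<alpha> p)(v := 1)"
        and wtU: "(pairing_weight U \<kappa> \<alpha> p)(v := ell p) = pairing_weight U \<kappa> \<alpha> p" for p
        using v by (auto simp: pairing_weight_def U'_def ell_def fun_eq_iff)
      have cardU': "card (W \<inter> U') = (if v \<in> W then Suc (card (W \<inter> U)) else card (W \<inter> U))" if "W \<subseteq> Y" for W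
        using finsub[OF that] v by (auto simp: U'_def Int_insert_right)
      \<comment> \<open>Scaling by \<open>ell p\<close> on the faces with \<open>v\<close> yields a
        cycle for the weight 1 at \<open>v\<close>. Its primitive \<open>b'\<close> has to be scaled
        back, so its part on those faces must first be made divisible by
        \<open>ell p\<close>.\<close>
      define c' where "c' W p = (if v \<in> W then ell p * c W p else c W p)" for W p
      have hpc': "\<forall>W. poly_form (Suc i + card (W \<inter> U')) (c' W)"
      proof
        fix W show "poly_form (Suc i + card (W \<inter> U')) (c' W)"
        proof (cases "W \<subseteq> Y")
          case True
          show ?thesis
          proof (cases "v \<in> W")
            case vW: True
            have "poly_form (Suc (Suc i + card (W \<inter> U))) (\<lambda>p. ell p * c W p)"
              unfolding ell_def by (intro poly_form.mul linear_functional_scale linear_functional_poly) (use hpc in blast)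
            then show ?thesis using vW True unfolding c'_def by (simp add: cardU')
          next
            case False
            then have "c' W = c W" by (simp add: c'_def fun_eq_iff)
            then show ?thesis using False True hpc by (simp add: cardU')
          qed
        next
          case False
          then have "c W p = 0" for p using suppc \<Gamma>Y by blast
          then have "c' W = (\<lambda>_. 0)" by (simp add: c'_def fun_eq_iff)
          then show ?thesis by (simp add: poly_form_zero)
        qed
      qed
      have suppc': "\<forall>W p. c' W p \<noteq> 0 \<longrightarrow> W \<in> \<Gamma> \<and> card W = q"
        using suppc by (auto simp: c'_def split: if_splits)
      have closed': "\<forall>p\<in>polys_below m. fcon Y (pairing_weight U' \<kappa> \<alpha> p) (\<lambda>W. c' W p) = 0"
      proof
        fix p :: "'f poly" assume p: "p \<in> polys_below m"
        have "fcon Y (pairing_weight U' \<kappa> \<alpha> p) (\<lambda>W. c' W p) F = 0" for F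
          unfolding wtU' c'_def
          using fcon_scale_vertex[OF v(1) Y, of "pairing_weight U \<kappa> \<alpha> p" "ell p" "\<lambda>W. c W p" F]
            closed[rule_format, OF p]
          unfolding wtU by simp
        then show "fcon Y (pairing_weight U' \<kappa> \<alpha> p) (\<lambda>W. c' W p) = 0" by (simp add: fun_eq_iff)
      qed
      obtain b' where hpb': "\<And>W. poly_form (i + card (W \<inter> U')) (b' W)"
        and suppb': "\<And>W p. b' W p \<noteq> 0 \<Longrightarrow> W \<in> \<Gamma> \<and> card W = Suc q"
        and b': "\<And>p. p \<in> polys_below m \<Longrightarrow> fcon Y (pairing_weight U' \<kappa> \<alpha> p) (\<lambda>W. b' W p) = (\<lambda>W. c' W p)"
        using less.hyps[OF less' finU' \<Gamma>Y down acyc inj \<kappa> hpc' suppc' closed'] by blast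
      \<comment> \<open>The part of \<open>b'\<close> on the faces with \<open>v\<close>, moved to
        the link of \<open>v\<close>. By anticommutation its contraction is a multiple of
        \<open>ell p\<close>, so \<open>b1\<close> is a cycle on the hyperplane where
        \<open>ell\<close> vanishes.\<close>
      define b1 where "b1 W p = cont v (\<lambda>W. b' W p) W" for W p
      define \<Gamma>' where "\<Gamma>' = link \<Gamma> {v}"
      have \<Gamma>'Y: "\<Gamma>' \<subseteq> Pow Y" using \<Gamma>Y by (auto simp: \<Gamma>'_def link_def)
      have down': "\<forall>B\<in>\<Gamma>'. \<forall>A. A \<subseteq> B \<longrightarrow> A \<in> \<Gamma>'"
        unfolding \<Gamma>'_def using link_down[OF down] by blast
      have \<Gamma>'I: "W \<in> \<Gamma>'" if "v \<notin> W" "insert v W \<in> \<Gamma>" for W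
        using that link_vertex[OF down] unfolding \<Gamma>'_def by blast
      have \<Gamma>'D: "v \<notin> W" "insert v W \<in> \<Gamma>" "W \<in> \<Gamma>" "W \<subseteq> Y" if "W \<in> \<Gamma>'" for W
        using that \<Gamma>Y unfolding \<Gamma>'_def link_def by auto
      have acyc': "\<forall>A\<in>\<Gamma>'. card A < m' \<longrightarrow> acyclic_at TYPE('f) Y (link \<Gamma>' A) q"
      proof safe
        fix A assume A: "A \<in> \<Gamma>'" "card A < m'"
        then have "card (insert v A) < m" using \<Gamma>'D[OF A(1)] finsub Suc by simp
        then have "acyclic_at TYPE('f) Y (link \<Gamma> (insert v A)) q" using acyc \<Gamma>'D[OF A(1)] by blast
        then show "acyclic_at TYPE('f) Y (link \<Gamma>' A) q"
          using link_link[OF down, of A "{v}"] A(1) unfolding \<Gamma>'_def by simp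
      qed
      \<comment> \<open>On a multiple of \<open>[:- \<alpha> v, 1:]\<close> the evaluation at
        \<open>\<alpha> u\<close> gains the factor \<open>\<alpha> u - \<alpha> v\<close>, nonzero
        by injectivity. The vertex \<open>v\<close> lies in \<open>U'\<close> and has weight 1; the
        value 1 only keeps \<open>\<kappa>'\<close> nonzero.\<close>
      define \<kappa>' where "\<kappa>' u = (if u = v then 1 else \<kappa> u * (\<alpha> u - \<alpha> v))" for u
      have \<kappa>': "\<forall>u\<in>Y. \<kappa>' u \<noteq> 0"
        using \<kappa> inj v unfolding \<kappa>'_def inj_on_def by auto
      have wt': "fcon Y (pairing_weight U' \<kappa>' \<alpha> p) x = fcon Y (pairing_weight U' \<kappa> \<alpha> ([:- \<alpha> v, 1:] * p)) x"
        for p and x :: "'a set \<Rightarrow> 'f"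
        by (rule fcon_cong) (auto simp: pairing_weight_def \<kappa>'_def U'_def algebra_simps)
      have hpb1: "poly_form (Suc i + card (W \<inter> U')) (b1 W)" for W
      proof (cases "v \<notin> W \<and> insert v W \<subseteq> Y")
        case True
        then have "poly_form (i + card (insert v W \<inter> U')) (\<lambda>p. esign v W * b' (insert v W) p)"
          by (intro poly_form_scale hpb')
        moreover have "card (insert v W \<inter> U') = Suc (card (W \<inter> U'))"
          using True cardU'[of "insert v W"] cardU'[of W] v by (simp add: Int_insert_left)
        moreover have "b1 W = (\<lambda>p. esign v W * b' (insert v W) p)"
          using True finsub[of W] by (auto simp: b1_def cont_def fun_eq_iff)
        ultimately show ?thesis by simp
      next
        case False
        have "b1 W p = 0" for p
        proof (rule ccontr)
          assume "b1 W p \<noteq> 0"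
          then have "v \<notin> W" "b' (insert v W) p \<noteq> 0" by (auto simp: b1_def cont_def split: if_splits)
          then show False using suppb'[of "insert v W" p] \<Gamma>Y False by blast
        qed
        then have "b1 W = (\<lambda>_. 0)" by (simp add: fun_eq_iff)
        then show ?thesis by (simp add: poly_form_zero)
      qed
      have suppb1: "W \<in> \<Gamma>' \<and> card W = q" if "b1 W p \<noteq> 0" for W p
      proof -
        have W: "v \<notin> W" "finite W" "b' (insert v W) p \<noteq> 0"
          using that by (auto simp: b1_def cont_def split: if_splits)
        then show ?thesis using suppb'[OF W(3)] \<Gamma>'I by simp
      qed
      have cont_c': "cont v (\<lambda>W. c' W p) = (\<lambda>W. ell p * cont v (\<lambda>W. c W p) W)" for p
        by (auto simp: cont_def c'_def fun_eq_iff)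
      have b1_eq: "fcon Y (pairing_weight U' \<kappa> \<alpha> p) (\<lambda>W. b1 W p) = - cont v (\<lambda>W. c' W p)"
        if "p \<in> polys_below m" for p
        using cont_fcon[of v Y "pairing_weight U' \<kappa> \<alpha> p" "\<lambda>W. b' W p"] b'[OF that]
        unfolding b1_def by simp
      let ?M = "\<lambda>p. [:- \<alpha> v, 1:] * p"
      define c2 where "c2 W p = b1 W (?M p)" for W p
      have hpc2: "\<forall>W. poly_form (Suc i + card (W \<inter> U')) (c2 W)"
        unfolding c2_def by (intro allI poly_form_comp[of ?M] hpb1) (simp_all only: distrib_left mult_smult_right)
      have suppc2: "\<forall>W p. c2 W p \<noteq> 0 \<longrightarrow> W \<in> \<Gamma>' \<and> card W = q"
        unfolding c2_def using suppb1 by blast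
      have closed2: "\<forall>p\<in>polys_below m'. fcon Y (pairing_weight U' \<kappa>' \<alpha> p) (\<lambda>W. c2 W p) = 0"
      proof
        fix p :: "'f poly" assume "p \<in> polys_below m'"
        then have p: "?M p \<in> polys_below m" unfolding Suc by (rule polys_below_mult)
        have "ell (?M p) = 0" by (simp add: ell_def)
        then show "fcon Y (pairing_weight U' \<kappa>' \<alpha> p) (\<lambda>W. c2 W p) = 0"
          unfolding wt' c2_def b1_eq[OF p] cont_c' by (simp only:) (simp add: fun_eq_iff)
      qed
      obtain \<tau> where hpt: "\<And>W. poly_form (i + card (W \<inter> U')) (\<tau> W)"
        and suppt: "\<And>W p. \<tau> W p \<noteq> 0 \<Longrightarrow> W \<in> \<Gamma>' \<and> card W = Suc q"
        and \<tau>: "\<And>p. p \<in> polys_below m' \<Longrightarrow> fcon Y (pairing_weight U' \<kappa>' \<alpha> p) (\<lambda>W. \<tau> W p) = (\<lambda>W. c2 W p)"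
        using less.hyps[OF less' finU' \<Gamma>'Y down' acyc' inj \<kappa>' hpc2 suppc2 closed2] by blast
      let ?T = "\<lambda>p. synthetic_div p (\<alpha> v)"
      \<comment> \<open>The primitive found on the hyperplane is extended to all \<open>p\<close> by
        division, linearly in \<open>p\<close>, which preserves its degree.\<close>
      define t where "t W p = \<tau> W (?T p)" for W p
      have hpt': "poly_form (i + card (W \<inter> U')) (t W)" for W
        unfolding t_def by (intro poly_form_comp[of ?T] hpt) (simp_all add: synthetic_div_add synthetic_div_smult)
      have suppt': "W \<in> \<Gamma>' \<and> card W = Suc q" if "t W p \<noteq> 0" for W p
        using that suppt unfolding t_def by blast
      \<comment> \<open>Correcting \<open>b1\<close> by a boundary in the link makes it vanish on
        the hyperplane, and \<open>poly_form_division\<close> then extracts the factor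
        \<open>poly p (\<alpha> v)\<close>.\<close>
      define e where "e W p = b1 W p - fcon Y (pairing_weight U' \<kappa> \<alpha> p) (\<lambda>W. t W p) W" for W p
      have suppe: "W \<in> \<Gamma>' \<and> card W = q" if "e W p \<noteq> 0" for W p
      proof (rule ccontr)
        assume no: "\<not> (W \<in> \<Gamma>' \<and> card W = q)"
        then have "b1 W p = 0" using suppb1 by blast
        moreover have "cont u (\<lambda>W. t W p) W = 0" for u
        proof (rule ccontr)
          assume "cont u (\<lambda>W. t W p) W \<noteq> 0"
          then have u: "u \<notin> W" "finite W" "t (insert u W) p \<noteq> 0"
            by (auto simp: cont_def split: if_splits)
          then have "insert u W \<in> \<Gamma>'" "card W = q" using suppt'[OF u(3)] by simp_all
          then show False using no down' by blast
        qed
        ultimately show False using that by (simp add: e_def fcon_def)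
      qed
      have hpe: "poly_form (Suc i + card (W \<inter> U')) (e W)" if "W \<subseteq> Y" for W
        unfolding e_def by (intro poly_form_diff hpb1 poly_form_fcon[OF Y] hpt' that)
      have e_zero: "e W (?M p) = 0" if "p \<in> polys_below m'" for p W
        using \<tau>[OF that] unfolding e_def t_def synthetic_div_mult wt' c2_def by simp
      have "\<exists>e'. poly_form (i + card (W \<inter> U')) e' \<and> (\<forall>p\<in>polys_below m. e W p = poly p (\<alpha> v) * e' p)
          \<and> (\<forall>p. e' p \<noteq> 0 \<longrightarrow> W \<in> \<Gamma>' \<and> card W = q)" for W
      proof (cases "W \<in> \<Gamma>' \<and> card W = q")
        case True
        then have WY: "W \<subseteq> Y" using \<Gamma>'Y by blast
        obtain e' where e': "poly_form (Suc i + card (W \<inter> U') - 1) e'"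
          "\<And>p. e W p - e W (p - [:poly p (\<alpha> v):]) = poly p (\<alpha> v) * e' p"
          using poly_form_division[OF hpe[OF WY], of "\<alpha> v"] by blast
        have "e W p = poly p (\<alpha> v) * e' p" if "p \<in> polys_below m" for p
        proof -
          have "p - [:poly p (\<alpha> v):] = ?M (?T p)"
            using synthetic_div_correct'[of "\<alpha> v" p] by (metis add_diff_cancel_right')
          moreover have "?T p \<in> polys_below m'" using that unfolding Suc by (rule polys_below_synthetic_div)
          ultimately have "e W (p - [:poly p (\<alpha> v):]) = 0" using e_zero by metis
          then show ?thesis using e'(2)[of p] by simp
        qed
        then show ?thesis using e'(1) True by auto
      next
        case False
        then have "e W p = 0" for p using suppe by blast
        then show ?thesis by (intro exI[of _ "\<lambda>_. 0"]) (simp add: poly_form_zero)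
      qed
      then obtain e' where hpe': "\<And>W. poly_form (i + card (W \<inter> U')) (e' W)"
        and e': "\<And>W p. p \<in> polys_below m \<Longrightarrow> e W p = poly p (\<alpha> v) * e' W p"
        and suppe': "\<And>W p. e' W p \<noteq> 0 \<Longrightarrow> W \<in> \<Gamma>' \<and> card W = q" by metis
      \<comment> \<open>On faces with \<open>v\<close> the corrected part is divided by
        \<open>ell p\<close>, which is \<open>\<kappa> v\<close> times the extracted factor. On the
        other faces, adding \<open>t\<close> makes up for the passage from \<open>b1\<close> to
        \<open>e\<close>.\<close>
      define b where "b W p = (if v \<in> W then (esign v (W - {v}) / \<kappa> v) * e' (W - {v}) p else b' W p + t W p)" for W p
      have \<kappa>v: "\<kappa> v \<noteq> 0" using \<kappa> v by blast
      have hpb: "poly_form (i + card (W \<inter> U)) (b W)" for W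
      proof (cases "v \<in> W")
        case True
        then have "b W = (\<lambda>p. (esign v (W - {v}) / \<kappa> v) * e' (W - {v}) p)" by (simp add: b_def fun_eq_iff)
        moreover have "(W - {v}) \<inter> U' = W \<inter> U" using v by (auto simp: U'_def)
        ultimately show ?thesis
          using poly_form_scale[OF hpe', of "W - {v}" "esign v (W - {v}) / \<kappa> v"] by (simp only:)
      next
        case False
        then have "b W = (\<lambda>p. b' W p + t W p)" by (simp add: b_def fun_eq_iff)
        moreover have "W \<inter> U' = W \<inter> U" using False by (auto simp: U'_def)
        ultimately show ?thesis using poly_form.add[OF hpb' hpt', of W] by simp
      qed
      have suppb: "W \<in> \<Gamma> \<and> card W = Suc q" if "b W p \<noteq> 0" for W p
      proof (cases "v \<in> W")
        case True
        then have "e' (W - {v}) p \<noteq> 0" using that by (auto simp: b_def)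
        then have W: "W - {v} \<in> \<Gamma>'" "card (W - {v}) = q" using suppe' by blast+
        have "insert v (W - {v}) = W" using True by blast
        then show ?thesis using \<Gamma>'D[OF W(1)] W(2) finsub[of "W - {v}"] True
          by (metis card_insert_disjoint)
      next
        case False
        then have "b' W p \<noteq> 0 \<or> t W p \<noteq> 0" using that by (auto simp: b_def)
        then show ?thesis
        proof
          assume "b' W p \<noteq> 0"
          then show ?thesis by (rule suppb')
        next
          assume "t W p \<noteq> 0"
          then show ?thesis using suppt'[of W p] \<Gamma>'D(3)[of W] by simp
        qed
      qed
      have contb: "ell p * cont v (\<lambda>W. b W p) W = e W p" if "p \<in> polys_below m" for p W
      proof (cases "v \<in> W \<or> infinite W")
        case True
        then have "W \<notin> \<Gamma>'" using \<Gamma>'D(1,4)[of W] finsub[of W] by blast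
        then have "e W p = 0" using suppe[of W p] by blast
        then show ?thesis using True by (simp add: cont_def)
      next
        case False
        then show ?thesis using \<kappa>v e'[OF that, of W] by (simp add: cont_def b_def ell_def)
      qed
      have main: "fcon Y (pairing_weight U \<kappa> \<alpha> p) (\<lambda>W. b W p) F = c F p" if p: "p \<in> polys_below m" "v \<notin> F" for p F
      proof -
        have wv: "pairing_weight U \<kappa> \<alpha> p v = ell p" "pairing_weight U' \<kappa> \<alpha> p v = 1"
          using v by (auto simp: pairing_weight_def ell_def U'_def)
        have rest: "fcon (Y - {v}) (pairing_weight U \<kappa> \<alpha> p) (\<lambda>W. b W p) F
            = fcon (Y - {v}) (pairing_weight U' \<kappa> \<alpha> p) (\<lambda>W. b' W p) F
              + fcon (Y - {v}) (pairing_weight U' \<kappa> \<alpha> p) (\<lambda>W. t W p) F"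
          unfolding fcon_def sum.distrib[symmetric] wtU'
          by (rule sum.cong) (use p(2) in \<open>auto simp: cont_def b_def algebra_simps\<close>)
        have t0: "cont v (\<lambda>W. t W p) F = 0"
          using suppt'[of "insert v F" p] \<Gamma>'D(1)[of "insert v F"] by (auto simp: cont_def)
        have "fcon Y (pairing_weight U \<kappa> \<alpha> p) (\<lambda>W. b W p) F
            = e F p + fcon Y (pairing_weight U' \<kappa> \<alpha> p) (\<lambda>W. b' W p) F - b1 F p
              + fcon Y (pairing_weight U' \<kappa> \<alpha> p) (\<lambda>W. t W p) F"
          unfolding fcon_split[OF v(1) Y] wv rest contb[OF p(1)] t0 b1_def by simp
        also have "\<dots> = c' F p" unfolding b'[OF p(1)] e_def by simp
        finally show ?thesis using p(2) by (simp add: c'_def)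
      qed
      \<comment> \<open>The remaining defect. On faces with \<open>v\<close> only its multiple by
        \<open>poly p (\<alpha> v)\<close> is seen to vanish, through the contraction of
        \<open>e\<close>; \<open>poly_form_cancel\<close> removes the factor.\<close>
      define y where "y F p = fcon Y (pairing_weight U \<kappa> \<alpha> p) (\<lambda>W. b W p) F - c F p" for F p
      have y0: "poly p (\<alpha> v) * y F p = 0" if p: "p \<in> polys_below m" and F: "v \<in> F" "F \<subseteq> Y" for F p
      proof -
        define G where "G = F - {v}"
        have G: "v \<notin> G" "finite G" "insert v G = F" using F finsub[OF F(2)] by (auto simp: G_def)
        let ?w = "pairing_weight U \<kappa> \<alpha> p" and ?w' = "pairing_weight U' \<kappa> \<alpha> p"
        have ev: "cont v (\<lambda>W. e W p) = 0"
        proof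
          fix W show "cont v (\<lambda>W. e W p) W = 0 W"
            using suppe[of "insert v W" p] \<Gamma>'D(1)[of "insert v W"] by (auto simp: cont_def)
        qed
        have e2: "(\<lambda>W. e W p) = (\<lambda>W. b1 W p) - fcon Y ?w' (\<lambda>W. t W p)"
          by (simp add: e_def fun_eq_iff)
        have "fcon Y ?w (\<lambda>W. e W p) = fcon Y ?w' (\<lambda>W. e W p)"
          unfolding fun_eq_iff fcon_split[OF v(1) Y] ev
          by (auto simp: fcon_def wtU' intro!: sum.cong)
        also have "\<dots> = - cont v (\<lambda>W. c' W p)"
          unfolding e2 fcon_diff b1_eq[OF p] by simp
        finally have fe: "fcon Y ?w (\<lambda>W. e W p) = - cont v (\<lambda>W. c' W p)" .
        have "ell p * cont v (\<lambda>F. y F p) G = ell p * cont v (fcon Y ?w (\<lambda>W. b W p)) G - ell p * cont v (\<lambda>F. c F p) G"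
          using G by (simp add: cont_def y_def algebra_simps)
        also have "ell p * cont v (fcon Y ?w (\<lambda>W. b W p)) G = - fcon Y ?w (\<lambda>W. ell p * cont v (\<lambda>W. b W p) W) G"
          unfolding cont_fcon fcon_scale by simp
        also have "(\<lambda>W. ell p * cont v (\<lambda>W. b W p) W) = (\<lambda>W. e W p)" using contb[OF p] by (simp add: fun_eq_iff)
        also have "- fcon Y ?w (\<lambda>W. e W p) G - ell p * cont v (\<lambda>F. c F p) G = 0"
          unfolding fe cont_c' by simp
        finally have "ell p * (esign v G * y F p) = 0" using G by (simp add: cont_def)
        then show ?thesis using \<kappa>v by (simp add: ell_def)
      qed
      have y1: "y F p = 0" if "p \<in> polys_below m" for F p
      proof (cases "F \<subseteq> Y \<and> v \<in> F")
        case True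
        have "poly_form (Suc i + card (F \<inter> U)) (y F)"
          unfolding y_def by (intro poly_form_diff poly_form_fcon[OF Y] hpb) (use True hpc in auto)
        then show ?thesis
          by (rule poly_form_cancel[OF inf, where x = "\<alpha> v" and m = m']) (use y0 True that Suc in auto)
      next
        case False
        show ?thesis
        proof (cases "v \<in> F")
          case True
          then have nF: "\<not> F \<subseteq> Y" using False by blast
          then have "c F p = 0" using suppc \<Gamma>Y by blast
          moreover have "cont u (\<lambda>W. b W p) F = 0" for u
          proof -
            have "b (insert u F) p = 0" using suppb[of "insert u F" p] nF \<Gamma>Y by blast
            then show ?thesis by (simp add: cont_def)
          qed
          ultimately show ?thesis by (simp add: y_def fcon_def)
        next
          case False
          then show ?thesis using main[OF that] by (simp add: y_def)
        qed
      qed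
      show ?thesis
        by (rule exI[of _ b]) (use hpb suppb y1 in \<open>auto simp: y_def fun_eq_iff\<close>)
    qed
  qed
qed

lemma poly_sum_below:
  assumes "p \<in> polys_below (Suc j)"
  shows "poly p x = (\<Sum>l\<le>j. coeff p l * x ^ l)"
proof -
  have "degree p \<le> j" using assms by (intro degree_le) (auto simp: polys_below_def)
  then show ?thesis
    unfolding poly_altdef by (intro sum.mono_neutral_left) (auto intro: coeff_eq_0)
qed

text \<open>The family \<open>coeff p j * c W\<close> is linear in \<open>p\<close>, so
  \<open>exact_pairing\<close> gives a primitive of degree 0, a single chain. Testing it at the
  monomials of degree \<open>l \<le> j\<close> separates the required equations.\<close>

lemma exact_forms:
  fixes \<Gamma> :: "'a::linorder set set" and c :: "'a set \<Rightarrow> 'f::field"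
  assumes inf: "infinite (UNIV :: 'f set)" and Y: "finite Y" "\<Gamma> \<subseteq> Pow Y"
    and down: "\<forall>B\<in>\<Gamma>. \<forall>A. A \<subseteq> B \<longrightarrow> A \<in> \<Gamma>"
    and acyc: "\<forall>A\<in>\<Gamma>. card A \<le> j \<longrightarrow> acyclic_at TYPE('f) Y (link \<Gamma> A) s"
    and inj: "inj_on \<alpha> Y"
    and c: "c \<in> supp_on {W \<in> \<Gamma>. card W = s}"
    and closed: "\<And>l. l \<le> j \<Longrightarrow> fcon Y (\<lambda>v. \<alpha> v ^ l) c = 0"
  obtains b where "b \<in> supp_on {W \<in> \<Gamma>. card W = Suc s}" "fcon Y (\<lambda>v. \<alpha> v ^ j) b = c"
    "\<And>l. l < j \<Longrightarrow> fcon Y (\<lambda>v. \<alpha> v ^ l) b = 0"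
proof -
  let ?w = "pairing_weight {} (\<lambda>_. 1) \<alpha>"
  have w: "?w p v = (\<Sum>l\<le>j. coeff p l * \<alpha> v ^ l)" if "p \<in> polys_below (Suc j)" for p v
    using poly_sum_below[OF that] by (simp add: pairing_weight_def)
  define c' where "c' W p = coeff p j * c W" for W p
  have 1: "\<forall>W. poly_form (Suc 0 + card (W \<inter> {})) (c' W)"
    unfolding c'_def by (simp add: poly_form.mul[OF linear_functional_coeff poly_form.const, simplified])
  have 2: "\<forall>W p. c' W p \<noteq> 0 \<longrightarrow> W \<in> \<Gamma> \<and> card W = s"
    using c by (auto simp: c'_def supp_on_def)
  have 3: "\<forall>p\<in>polys_below (Suc j). fcon Y (?w p) (\<lambda>W. c' W p) = 0"
  proof
    fix p :: "'f poly" assume p: "p \<in> polys_below (Suc j)"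
    have "fcon Y (?w p) c F = 0" for F
    proof -
      have "fcon Y (?w p) c F = (\<Sum>v\<in>Y. \<Sum>l\<le>j. coeff p l * (\<alpha> v ^ l * cont v c F))"
        by (simp only: fcon_def w[OF p] sum_distrib_right mult.assoc)
      also have "\<dots> = (\<Sum>l\<le>j. coeff p l * fcon Y (\<lambda>v. \<alpha> v ^ l) c F)"
        by (subst sum.swap) (simp add: fcon_def sum_distrib_left)
      finally show ?thesis using closed by simp
    qed
    then show "fcon Y (?w p) (\<lambda>W. c' W p) = 0"
      unfolding c'_def fcon_scale by (simp add: fun_eq_iff)
  qed
  have acyc': "\<forall>A\<in>\<Gamma>. card A < Suc j \<longrightarrow> acyclic_at TYPE('f) Y (link \<Gamma> A) s"
    using acyc by (simp add: less_Suc_eq_le)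
  have "finite (Y - {})" "\<forall>v\<in>Y. (1 :: 'f) \<noteq> 0" using Y(1) by simp_all
  note ex = exact_pairing[OF inf Y(1) this(1) Y(2) down acyc' inj this(2) 1 2 3]
  obtain b where b: "\<And>W. poly_form (0 + card (W \<inter> {})) (b W)"
      "\<And>W p. b W p \<noteq> 0 \<Longrightarrow> W \<in> \<Gamma> \<and> card W = Suc s"
      "\<And>p. p \<in> polys_below (Suc j) \<Longrightarrow> fcon Y (?w p) (\<lambda>W. b W p) = (\<lambda>W. c' W p)"
    using ex by blast
  define B where "B W = b W 0" for W
  have bB: "b W p = B W" for W p
    unfolding B_def using poly_form_0_const[OF b(1)] by simp
  have key: "fcon Y (\<lambda>v. \<alpha> v ^ l) B = (\<lambda>W. (if l = j then 1 else 0) * c W)" if "l \<le> j" for l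
  proof -
    have mon: "monom 1 l \<in> polys_below (Suc j)" using that by (auto simp: polys_below_def)
    have "?w (monom 1 l) = (\<lambda>v. \<alpha> v ^ l)" by (simp add: pairing_weight_def poly_monom fun_eq_iff)
    then show ?thesis using b(3)[OF mon] by (simp add: bB c'_def)
  qed
  show ?thesis
  proof (rule that[of B])
    show "B \<in> supp_on {W \<in> \<Gamma>. card W = Suc s}" using b(2) by (auto simp: supp_on_def B_def)
    show "fcon Y (\<lambda>v. \<alpha> v ^ j) B = c" using key[of j] by simp
    show "fcon Y (\<lambda>v. \<alpha> v ^ l) B = 0" if "l < j" for l using key[of l] that by (simp add: fun_eq_iff)
  qed
qed

section \<open>Extension of scalars\<close>

lemma sum_delta_fun:
  fixes c :: "'b \<Rightarrow> 'f::field"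
  assumes "finite M" "c \<in> supp_on M"
  shows "c = (\<Sum>x\<in>M. (\<lambda>y. c x * delta x y))"
  unfolding fun_eq_iff sum_fun_def delta_def
  using assms by (auto simp: supp_on_def if_distrib[of "(*) _"] cong: if_cong)

lemma lin_sum:
  assumes "lin g" shows "g (\<Sum>x\<in>M. (\<lambda>y. a x * h x y)) = (\<Sum>x\<in>M. (\<lambda>y. a x * g (h x) y))"
proof (induction M rule: infinite_finite_induct)
  case (insert x M)
  have "g (x + y) = g x + g y" "g (\<lambda>u. a * x u) = (\<lambda>u. a * g x u)" for x y a
    using assms unfolding lin_def by blast+
  then show ?case by (simp only: sum.insert[OF insert.hyps(1,2)] insert.IH)
qed (use lin_0[OF assms] in \<open>simp_all add: zero_fun_def\<close>)

text \<open>A contracting homotopy over the small field has a matrix, and the homotopy identity is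
  an identity between matrix entries; applying \<open>\<iota>\<close> entrywise transports it to the
  large field.\<close>

lemma acyclic_at_extension:
  fixes \<Gamma> :: "'a::linorder set set" and \<iota> :: "'k::field \<Rightarrow> 'f::field"
  assumes \<iota>: "\<And>x y. \<iota> (x + y) = \<iota> x + \<iota> y" "\<And>x y. \<iota> (x * y) = \<iota> x * \<iota> y" "\<iota> 1 = 1"
    and Y: "finite Y" "\<Gamma> \<subseteq> Pow Y"
    and exact: "\<And>c :: 'a set \<Rightarrow> 'k. c \<in> supp_on {W \<in> \<Gamma>. card W = q} \<Longrightarrow> fcon Y (\<lambda>_. 1) c = 0 \<Longrightarrow>
      \<exists>b \<in> supp_on {W \<in> \<Gamma>. card W = Suc q}. fcon Y (\<lambda>_. 1) b = c"
  shows "acyclic_at TYPE('f) Y \<Gamma> q"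
proof -
  let ?D = "fcon Y (\<lambda>_. 1 :: 'k) :: ('a set \<Rightarrow> 'k) \<Rightarrow> _" and ?D' = "fcon Y (\<lambda>_. 1 :: 'f) :: ('a set \<Rightarrow> 'f) \<Rightarrow> _"
  let ?S = "\<lambda>n. {W \<in> \<Gamma>. card W = n}"
  have \<iota>0: "\<iota> 0 = 0" using \<iota>(1)[of 0 0] by (metis add.right_neutral add_left_cancel)
  have \<iota>neg: "\<iota> (- x) = - \<iota> x" for x using \<iota>(1)[of x "- x"] \<iota>0 by (simp add: eq_neg_iff_add_eq_0 add.commute)
  have \<iota>diff: "\<iota> (x - y) = \<iota> x - \<iota> y" for x y using \<iota>(1)[of x "- y"] \<iota>neg by simp
  have \<iota>sum: "\<iota> (sum h A) = (\<Sum>x\<in>A. \<iota> (h x))" for h and A :: "'a set set"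
    by (induction A rule: infinite_finite_induct) (simp_all add: \<iota> \<iota>0)
  have \<iota>sum': "\<iota> (sum h A) = (\<Sum>x\<in>A. \<iota> (h x))" for h and A :: "'a set"
    by (induction A rule: infinite_finite_induct) (simp_all add: \<iota> \<iota>0)
  have \<iota>pow: "\<iota> (x ^ n) = \<iota> x ^ n" for x n by (induction n) (simp_all add: \<iota>)
  have \<iota>esign: "\<iota> (esign v F) = esign v F" for v :: 'a and F by (simp add: esign_def \<iota>pow \<iota>neg \<iota>)
  have \<iota>D: "\<iota> (?D x F) = ?D' (\<lambda>W. \<iota> (x W)) F" for x F
    by (simp add: fcon_def \<iota>sum' \<iota> cont_def \<iota>esign \<iota>0 if_distrib cong: if_cong)
  have fin: "finite \<Gamma>" "finite (?S n)" for n using finite_subset[OF Y(2)] Y(1) by auto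
  have linD: "Vector_Spaces.linear (\<lambda>a c x. a * c x) (\<lambda>a c x. a * c x) ?D" using lin_fcon lin_linear by blast
  obtain g1 where g1: "range g1 \<subseteq> supp_on (?S (Suc q))" "lin g1"
      "\<And>z. z \<in> ?D ` supp_on (?S (Suc q)) \<Longrightarrow> ?D (g1 z) = z"
    using fsp.linear_exists_right_inverse_on[OF linD subspace_supp_on[of "?S (Suc q)"]]
    unfolding lin_linear[symmetric] by blast
  obtain g2 where g2: "range g2 \<subseteq> supp_on (?S q)" "lin g2"
      "\<And>z. z \<in> ?D ` supp_on (?S q) \<Longrightarrow> ?D (g2 z) = z"
    using fsp.linear_exists_right_inverse_on[OF linD subspace_supp_on[of "?S q"]]
    unfolding lin_linear[symmetric] by blast
  \<comment> \<open>\<open>g1\<close> and \<open>g2\<close> are linear right inverses of the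
    boundary, on its images from sizes \<open>Suc q\<close> and \<open>q\<close>. The identity
    \<open>?D (h c) = c - g2 (?D c)\<close> holds on all chains of size \<open>q\<close>, not just
    on cycles, so it may be tested on basis elements.\<close>
  define h where "h c = g1 (c - g2 (?D c))" for c
  have h: "?D (h c) F = c F - g2 (?D c) F" if c: "c \<in> supp_on (?S q)" for c F
  proof -
    have "?D (g2 (?D c)) = ?D c" by (rule g2(3)) (use c in blast)
    then have z: "?D (c - g2 (?D c)) = 0" by (simp only: fcon_diff diff_self)
    have "g2 (?D c) \<in> supp_on (?S q)" using g2(1) by blast
    then have m: "c - g2 (?D c) \<in> supp_on (?S q)" by (rule fs.subspace_diff[OF subspace_supp_on c])
    obtain b where "b \<in> supp_on (?S (Suc q))" "?D b = c - g2 (?D c)" using exact[OF m z] by blast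
    then have "c - g2 (?D c) \<in> ?D ` supp_on (?S (Suc q))" by (intro image_eqI[of _ _ b]) simp_all
    from g1(3)[OF this] have "?D (h c) = c - g2 (?D c)" by (simp only: h_def)
    then show ?thesis by simp
  qed
  define H where "H W W' = (if W' \<in> ?S q then \<iota> (h (delta W') W) else 0)" for W W'
  have delta: "(delta W' :: 'a set \<Rightarrow> 'k) \<in> supp_on (?S q)" if "W' \<in> ?S q" for W'
    using that by (auto simp: supp_on_def delta_def)
  have dl: "\<iota> (delta W' W) = delta W' W" for W W' :: "'a set" by (simp add: delta_def \<iota> \<iota>0)
  have "?D' (\<lambda>W. \<Sum>W'\<in>\<Gamma>. H W W' * c W') F = c F"
    if c: "\<forall>W. c W \<noteq> 0 \<longrightarrow> W \<in> \<Gamma> \<and> card W = q" and closed: "?D' c = 0" for c F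
  proof -
    have csupp: "c \<in> supp_on (?S q)" using c by (auto simp: supp_on_def)
    have "(\<lambda>W. \<Sum>W'\<in>\<Gamma>. H W W' * c W') = (\<Sum>W'\<in>?S q. (\<lambda>W. c W' * \<iota> (h (delta W') W)))"
      unfolding sum_fun_def fun_eq_iff using fin c
      by (auto simp: H_def mult.commute sum.inter_filter[symmetric] if_distrib cong: if_cong intro!: sum.mono_neutral_cong_right)
    moreover have "?D' (\<Sum>W'\<in>?S q. (\<lambda>W. c W' * \<iota> (h (delta W') W)))
        = (\<Sum>W'\<in>?S q. (\<lambda>F. c W' * ?D' (\<lambda>W. \<iota> (h (delta W') W)) F))"
      by (rule lin_sum[OF lin_fcon])
    ultimately have "?D' (\<lambda>W. \<Sum>W'\<in>\<Gamma>. H W W' * c W') F = (\<Sum>W'\<in>?S q. c W' * \<iota> (?D (h (delta W')) F))"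
      by (simp only: sum_fun_def \<iota>D)
    also have "\<dots> = (\<Sum>W'\<in>?S q. c W' * delta W' F) - (\<Sum>W'\<in>?S q. c W' * \<iota> (g2 (?D (delta W')) F))"
      by (simp add: h[OF delta] \<iota>diff dl right_diff_distrib sum_subtractf)
    also have "(\<Sum>W'\<in>?S q. c W' * delta W' F) = c F"
      using fun_cong[OF sum_delta_fun[OF fin(2) csupp], of F] by (simp add: sum_fun_def)
    \<comment> \<open>In coordinates this is the extension of \<open>g2\<close> applied to the
      boundary of \<open>c\<close>, which is zero.\<close>
    also have "(\<Sum>W'\<in>?S q. c W' * \<iota> (g2 (?D (delta W')) F)) = 0"
    proof -
      have DP: "?D (delta W') \<in> supp_on (Pow Y)" if "W' \<in> ?S q" for W'
      proof -
        have "?D (delta W') G = 0" if "\<not> G \<subseteq> Y" for G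
        proof -
          have "insert v G \<noteq> W'" for v using that \<open>W' \<in> ?S q\<close> Y(2) by blast
          then show ?thesis by (auto simp: fcon_def cont_def delta_def intro!: sum.neutral)
        qed
        then show ?thesis by (auto simp: supp_on_def)
      qed
      have "g2 (?D (delta W')) F = (\<Sum>G\<in>Pow Y. ?D (delta W') G * g2 (delta G) F)" if "W' \<in> ?S q" for W'
      proof -
        have "g2 (?D (delta W')) = g2 (\<Sum>G\<in>Pow Y. (\<lambda>y. ?D (delta W') G * delta G y))"
          using sum_delta_fun[OF _ DP[OF that]] Y(1) by simp
        also have "\<dots> = (\<Sum>G\<in>Pow Y. (\<lambda>y. ?D (delta W') G * g2 (delta G) y))" by (rule lin_sum[OF g2(2)])
        finally show ?thesis by (simp add: sum_fun_def)
      qed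
      then have "(\<Sum>W'\<in>?S q. c W' * \<iota> (g2 (?D (delta W')) F))
          = (\<Sum>W'\<in>?S q. \<Sum>G\<in>Pow Y. c W' * ?D' (delta W') G * \<iota> (g2 (delta G) F))"
        by (intro sum.cong refl) (simp only: \<iota>sum \<iota>(2) \<iota>D dl sum_distrib_left mult.assoc)
      also have "\<dots> = (\<Sum>G\<in>Pow Y. (\<Sum>W'\<in>?S q. c W' * ?D' (delta W') G) * \<iota> (g2 (delta G) F))"
        by (subst sum.swap) (simp add: sum_distrib_right)
      also have "\<dots> = 0"
      proof (rule sum.neutral, rule ballI)
        fix G
        have "(\<Sum>W'\<in>?S q. c W' * ?D' (delta W') G) = ?D' c G"
          by (subst (2) sum_delta_fun[OF fin(2) csupp], subst lin_sum[OF lin_fcon]) (simp add: sum_fun_def)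
        then show "(\<Sum>W'\<in>?S q. c W' * ?D' (delta W') G) * \<iota> (g2 (delta G) F) = 0" using closed by simp
      qed
      finally show ?thesis .
    qed
    finally show ?thesis by simp
  qed
  moreover have "W \<in> \<Gamma> \<and> card W = Suc q" if "H W W' \<noteq> 0" for W W'
  proof -
    have "h (delta W') W \<noteq> 0" using that \<iota>0 by (auto simp: H_def split: if_splits)
    moreover have "h (delta W') \<in> supp_on (?S (Suc q))" using g1(1) by (auto simp: h_def)
    ultimately show ?thesis by (auto simp: supp_on_def)
  qed
  ultimately show ?thesis
    unfolding acyclic_at_def by (intro exI[of _ H]) (auto simp: fun_eq_iff)
qed

text \<open>Provides an infinite extension of an arbitrary, possibly finite, field.\<close>

lemma infinite_poly_fract: "infinite (UNIV :: 'k::field poly fract set)"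
proof -
  have "inj (\<lambda>n. Fract (monom (1 :: 'k) n) 1)"
  proof (rule injI)
    fix m n assume "Fract (monom (1 :: 'k) m) 1 = Fract (monom 1 n) 1"
    then have "monom (1 :: 'k) m = monom 1 n" by (simp add: eq_fract)
    then show "m = n" by (metis degree_monom_eq one_neq_zero)
  qed
  from range_inj_infinite[OF this] show ?thesis by (rule infinite_super[OF subset_UNIV])
qed

lemma bd_eq_fcon:
  fixes c :: "'a::linorder set \<Rightarrow> 'k::field"
  assumes "finite Y" "\<Gamma> \<subseteq> Pow Y" "c \<in> supp_on \<Gamma>"
  shows "bd \<Gamma> c = fcon Y (\<lambda>_. 1) c"
proof
  fix F
  have zero: "c (insert v F) = 0" if "insert v F \<notin> \<Gamma>" for v using assms(3) that by (auto simp: supp_on_def)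
  show "bd \<Gamma> c F = fcon Y (\<lambda>_. 1) c F"
  proof (cases "finite F")
    case True
    have "fcon Y (\<lambda>_. 1) c F = (\<Sum>v\<in>Y. if v \<notin> F \<and> insert v F \<in> \<Gamma> then (-1) ^ card {u \<in> F. u < v} * c (insert v F) else 0)"
      unfolding fcon_def by (rule sum.cong) (use True zero in \<open>auto simp: cont_def esign_def\<close>)
    also have "\<dots> = (\<Sum>v\<in>{v \<in> Y. v \<notin> F \<and> insert v F \<in> \<Gamma>}. (-1) ^ card {u \<in> F. u < v} * c (insert v F))"
      using assms(1) by (simp add: sum.inter_filter)
    also have "{v \<in> Y. v \<notin> F \<and> insert v F \<in> \<Gamma>} = {v. v \<notin> F \<and> insert v F \<in> \<Gamma>}" using assms(2) by blast
    finally show ?thesis by (simp add: bd_def)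
  next
    case False
    then have "insert v F \<notin> \<Gamma>" for v
      using assms(1,2) by (metis PowD finite_insert finite_subset subsetD)
    then show ?thesis using False by (simp add: bd_def fcon_def cont_def)
  qed
qed

text \<open>Sets with \<open>q\<close> elements have dimension \<open>q - 1\<close>; the ground
  field is embedded as the constants.\<close>

lemma acyclic_at_red_hom_zero:
  fixes \<Gamma> :: "'a::linorder set set"
  assumes "finite Y" "\<Gamma> \<subseteq> Pow Y" "red_hom_zero TYPE('k::field) \<Gamma> (int q - 1)"
  shows "acyclic_at TYPE('k poly fract) Y \<Gamma> q"
proof (rule acyclic_at_extension[of "\<lambda>a. Fract [:a:] 1"])
  fix c :: "'a set \<Rightarrow> 'k"
  assume c: "c \<in> supp_on {W \<in> \<Gamma>. card W = q}" and z: "fcon Y (\<lambda>_. 1) c = 0"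
  have c\<Gamma>: "c \<in> supp_on \<Gamma>" using c by (auto simp: supp_on_def)
  have nat: "nat (int q - 1 + 1) = q" "nat (int q - 1 + 2) = Suc q" by auto
  have "is_chain \<Gamma> q c" using c by (auto simp: is_chain_def supp_on_def)
  moreover have "bd \<Gamma> c F = 0" for F using bd_eq_fcon[OF assms(1,2) c\<Gamma>] z by simp
  ultimately obtain b where b: "is_chain \<Gamma> (Suc q) b" "bd \<Gamma> b = c"
    using assms(3) unfolding red_hom_zero_def nat by fastforce
  have "b \<in> supp_on {W \<in> \<Gamma>. card W = Suc q}" using b(1) by (auto simp: is_chain_def supp_on_def)
  moreover from this have "fcon Y (\<lambda>_. 1) b = c"
    using bd_eq_fcon[OF assms(1,2), of b] b(2) by (auto simp: supp_on_def)
  ultimately show "\<exists>b\<in>supp_on {W \<in> \<Gamma>. card W = Suc q}. fcon Y (\<lambda>_. 1) b = c" by blast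
qed (use assms in \<open>simp_all add: One_fract_def one_pCons mult_ac\<close>)

section \<open>Intersecting set families\<close>

text \<open>Compares the positions \<open>P\<close> of nonzero pieces with the positions
  \<open>S\<close> of the pieces that they annihilate. Induction on the ground set: in the
  borderline case complementation is an injection, and \<open>{..<r}\<close> is excepted because its
  complement misses \<open>{..<r}\<close>; otherwise the family splits by membership of the last
  element.\<close>

lemma shifted_two_intersecting:
  fixes \<P> :: "nat set set"
  assumes "\<P> \<subseteq> {P. P \<subseteq> {..<n} \<and> card P = k}"
    and "\<And>P i j. P \<in> \<P> \<Longrightarrow> j \<in> P \<Longrightarrow> i < j \<Longrightarrow> i \<notin> P \<Longrightarrow> insert i (P - {j}) \<in> \<P>"
    and "\<And>P Q. P \<in> \<P> \<Longrightarrow> Q \<in> \<P> \<Longrightarrow> 2 \<le> card (P \<inter> Q)"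
    and "2 * k \<le> n + 1" "k \<le> r"
  shows "card (\<P> - {{..<r}})
    \<le> card {S. S \<subseteq> {..<n} \<and> Suc (card S) = k \<and> S \<inter> {..<r} \<noteq> {} \<and> (\<exists>P\<in>\<P>. P \<inter> S = {})}"
  using assms
proof (induction n arbitrary: \<P> k)
  case 0
  have "\<P> = {}"
  proof (rule ccontr)
    assume "\<P> \<noteq> {}"
    then obtain P where "P \<in> \<P>" by blast
    then show False using "0.prems"(1) "0.prems"(3)[of P P] by auto
  qed
  then show ?case by simp
next
  case (Suc n)
  note sub = Suc.prems(1) and sh = Suc.prems(2) and int = Suc.prems(3) and nk = Suc.prems(4) and kr = Suc.prems(5)
  let ?R = "\<lambda>\<P> n k. {S. S \<subseteq> {..<n} \<and> Suc (card S) = k \<and> S \<inter> {..<r} \<noteq> {} \<and> (\<exists>P\<in>\<P>. P \<inter> S = {})}"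
  have finR: "finite (?R \<P> n k)" for \<P> n k by (rule finite_subset[of _ "Pow {..<n}"]) auto
  have fin\<P>: "finite \<P>" by (rule finite_subset[OF sub]) (rule finite_subset[of _ "Pow {..<Suc n}"], auto)
  have finP: "finite P" if "P \<in> \<P>" for P using sub that finite_subset[of P "{..<Suc n}"] by auto
  show ?case
  proof (cases "\<P> = {}")
    case False
    then obtain P0 where P0: "P0 \<in> \<P>" by blast
    have k2: "k \<ge> 2" using int[OF P0 P0] sub P0 by auto
    show ?thesis
    proof (cases "2 * k = Suc n + 1")
      \<comment> \<open>The complement of a \<open>k\<close>-set has \<open>k - 1\<close> elements
        and is disjoint from that set.\<close>
      case True
      have inj: "inj_on (\<lambda>P. {..<Suc n} - P) (\<P> - {{..<r}})"
        using sub by (intro inj_onI) blast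
      have im: "(\<lambda>P. {..<Suc n} - P) ` (\<P> - {{..<r}}) \<subseteq> ?R \<P> (Suc n) k"
      proof (rule image_subsetI)
        fix P assume P: "P \<in> \<P> - {{..<r}}"
        then have P': "P \<subseteq> {..<Suc n}" "card P = k" "P \<in> \<P>" "P \<noteq> {..<r}" using sub by auto
        have "card ({..<Suc n} - P) = Suc n - k" using P' finP by (subst card_Diff_subset) auto
        moreover have "({..<Suc n} - P) \<inter> {..<r} \<noteq> {}"
        proof
          assume "({..<Suc n} - P) \<inter> {..<r} = {}"
          then have sub': "{..<min (Suc n) r} \<subseteq> P" by auto
          then have "min (Suc n) r \<le> k" using card_mono[OF finP[OF P'(3)] sub'] P'(2) by simp
          then have "r = k" "min (Suc n) r = r" using True kr k2 by auto
          then have "{..<r} \<subseteq> P" "card {..<r} = card P" using sub' P'(2) by simp_all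
          then have "{..<r} = P" using card_subset_eq[OF finP[OF P'(3)]] by blast
          then show False using P'(4) by blast
        qed
        ultimately show "{..<Suc n} - P \<in> ?R \<P> (Suc n) k"
          using P'(3) True by auto
      qed
      have "card (\<P> - {{..<r}}) = card ((\<lambda>P. {..<Suc n} - P) ` (\<P> - {{..<r}}))"
        by (rule card_image[OF inj, symmetric])
      also have "\<dots> \<le> card (?R \<P> (Suc n) k)" by (rule card_mono[OF finR im])
      finally show ?thesis .
    next
      case False
      then have nk': "2 * k \<le> Suc n" using nk by simp
      \<comment> \<open>A set that contains \<open>n\<close> and has at most \<open>n\<close>
        elements leaves a smaller position free. Shifting \<open>n\<close> there in one member shows
        that deleting \<open>n\<close> preserves 2-intersection, and that \<open>n\<close> may be
        added to \<open>S\<close> without losing disjointness.\<close>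
      have fresh: "\<exists>x<n. x \<notin> A" if "A \<subseteq> {..<Suc n}" "n \<in> A" "card A < Suc n" for A
      proof (rule ccontr)
        assume "\<not> ?thesis"
        then have "{..<Suc n} \<subseteq> A" using that(2) by (auto simp: less_Suc_eq)
        then have "A = {..<Suc n}" using that(1) by blast
        then show False using that(3) by simp
      qed
      define \<P>0 where "\<P>0 = {P \<in> \<P>. n \<notin> P}"
      define \<Q> where "\<Q> = {P \<in> \<P>. n \<in> P}"
      define \<P>1 where "\<P>1 = (\<lambda>P. P - {n}) ` \<Q>"
      have push: "insert x (P - {n}) \<in> \<P>" if "P \<in> \<Q>" "x < n" "x \<notin> P" for P x
        using sh[of P n x] that by (auto simp: \<Q>_def)
      have IH0: "card (\<P>0 - {{..<r}}) \<le> card (?R \<P>0 n k)"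
      proof (rule Suc.IH)
        show "\<P>0 \<subseteq> {P. P \<subseteq> {..<n} \<and> card P = k}"
          using sub by (fastforce simp: \<P>0_def lessThan_Suc)
        show "insert i (P - {j}) \<in> \<P>0" if "P \<in> \<P>0" "j \<in> P" "i < j" "i \<notin> P" for P i j
        proof -
          have "j < Suc n" using that sub by (auto simp: \<P>0_def)
          then show ?thesis using sh[of P j i] that by (auto simp: \<P>0_def)
        qed
      qed (use int nk' kr in \<open>auto simp: \<P>0_def\<close>)
      have Q: "P \<subseteq> {..<Suc n}" "card P = k" "n \<in> P" "finite P" "P \<in> \<P>" if "P \<in> \<Q>" for P
        using that sub finP by (auto simp: \<Q>_def)
      have IH1: "card (\<P>1 - {{..<r}}) \<le> card (?R \<P>1 n (k - 1))"
      proof (rule Suc.IH)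
        show "\<P>1 \<subseteq> {P. P \<subseteq> {..<n} \<and> card P = k - 1}"
        proof
          fix P1 assume "P1 \<in> \<P>1"
          then obtain P where P: "P \<in> \<Q>" "P1 = P - {n}" unfolding \<P>1_def by blast
          have "P1 \<subseteq> {..<n}" using Q(1)[OF P(1)] P(2) by (auto simp: lessThan_Suc)
          then show "P1 \<in> {P. P \<subseteq> {..<n} \<and> card P = k - 1}" using Q[OF P(1)] P(2) by simp
        qed
        show "insert i (P1 - {j}) \<in> \<P>1" if "P1 \<in> \<P>1" "j \<in> P1" "i < j" "i \<notin> P1" for P1 i j
        proof -
          obtain P where P: "P \<in> \<Q>" "P1 = P - {n}" using \<open>P1 \<in> \<P>1\<close> unfolding \<P>1_def by blast
          have "j < n" using Q(1)[OF P(1)] P(2) that(2) by (auto simp: lessThan_Suc)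
          then have "insert i (P - {j}) \<in> \<Q>"
            using sh[of P j i] Q[OF P(1)] P(2) that by (auto simp: \<Q>_def)
          moreover have "insert i (P1 - {j}) = insert i (P - {j}) - {n}"
            using P(2) \<open>j < n\<close> that(3) by auto
          ultimately show ?thesis by (auto simp: \<P>1_def)
        qed
        show "2 \<le> card (P1 \<inter> Q1)" if "P1 \<in> \<P>1" "Q1 \<in> \<P>1" for P1 Q1
        proof -
          obtain P where P: "P \<in> \<Q>" "P1 = P - {n}" using \<open>P1 \<in> \<P>1\<close> unfolding \<P>1_def by blast
          obtain Q' where Q': "Q' \<in> \<Q>" "Q1 = Q' - {n}" using \<open>Q1 \<in> \<P>1\<close> unfolding \<P>1_def by blast
          have "card P + card Q' = card (P \<union> Q') + card (P \<inter> Q')" using Q(4) P(1) Q'(1) by (intro card_Un_Int) auto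
          then have "card (P \<union> Q') < Suc n"
            using int[OF Q(5)[OF P(1)] Q(5)[OF Q'(1)]] Q(2)[OF P(1)] Q(2)[OF Q'(1)] nk' by simp
          then obtain x where x: "x < n" "x \<notin> P \<union> Q'" using fresh[of "P \<union> Q'"] Q(1,3) P(1) Q'(1) by blast
          have "2 \<le> card (P \<inter> insert x (Q' - {n}))"
            by (rule int[OF Q(5)[OF P(1)] push[OF Q'(1)]]) (use x in auto)
          moreover have "P \<inter> insert x (Q' - {n}) = P1 \<inter> Q1" using x P(2) Q'(2) by auto
          ultimately show ?thesis by simp
        qed
      qed (use nk' kr in auto)
      \<comment> \<open>Since \<open>k - 1 < r\<close>, the excepted set is lost at most once, in
        the part without the last element.\<close>
      have nV: "{..<r} \<notin> \<P>1"
      proof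
        assume "{..<r} \<in> \<P>1"
        then obtain P where "P \<in> \<Q>" "{..<r} = P - {n}" unfolding \<P>1_def by blast
        then have "card {..<r} = k - 1" using Q by simp
        then show False using kr k2 by simp
      qed
      have cQ: "card \<P>1 = card \<Q>"
        unfolding \<P>1_def by (rule card_image, rule inj_onI) (use Q(3) in blast)
      have "card (\<P> - {{..<r}}) \<le> card ((\<P>0 - {{..<r}}) \<union> \<Q>)"
        by (rule card_mono) (use fin\<P> in \<open>auto simp: \<P>0_def \<Q>_def\<close>)
      also have "\<dots> \<le> card (\<P>0 - {{..<r}}) + card \<Q>" by (rule card_Un_le)
      also have "\<dots> \<le> card (?R \<P>0 n k) + card (?R \<P>1 n (k - 1))"
        using IH0 IH1 nV cQ by simp
      also have "card (?R \<P>1 n (k - 1)) = card (insert n ` ?R \<P>1 n (k - 1))"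
        by (rule card_image[symmetric], rule inj_onI) auto
      also have "card (?R \<P>0 n k) + card (insert n ` ?R \<P>1 n (k - 1))
          = card (?R \<P>0 n k \<union> insert n ` ?R \<P>1 n (k - 1))"
        by (rule card_Un_disjoint[symmetric]) (use finR in auto)
      also have "\<dots> \<le> card (?R \<P> (Suc n) k)"
      proof (rule card_mono[OF finR], rule Un_least)
        show "?R \<P>0 n k \<subseteq> ?R \<P> (Suc n) k" by (auto simp: \<P>0_def)
        show "insert n ` ?R \<P>1 n (k - 1) \<subseteq> ?R \<P> (Suc n) k"
        proof (rule image_subsetI)
          fix S assume S: "S \<in> ?R \<P>1 n (k - 1)"
          then obtain P where P: "P \<in> \<Q>" "(P - {n}) \<inter> S = {}" unfolding \<P>1_def by blast
          have Sn: "S \<subseteq> {..<n}" "finite S" "n \<notin> S" using S finite_subset[of S "{..<n}"] by auto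
          have "card (P \<union> S) \<le> card P + card S" by (rule card_Un_le)
          then have "card (P \<union> S) < Suc n" using S Q(2)[OF P(1)] nk' k2 by auto
          then obtain x where x: "x < n" "x \<notin> P \<union> S"
            using fresh[of "P \<union> S"] Q(1,3)[OF P(1)] Sn(1) by fastforce
          have "insert x (P - {n}) \<in> \<P>" by (rule push[OF P(1)]) (use x in auto)
          moreover have "insert x (P - {n}) \<inter> insert n S = {}" using x P(2) by auto
          ultimately have "\<exists>P\<in>\<P>. P \<inter> insert n S = {}" by blast
          moreover have "Suc (card (insert n S)) = k" using S Sn k2 by simp
          moreover have "insert n S \<inter> {..<r} \<noteq> {}" using S by blast
          moreover have "insert n S \<subseteq> {..<Suc n}" using Sn(1) by auto
          ultimately show "insert n S \<in> ?R \<P> (Suc n) k" by blast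
        qed
      qed
      finally show ?thesis .
    qed
  qed simp
qed

section \<open>Compression of set families\<close>

definition exchange :: "'a \<Rightarrow> 'a \<Rightarrow> 'a set \<Rightarrow> 'a set" where
  "exchange v w F = (if v \<in> F \<and> w \<notin> F then insert w (F - {v}) else if w \<in> F \<and> v \<notin> F then insert v (F - {w}) else F)"

text \<open>Of two sets related by swapping \<open>v\<close> and \<open>w\<close>, the one with
  \<open>v\<close> is a member if either was, the one with \<open>w\<close> if both were. The same
  pattern, with sums and preimages, returns in \<open>vertex_shift\<close>.\<close>

definition compress :: "'a \<Rightarrow> 'a \<Rightarrow> 'a set set \<Rightarrow> 'a set set" where
  "compress v w \<F> = {F. if v \<in> F \<and> w \<notin> F then F \<in> \<F> \<or> exchange v w F \<in> \<F>
     else if w \<in> F \<and> v \<notin> F then F \<in> \<F> \<and> exchange v w F \<in> \<F> else F \<in> \<F>}"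

lemma exchange_exchange: "v \<noteq> w \<Longrightarrow> exchange v w (exchange v w F) = F"
  by (auto simp: exchange_def)

lemma card_exchange: "finite F \<Longrightarrow> card (exchange v w F) = card F"
  using card_gt_0_iff[of F] by (auto simp: exchange_def)

definition push_down :: "'a \<Rightarrow> 'a \<Rightarrow> 'a set set \<Rightarrow> 'a set \<Rightarrow> 'a set" where
  "push_down v w \<F> F = (if w \<in> F \<and> v \<notin> F \<and> exchange v w F \<notin> \<F> then exchange v w F else F)"

lemma bij_push_down:
  assumes "v \<noteq> w" shows "bij_betw (push_down v w \<F>) \<F> (compress v w \<F>)"
proof (rule bij_betwI')
  show "push_down v w \<F> x = push_down v w \<F> y \<longleftrightarrow> x = y" if "x \<in> \<F>" "y \<in> \<F>" for x y
  proof -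
    have "x = y" if "exchange v w x = exchange v w y" using that exchange_exchange[OF assms] by metis
    then show ?thesis using \<open>x \<in> \<F>\<close> \<open>y \<in> \<F>\<close> by (auto simp: push_down_def)
  qed
  show "push_down v w \<F> x \<in> compress v w \<F>" if "x \<in> \<F>" for x
    using that exchange_exchange[OF assms, of x] assms by (auto simp: push_down_def compress_def exchange_def)
  fix y assume y: "y \<in> compress v w \<F>"
  show "\<exists>x\<in>\<F>. y = push_down v w \<F> x"
  proof (cases "y \<in> \<F>")
    case True
    then have "y = push_down v w \<F> y" using y by (auto simp: push_down_def compress_def split: if_splits)
    then show ?thesis using True by blast
  next
    case False
    then have *: "v \<in> y" "w \<notin> y" "exchange v w y \<in> \<F>" using y by (auto simp: compress_def split: if_splits)
    have "w \<in> exchange v w y" "v \<notin> exchange v w y" using *(1,2) assms by (auto simp: exchange_def)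
    then have "push_down v w \<F> (exchange v w y) = y" using False exchange_exchange[OF assms, of y] by (simp add: push_down_def)
    then show ?thesis using *(3) by metis
  qed
qed

text \<open>Disjointness is invariant under exchanging both sets. A compressed set with only
  \<open>w\<close> has both versions in the old family, one with only \<open>v\<close> has at least
  one, and the remaining sets are fixed; so a disjoint pair would come from an old disjoint
  pair.\<close>

lemma compress_cross:
  assumes "v \<noteq> w" "\<forall>A\<in>\<A>. \<forall>B\<in>\<B>. A \<inter> B \<noteq> {}" "A \<in> compress v w \<A>" "B \<in> compress v w \<B>"
  shows "A \<inter> B \<noteq> {}"
proof
  assume AB: "A \<inter> B = {}"
  have e: "exchange v w A \<inter> exchange v w B = {}" using AB assms(1) by (auto simp: exchange_def)
  have no: "\<not> (A \<in> \<A> \<and> B \<in> \<B>)" "\<not> (exchange v w A \<in> \<A> \<and> exchange v w B \<in> \<B>)"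
    using assms(2) AB e by blast+
  have "\<not> (v \<in> A \<and> v \<in> B)" "\<not> (w \<in> A \<and> w \<in> B)" using AB by auto
  consider "v \<in> A" "w \<notin> A" "v \<notin> B" "w \<notin> B" | "v \<in> B" "w \<notin> B" "v \<notin> A" "w \<notin> A"
    | "v \<in> A" "w \<notin> A" "w \<in> B" "v \<notin> B" | "v \<in> B" "w \<notin> B" "w \<in> A" "v \<notin> A"
    | "A \<in> \<A>" "B \<in> \<B>"
    using assms(3,4) AB by (auto simp: compress_def split: if_splits)
  then show False
  proof cases
    case 1
    then have "exchange v w B = B" "B \<in> \<B>" using assms(4) by (auto simp: exchange_def compress_def split: if_splits)
    then show False using no assms(3) 1 by (auto simp: compress_def)
  next
    case 2
    then have "exchange v w A = A" "A \<in> \<A>" using assms(3) by (auto simp: exchange_def compress_def split: if_splits)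
    then show False using no assms(4) 2 by (auto simp: compress_def)
  next
    case 3
    then show False using no assms(3,4) by (auto simp: compress_def)
  next
    case 4
    then show False using no assms(3,4) by (auto simp: compress_def)
  next
    case 5
    then show False using no by blast
  qed
qed

text \<open>For a set with \<open>v\<close> only, deleting \<open>v\<close> equals deleting
  \<open>w\<close> from its exchange, and other deletions commute with the exchange. For a set with
  both, the deletions of \<open>v\<close> and of \<open>w\<close> are exchanged with each
  other.\<close>

lemma compress_shadow:
  assumes "v \<noteq> w" "\<And>B x. B \<in> \<B> \<Longrightarrow> x \<in> B \<Longrightarrow> B - {x} \<in> \<A>" "B \<in> compress v w \<B>" "x \<in> B"
  shows "B - {x} \<in> compress v w \<A>"
proof -
  consider "v \<in> B" "w \<notin> B" | "w \<in> B" "v \<notin> B" | "v \<in> B" "w \<in> B" | "v \<notin> B" "w \<notin> B" by blast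
  then show ?thesis
  proof cases
    case 1
    then have B: "B \<in> \<B> \<or> exchange v w B \<in> \<B>" using assms(3) by (simp add: compress_def)
    show ?thesis
    proof (cases "x = v")
      case True
      have "exchange v w B - {w} = B - {v}" using 1 by (auto simp: exchange_def)
      moreover have "w \<in> exchange v w B" using 1 by (auto simp: exchange_def)
      ultimately have "B - {x} \<in> \<A>" using B assms(2,4) True by metis
      then show ?thesis using 1 True by (simp add: compress_def)
    next
      case False
      have "exchange v w B - {x} = exchange v w (B - {x})" using 1 False assms(4) by (auto simp: exchange_def)
      moreover have "x \<in> exchange v w B" using 1 False assms(4) by (auto simp: exchange_def)
      ultimately have "B - {x} \<in> \<A> \<or> exchange v w (B - {x}) \<in> \<A>" using B assms(2,4) by metis
      then show ?thesis using 1 False by (simp add: compress_def)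
    qed
  next
    case 2
    then have B: "B \<in> \<B>" "exchange v w B \<in> \<B>" using assms(3) by (auto simp: compress_def)
    show ?thesis
    proof (cases "x = w")
      case True
      then show ?thesis using 2 assms(2)[OF B(1) assms(4)] by (simp add: compress_def)
    next
      case False
      have "exchange v w (B - {x}) = exchange v w B - {x}" using 2 False assms(4) by (auto simp: exchange_def)
      moreover have "x \<in> exchange v w B" using 2 False assms(4) by (auto simp: exchange_def)
      ultimately show ?thesis
        using 2 False assms(2)[OF B(1) assms(4)] assms(2)[OF B(2)] by (simp add: compress_def)
    qed
  next
    case 3
    then have B: "B \<in> \<B>" using assms(3) by (auto simp: compress_def)
    have "exchange v w (B - {v}) = B - {w}" using 3 assms(1) by (auto simp: exchange_def)
    then show ?thesis using 3 assms(1) assms(2)[OF B] assms(4) by (auto simp: compress_def)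
  next
    case 4
    then show ?thesis using assms(2,3,4) by (auto simp: compress_def)
  qed
qed

text \<open>Each compression replaces a vertex outside \<open>V\<close> by one of \<open>V\<close>,
  and the total number of elements of members of \<open>\<B>\<close> outside \<open>V\<close>
  drops.\<close>

lemma compress_to_apex:
  fixes \<Delta> :: "'a set set"
  assumes \<Delta>: "finite \<Delta>" "\<And>B. B \<in> \<Delta> \<Longrightarrow> finite B" and V: "finite V" "card V = r"
    and sh: "\<And>B v w. B \<in> \<Delta> \<Longrightarrow> w \<in> B \<Longrightarrow> w \<notin> V \<Longrightarrow> v \<in> V \<Longrightarrow> v \<notin> B \<Longrightarrow> insert v (B - {w}) \<in> \<Delta>"
  shows "\<lbrakk>\<A> \<subseteq> {F \<in> \<Delta>. card F = r - 1}; \<B> \<subseteq> {F \<in> \<Delta>. card F = r}; \<B> \<noteq> {};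
     \<forall>A\<in>\<A>. \<forall>B\<in>\<B>. A \<inter> B \<noteq> {}; \<forall>B\<in>\<B>. \<forall>x\<in>B. B - {x} \<in> \<A>\<rbrakk> \<Longrightarrow>
    \<exists>\<A>' \<B>'. \<A>' \<subseteq> {F \<in> \<Delta>. card F = r - 1} \<and> \<B>' \<subseteq> {F \<in> \<Delta>. card F = r} \<and> V \<in> \<B>' \<and>
     (\<forall>A\<in>\<A>'. \<forall>B\<in>\<B>'. A \<inter> B \<noteq> {}) \<and> (\<forall>B\<in>\<B>'. \<forall>x\<in>B. B - {x} \<in> \<A>') \<and>
     card \<A>' = card \<A> \<and> card \<B>' = card \<B>"
proof (induction "\<Sum>B\<in>\<B>. card (B - V)" arbitrary: \<A> \<B> rule: less_induct)
  case less
  show ?case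
  proof (cases "V \<in> \<B>")
    case True
    then show ?thesis using less.prems by blast
  next
    case False
    obtain B0 where "B0 \<in> \<B>" using less.prems(3) by blast
    \<comment> \<open>Minimality ensures progress: the exchange of \<open>B\<close> has fewer
      elements outside \<open>V\<close>, hence is not yet a member, so the compression really moves
      \<open>B\<close>.\<close>
    then obtain B where B: "B \<in> \<B>" "\<And>B'. B' \<in> \<B> \<Longrightarrow> card (B - V) \<le> card (B' - V)"
      using ex_has_least_nat[of "\<lambda>B. B \<in> \<B>" B0 "\<lambda>B. card (B - V)"] by blast
    have Bf: "finite B" "card B = r" "B \<in> \<Delta>" using less.prems(2) B(1) \<Delta>(2) by auto
    have "\<not> B \<subseteq> V" using card_subset_eq[OF V(1)] Bf(2) V(2) False B(1) by metis
    then obtain w where w: "w \<in> B" "w \<notin> V" by blast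
    have "\<not> V \<subseteq> B" using card_subset_eq[OF Bf(1)] Bf(2) V(2) False B(1) by metis
    then obtain v where v: "v \<in> V" "v \<notin> B" by blast
    have vw: "v \<noteq> w" using v w by blast
    have in\<Delta>: "push_down v w \<F> F \<in> {F \<in> \<Delta>. card F = n}" if "F \<in> {F \<in> \<Delta>. card F = n}" for \<F> F n
      using that sh[of F w v] w v card_exchange[OF \<Delta>(2), of F v w] by (auto simp: push_down_def exchange_def)
    have comp: "compress v w \<F> = push_down v w \<F> ` \<F>" for \<F>
      using bij_push_down[OF vw, of \<F>] by (simp add: bij_betw_def)
    have sub: "compress v w \<F> \<subseteq> {F \<in> \<Delta>. card F = n}" if "\<F> \<subseteq> {F \<in> \<Delta>. card F = n}" for \<F> n
      unfolding comp using in\<Delta> that by blast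
    have cardc: "card (compress v w \<F>) = card \<F>" for \<F>
      using bij_betw_same_card[OF bij_push_down[OF vw]] by metis
    have fin\<B>: "finite \<B>" using less.prems(2) \<Delta>(1) finite_subset by fastforce
    have le: "card (push_down v w \<B> F - V) \<le> card (F - V)" if "F \<in> \<B>" for F
      using that less.prems(2) \<Delta>(2) v by (auto simp: push_down_def exchange_def intro!: card_mono)
    have "B' \<notin> \<B>" if "B' = insert v (B - {w})" for B'
    proof
      assume "B' \<in> \<B>"
      moreover have "B' - V = (B - V) - {w}" using that v by auto
      then have "card (B' - V) < card (B - V)" using w Bf(1) card_Diff1_less[of "B - V" w] by (simp only:) auto
      ultimately show False using B(2) by fastforce
    qed
    then have pB: "push_down v w \<B> B = insert v (B - {w})"
      using v w by (auto simp: push_down_def exchange_def)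
    have "push_down v w \<B> B - V = (B - V) - {w}" using pB v by auto
    then have lt: "card (push_down v w \<B> B - V) < card (B - V)"
      using w Bf(1) card_Diff1_less[of "B - V" w] by (simp only:) auto
    have "(\<Sum>B\<in>compress v w \<B>. card (B - V)) = (\<Sum>B\<in>\<B>. card (push_down v w \<B> B - V))"
      by (rule sum.reindex_bij_betw[OF bij_push_down[OF vw], symmetric])
    also have "\<dots> < (\<Sum>B\<in>\<B>. card (B - V))"
      by (rule sum_strict_mono_ex1[OF fin\<B>]) (use le lt B(1) in auto)
    finally have decr: "(\<Sum>B\<in>compress v w \<B>. card (B - V)) < (\<Sum>B\<in>\<B>. card (B - V))" .
    have "\<exists>\<A>' \<B>'. \<A>' \<subseteq> {F \<in> \<Delta>. card F = r - 1} \<and> \<B>' \<subseteq> {F \<in> \<Delta>. card F = r} \<and> V \<in> \<B>' \<and>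
     (\<forall>A\<in>\<A>'. \<forall>B\<in>\<B>'. A \<inter> B \<noteq> {}) \<and> (\<forall>B\<in>\<B>'. \<forall>x\<in>B. B - {x} \<in> \<A>') \<and>
     card \<A>' = card (compress v w \<A>) \<and> card \<B>' = card (compress v w \<B>)"
    proof (rule less.hyps[OF decr])
      show "compress v w \<B> \<noteq> {}" unfolding comp using less.prems(3) by blast
      show "\<forall>A\<in>compress v w \<A>. \<forall>B\<in>compress v w \<B>. A \<inter> B \<noteq> {}"
        using compress_cross[OF vw less.prems(4)] by blast
      show "\<forall>B\<in>compress v w \<B>. \<forall>x\<in>B. B - {x} \<in> compress v w \<A>"
        using compress_shadow[OF vw, of \<B> \<A>] less.prems(5) by blast
    qed (use sub less.prems in auto)
    then show ?thesis unfolding cardc .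
  qed
qed

section \<open>Shifting graded families of chains\<close>

definition contraction_closed :: "'a::linorder set \<Rightarrow> (nat \<Rightarrow> ('a set \<Rightarrow> 'f::field) set) \<Rightarrow> bool" where
  "contraction_closed Y D \<longleftrightarrow> finite Y \<and> (\<forall>s. fs.subspace (D s) \<and> D s \<subseteq> supp_on {W. W \<subseteq> Y \<and> card W = s} \<and>
     (\<forall>c\<in>D (Suc s). \<forall>v. cont v c \<in> D s))"

definition piece :: "nat \<Rightarrow> (nat \<Rightarrow> ('a set \<Rightarrow> 'f::field) set) \<Rightarrow> nat set \<Rightarrow> ('a set \<Rightarrow> 'f) set" where
  "piece R D P = (if card P \<le> R then D (R - card P) else {0})"

text \<open>The piece at P collects what is left of faces after removing the vertices with positions in P.
  Positions below r stand for the vertices of V, the later ones for generic linear forms.\<close>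
definition graded_family :: "nat \<Rightarrow> nat \<Rightarrow> (nat \<Rightarrow> ('a set \<Rightarrow> 'f::field) set) \<Rightarrow> (nat set \<Rightarrow> ('a set \<Rightarrow> 'f) set) \<Rightarrow> bool" where
  "graded_family n R D \<F> \<longleftrightarrow> (\<forall>P. P \<subseteq> {..<n} \<longrightarrow> fs.subspace (\<F> P) \<and> \<F> P \<subseteq> piece R D P)"

text \<open>Linear counterpart of a compressed pair: vanishing wedges stand for cross-intersection,
  \<open>cont v\<close> and the deletion of a position for the shadow outside and inside the
  positions, and the nonzero element at \<open>{..<r}\<close> for V being a member.\<close>

definition annihilating_pair :: "nat \<Rightarrow> nat \<Rightarrow> (nat \<Rightarrow> ('a::linorder set \<Rightarrow> 'f::field) set) \<Rightarrow>
    (nat set \<Rightarrow> ('a set \<Rightarrow> 'f) set) \<Rightarrow> (nat set \<Rightarrow> ('a set \<Rightarrow> 'f) set) \<Rightarrow> bool" where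
  "annihilating_pair n r D \<B> \<A> \<longleftrightarrow> graded_family n r D \<B> \<and> graded_family n (r - 1) D \<A> \<and>
     (\<forall>P S b a. P \<subseteq> {..<n} \<longrightarrow> S \<subseteq> {..<n} \<longrightarrow> P \<inter> S = {} \<longrightarrow> b \<in> \<B> P \<longrightarrow> a \<in> \<A> S \<longrightarrow> wedge b a = 0) \<and>
     (\<forall>P b. P \<subseteq> {..<n} \<longrightarrow> b \<in> \<B> P \<longrightarrow> (\<forall>v. cont v b \<in> \<A> P) \<and> (\<forall>z\<in>P. b \<in> \<A> (P - {z}))) \<and>
     (\<exists>b\<in>\<B> {..<r}. b \<noteq> 0)"

text \<open>Algebraic compression that trades the link vertex \<open>v\<close> for the position
  \<open>z\<close>; sum and preimage under \<open>cont v\<close> take the places of union and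
  intersection.\<close>

definition vertex_shift :: "nat \<Rightarrow> 'a::linorder \<Rightarrow> (nat set \<Rightarrow> ('a set \<Rightarrow> 'f::field) set) \<Rightarrow> nat set \<Rightarrow> ('a set \<Rightarrow> 'f) set" where
  "vertex_shift z v \<F> P = (if z \<in> P then {cont v x + y |x y. x \<in> \<F> (P - {z}) \<and> y \<in> \<F> P}
     else {x \<in> \<F> P. cont v x \<in> \<F> (insert z P)})"

text \<open>The same compression between two positions, with the identity in place of a
  contraction.\<close>

definition position_shift :: "nat \<Rightarrow> nat \<Rightarrow> (nat set \<Rightarrow> ('a set \<Rightarrow> 'f::field) set) \<Rightarrow> nat set \<Rightarrow> ('a set \<Rightarrow> 'f) set" where
  "position_shift i j \<F> P = (if i \<in> P \<and> j \<notin> P then {x + y |x y. x \<in> \<F> (insert j (P - {i})) \<and> y \<in> \<F> P}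
     else if j \<in> P \<and> i \<notin> P then {x \<in> \<F> P. x \<in> \<F> (insert i (P - {j}))} else \<F> P)"

lemma piece_card: "card P = card Q \<Longrightarrow> piece R D P = piece R D Q"
  by (simp add: piece_def)

context
  fixes Y :: "'a::linorder set" and D :: "nat \<Rightarrow> ('a set \<Rightarrow> 'f::field) set"
  assumes D: "contraction_closed Y D"
begin

lemma subspace_piece: "fs.subspace (piece R D P)"
  using D by (auto simp: piece_def contraction_closed_def fs.subspace_single_0)

lemma piece_supp: "piece R D P \<subseteq> supp_on (Pow Y)"
proof (cases "card P \<le> R")
  case True
  have "D (R - card P) \<subseteq> supp_on {W. W \<subseteq> Y \<and> card W = R - card P}" using D by (simp add: contraction_closed_def)
  also have "\<dots> \<subseteq> supp_on (Pow Y)" by (rule supp_on_mono) auto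
  finally show ?thesis using True by (simp add: piece_def)
qed (simp add: piece_def supp_on_def)

lemma finite_Pow_Y: "finite (Pow Y)" using D by (simp add: contraction_closed_def)

lemma piece_homog: "c \<in> piece R D P \<Longrightarrow> homog (R - card P) c"
proof (cases "card P \<le> R")
  case True
  assume "c \<in> piece R D P"
  moreover have "D (R - card P) \<subseteq> supp_on {W. W \<subseteq> Y \<and> card W = R - card P}" "finite Y"
    using D by (simp_all add: contraction_closed_def)
  ultimately have "c \<in> supp_on {W. W \<subseteq> Y \<and> card W = R - card P}" using True by (auto simp: piece_def)
  then show ?thesis using \<open>finite Y\<close> finite_subset unfolding homog_def supp_on_def by blast
qed (simp add: piece_def homog_def)

lemma piece_cont_insert:
  assumes "c \<in> piece R D P" "finite P" "z \<notin> P"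
  shows "cont v c \<in> piece R D (insert z P)"
proof (cases "card P < R")
  case True
  then obtain s where s: "R - card P = Suc s" by (metis Suc_diff_Suc)
  then have "c \<in> D (Suc s)" using assms(1) True by (simp add: piece_def)
  then have "cont v c \<in> D s" using D by (simp add: contraction_closed_def)
  moreover have "R - card (insert z P) = s" using assms s by simp
  ultimately show ?thesis using True assms by (simp add: piece_def)
next
  case False
  then have "homog 0 c" using piece_homog[OF assms(1)] by simp
  then have "cont v c = 0" by (rule homog_0_cont)
  then show ?thesis by (simp add: fs.subspace_0[OF subspace_piece])
qed

lemma graded_familyD:
  assumes "graded_family n R D \<F>" "P \<subseteq> {..<n}"
  shows "fs.subspace (\<F> P)" "\<F> P \<subseteq> piece R D P" "\<F> P \<subseteq> supp_on (Pow Y)"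
    "c \<in> \<F> P \<Longrightarrow> homog (R - card P) c"
proof -
  show 1: "fs.subspace (\<F> P)" and 2: "\<F> P \<subseteq> piece R D P" using assms unfolding graded_family_def by blast+
  show "\<F> P \<subseteq> supp_on (Pow Y)" using 2 piece_supp by (rule order_trans)
  show "homog (R - card P) c" if "c \<in> \<F> P" using piece_homog subsetD[OF 2 that] .
qed

lemma subspace_sum_image:
  assumes "fs.subspace X" "fs.subspace Z" "lin g"
  shows "fs.subspace {g x + y |x y. x \<in> X \<and> y \<in> Z}"
proof -
  have "fs.subspace (g ` X)"
    using fsp.linear_subspace_image[of g X] assms lin_linear by blast
  from fs.subspace_sums[OF this assms(2)] show ?thesis
    by (rule back_subst[of fs.subspace]) auto
qed

lemma subspace_preimage:
  assumes "fs.subspace X" "fs.subspace Z" "lin g"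
  shows "fs.subspace {x \<in> X. g x \<in> Z}"
proof -
  have "fs.subspace {x. g x \<in> Z}"
    using fsp.linear_subspace_linear_preimage[of g Z] assms lin_linear by blast
  from fs.subspace_inter[OF assms(1) this] show ?thesis by (simp add: Int_def)
qed

lemma lin_id: "lin (\<lambda>x. x)" by (simp add: lin_def)

lemma graded_family_vertex_shift:
  assumes F: "graded_family n R D \<F>" and z: "z < n"
  shows "graded_family n R D (vertex_shift z v \<F>)"
  unfolding graded_family_def
proof (intro allI impI)
  fix P assume P: "P \<subseteq> {..<n}"
  have fin: "finite P" using P finite_subset by blast
  show "fs.subspace (vertex_shift z v \<F> P) \<and> vertex_shift z v \<F> P \<subseteq> piece R D P"
  proof (cases "z \<in> P")
    case True
    then have vertex_shift: "vertex_shift z v \<F> P = {cont v x + y |x y. x \<in> \<F> (P - {z}) \<and> y \<in> \<F> P}" by (simp add: vertex_shift_def)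
    have P': "P - {z} \<subseteq> {..<n}" using P by blast
    have "cont v x + y \<in> piece R D P" if "x \<in> \<F> (P - {z})" "y \<in> \<F> P" for x y
    proof (rule fs.subspace_add[OF subspace_piece])
      have "cont v x \<in> piece R D (insert z (P - {z}))"
        by (rule piece_cont_insert) (use that graded_familyD[OF F P'] fin in auto)
      then show "cont v x \<in> piece R D P" using True by (simp add: insert_absorb)
      show "y \<in> piece R D P" using that graded_familyD[OF F P] by blast
    qed
    moreover have "fs.subspace (vertex_shift z v \<F> P)"
      unfolding vertex_shift by (rule subspace_sum_image[OF graded_familyD(1)[OF F P'] graded_familyD(1)[OF F P] lin_cont])
    ultimately show ?thesis unfolding vertex_shift by blast
  next
    case False
    then have vertex_shift: "vertex_shift z v \<F> P = {x \<in> \<F> P. cont v x \<in> \<F> (insert z P)}" by (simp add: vertex_shift_def)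
    have "insert z P \<subseteq> {..<n}" using P z by simp
    then have "fs.subspace (vertex_shift z v \<F> P)"
      unfolding vertex_shift by (rule subspace_preimage[OF graded_familyD(1)[OF F P] graded_familyD(1)[OF F] lin_cont])
    then show ?thesis using graded_familyD(2)[OF F P] unfolding vertex_shift by blast
  qed
qed

lemma graded_family_position_shift:
  assumes F: "graded_family n R D \<F>" and ij: "i < n" "j < n"
  shows "graded_family n R D (position_shift i j \<F>)"
  unfolding graded_family_def
proof (intro allI impI)
  fix P assume P: "P \<subseteq> {..<n}"
  have fin: "finite P" using P finite_subset by blast
  note G = graded_familyD[OF F]
  consider "i \<in> P" "j \<notin> P" | "j \<in> P" "i \<notin> P" | "i \<in> P \<longleftrightarrow> j \<in> P" by blast
  then show "fs.subspace (position_shift i j \<F> P) \<and> position_shift i j \<F> P \<subseteq> piece R D P"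
  proof cases
    case 1
    then have position_shift: "position_shift i j \<F> P = {x + y |x y. x \<in> \<F> (insert j (P - {i})) \<and> y \<in> \<F> P}" by (simp add: position_shift_def)
    have P': "insert j (P - {i}) \<subseteq> {..<n}" using P ij by auto
    have "card (insert j (P - {i})) = card P" using 1 fin card_Suc_Diff1[of P i] by simp
    then have "piece R D (insert j (P - {i})) = piece R D P" by (rule piece_card)
    then have "\<F> (insert j (P - {i})) \<subseteq> piece R D P" using G(2)[OF P'] by simp
    then have "position_shift i j \<F> P \<subseteq> piece R D P"
      unfolding position_shift using G(2)[OF P] fs.subspace_add[OF subspace_piece] by blast
    moreover have "fs.subspace (position_shift i j \<F> P)"
      unfolding position_shift by (rule subspace_sum_image[OF G(1)[OF P'] G(1)[OF P] lin_id])
    ultimately show ?thesis by blast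
  next
    case 2
    then have position_shift: "position_shift i j \<F> P = {x \<in> \<F> P. x \<in> \<F> (insert i (P - {j}))}" by (simp add: position_shift_def)
    have P': "insert i (P - {j}) \<subseteq> {..<n}" using P ij by auto
    have "fs.subspace (position_shift i j \<F> P)"
      unfolding position_shift by (rule subspace_preimage[OF G(1)[OF P] G(1)[OF P'] lin_id])
    then show ?thesis using G(2)[OF P] unfolding position_shift by blast
  next
    case 3
    then have "position_shift i j \<F> P = \<F> P" by (auto simp: position_shift_def)
    then show ?thesis using G(1,2)[OF P] by simp
  qed
qed

lemma annihilating_pairD:
  assumes "annihilating_pair n r D \<B> \<A>"
  shows "graded_family n r D \<B>" "graded_family n (r - 1) D \<A>"
    "\<And>P S b a. P \<subseteq> {..<n} \<Longrightarrow> S \<subseteq> {..<n} \<Longrightarrow> P \<inter> S = {} \<Longrightarrow> b \<in> \<B> P \<Longrightarrow> a \<in> \<A> S \<Longrightarrow> wedge b a = 0"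
    "\<And>P b v. P \<subseteq> {..<n} \<Longrightarrow> b \<in> \<B> P \<Longrightarrow> cont v b \<in> \<A> P"
    "\<And>P b z. P \<subseteq> {..<n} \<Longrightarrow> b \<in> \<B> P \<Longrightarrow> z \<in> P \<Longrightarrow> b \<in> \<A> (P - {z})"
    "\<exists>b\<in>\<B> {..<r}. b \<noteq> 0"
proof -
  note v = assms[unfolded annihilating_pair_def]
  show "graded_family n r D \<B>" using v by (rule conjunct1)
  show "graded_family n (r - 1) D \<A>" using v[THEN conjunct2] by (rule conjunct1)
  show "wedge b a = 0" if "P \<subseteq> {..<n}" "S \<subseteq> {..<n}" "P \<inter> S = {}" "b \<in> \<B> P" "a \<in> \<A> S" for P S b a
    using v[THEN conjunct2, THEN conjunct2, THEN conjunct1, rule_format, OF that] .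
  show "cont v b \<in> \<A> P" if "P \<subseteq> {..<n}" "b \<in> \<B> P" for P b v
    using v[THEN conjunct2, THEN conjunct2, THEN conjunct2, THEN conjunct1, rule_format, OF that] by (rule conjunct1[THEN spec])
  show "b \<in> \<A> (P - {z})" if "P \<subseteq> {..<n}" "b \<in> \<B> P" "z \<in> P" for P b z
    using v[THEN conjunct2, THEN conjunct2, THEN conjunct2, THEN conjunct1, rule_format, OF that(1,2)] that(3) by blast
  show "\<exists>b\<in>\<B> {..<r}. b \<noteq> 0" using v by blast
qed

text \<open>A set of \<open>r\<close> positions leaves degree 0, where contractions vanish; hence
  shifting cannot lose the nonzero element at \<open>{..<r}\<close>.\<close>

lemma apex_scalar:
  assumes "graded_family n r D \<B>" "b \<in> \<B> {..<r}" "r \<le> n"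
  shows "homog 0 b" "cont v b = 0"
proof -
  have "{..<r} \<subseteq> {..<n}" using assms(3) by auto
  from graded_familyD(4)[OF assms(1) this assms(2)] show "homog 0 b" by simp
  then show "cont v b = 0" by (rule homog_0_cont)
qed

text \<open>If \<open>wedge x a = 0\<close>, the Leibniz rule makes
  \<open>wedge (cont v x) a\<close> equal to \<open>wedge x (cont v a)\<close> up to sign. The
  preimage condition on \<open>a\<close> places \<open>cont v a\<close> at a set of positions that
  is still disjoint from that of \<open>x\<close>.\<close>

lemma annihilating_pair_vertex_shift:
  assumes V: "annihilating_pair n r D \<B> \<A>" and z: "z < n" and rn: "r \<le> n"
  shows "annihilating_pair n r D (vertex_shift z v \<B>) (vertex_shift z v \<A>)"
  unfolding annihilating_pair_def
proof (intro conjI allI impI ballI)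
  note B = annihilating_pairD(1)[OF V] and A = annihilating_pairD(2)[OF V] and cr = annihilating_pairD(3)[OF V]
    and sc = annihilating_pairD(4)[OF V] and sm = annihilating_pairD(5)[OF V]
  show "graded_family n r D (vertex_shift z v \<B>)" by (rule graded_family_vertex_shift[OF B z])
  show "graded_family n (r - 1) D (vertex_shift z v \<A>)" by (rule graded_family_vertex_shift[OF A z])
  {
    fix P S b a assume P: "P \<subseteq> {..<n}" and S: "S \<subseteq> {..<n}" and PS: "P \<inter> S = {}"
      and b: "b \<in> vertex_shift z v \<B> P" and a: "a \<in> vertex_shift z v \<A> S"
    show "wedge b a = 0"
    proof (cases "z \<in> P")
      case True
      then obtain x y where xy: "b = cont v x + y" "x \<in> \<B> (P - {z})" "y \<in> \<B> P"
        using b by (auto simp: vertex_shift_def)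
      have "z \<notin> S" using True PS by blast
      then have a': "a \<in> \<A> S" "cont v a \<in> \<A> (insert z S)" using a by (auto simp: vertex_shift_def)
      have P': "P - {z} \<subseteq> {..<n}" using P by blast
      have "wedge y a = 0" by (rule cr[OF P S PS xy(3) a'(1)])
      moreover have "wedge x a = 0" by (rule cr[OF P' S _ xy(2) a'(1)]) (use PS in blast)
      moreover have "wedge x (cont v a) = 0" by (rule cr[OF P' _ _ xy(2) a'(2)]) (use PS S z in auto)
      ultimately have "wedge (cont v x) a F = 0" for F
        using cont_wedge[OF graded_familyD(4)[OF B P' xy(2)], of v a F] by simp
      then show ?thesis unfolding xy(1) wedge_add_left using \<open>wedge y a = 0\<close> by (simp add: fun_eq_iff)
    next
      case zP: False
      then have b': "b \<in> \<B> P" "cont v b \<in> \<B> (insert z P)" using b by (auto simp: vertex_shift_def)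
      show ?thesis
      proof (cases "z \<in> S")
        case True
        then obtain x y where xy: "a = cont v x + y" "x \<in> \<A> (S - {z})" "y \<in> \<A> S"
          using a by (auto simp: vertex_shift_def)
        have S': "S - {z} \<subseteq> {..<n}" using S by blast
        have "wedge b y = 0" by (rule cr[OF P S PS b'(1) xy(3)])
        moreover have "wedge b x = 0" by (rule cr[OF P S' _ b'(1) xy(2)]) (use PS in blast)
        moreover have "wedge (cont v b) x = 0" by (rule cr[OF _ S' _ b'(2) xy(2)]) (use PS P z in auto)
        ultimately have "wedge b (cont v x) F = 0" for F
          using cont_wedge[OF graded_familyD(4)[OF B P b'(1)], of v x F] by simp
        then show ?thesis unfolding xy(1) wedge_add_right using \<open>wedge b y = 0\<close> by (simp add: fun_eq_iff)
      next
        case False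
        then have "a \<in> \<A> S" using a by (simp add: vertex_shift_def)
        then show ?thesis by (rule cr[OF P S PS b'(1)])
      qed
    qed
  }
  {
    fix P b w assume P: "P \<subseteq> {..<n}" and b: "b \<in> vertex_shift z v \<B> P"
    show "cont w b \<in> vertex_shift z v \<A> P"
    proof (cases "z \<in> P")
      case True
      then obtain x y where xy: "b = cont v x + y" "x \<in> \<B> (P - {z})" "y \<in> \<B> P"
        using b by (auto simp: vertex_shift_def)
      have P': "P - {z} \<subseteq> {..<n}" using P by blast
      have "cont w x \<in> \<A> (P - {z})" by (rule sc[OF P' xy(2)])
      then have "- cont w x \<in> \<A> (P - {z})" by (rule fs.subspace_neg[OF graded_familyD(1)[OF A P']])
      moreover have "cont w b = cont v (- cont w x) + cont w y"
        unfolding xy(1) cont_add cont_neg using cont_anticomm[of w v x] by simp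
      moreover have "cont w y \<in> \<A> P" by (rule sc[OF P xy(3)])
      ultimately show ?thesis using True by (auto simp: vertex_shift_def)
    next
      case False
      then have b': "b \<in> \<B> P" "cont v b \<in> \<B> (insert z P)" using b by (auto simp: vertex_shift_def)
      have P': "insert z P \<subseteq> {..<n}" using P z by simp
      have "cont w (cont v b) \<in> \<A> (insert z P)" by (rule sc[OF P' b'(2)])
      then have "- cont w (cont v b) \<in> \<A> (insert z P)" by (rule fs.subspace_neg[OF graded_familyD(1)[OF A P']])
      then have "cont v (cont w b) \<in> \<A> (insert z P)" using cont_anticomm[of v w b] by simp
      then show ?thesis using False sc[OF P b'(1)] by (simp add: vertex_shift_def)
    qed
  }
  {
    fix P b u assume P: "P \<subseteq> {..<n}" and b: "b \<in> vertex_shift z v \<B> P" and u: "u \<in> P"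
    have "P - {u} \<subseteq> {..<n}" using P by blast
    show "b \<in> vertex_shift z v \<A> (P - {u})"
    proof (cases "z \<in> P")
      case True
      then obtain x y where xy: "b = cont v x + y" "x \<in> \<B> (P - {z})" "y \<in> \<B> P"
        using b by (auto simp: vertex_shift_def)
      have P': "P - {z} \<subseteq> {..<n}" using P by blast
      show ?thesis
      proof (cases "u = z")
        case uz: True
        have "cont v x \<in> \<A> (P - {z})" by (rule sc[OF P' xy(2)])
        moreover have "y \<in> \<A> (P - {z})" by (rule sm[OF P xy(3) True])
        ultimately have "b \<in> \<A> (P - {z})" unfolding xy(1) by (rule fs.subspace_add[OF graded_familyD(1)[OF A P']])
        \<comment> \<open>The summand \<open>cont v x\<close> disappears because contracting twice
          by \<open>v\<close> gives zero.\<close>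
        moreover have "cont v b \<in> \<A> P" unfolding xy(1) cont_add using sc[OF P xy(3), of v] by simp
        ultimately show ?thesis using True uz by (simp add: vertex_shift_def insert_absorb)
      next
        case False
        have "x \<in> \<A> (P - {z} - {u})" by (rule sm[OF P' xy(2)]) (use u False in blast)
        moreover have "P - {z} - {u} = P - {u} - {z}" by blast
        moreover have "y \<in> \<A> (P - {u})" by (rule sm[OF P xy(3) u])
        ultimately show ?thesis using True False xy(1) by (auto simp: vertex_shift_def)
      qed
    next
      case False
      then have b': "b \<in> \<B> P" "cont v b \<in> \<B> (insert z P)" using b by (auto simp: vertex_shift_def)
      have P': "insert z P \<subseteq> {..<n}" using P z by simp
      have "cont v b \<in> \<A> (insert z P - {u})" by (rule sm[OF P' b'(2)]) (use u in blast)
      moreover have "insert z P - {u} = insert z (P - {u})" using u False by blast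
      ultimately show ?thesis using False sm[OF P b'(1) u] by (simp add: vertex_shift_def)
    qed
  }
  obtain b where b: "b \<in> \<B> {..<r}" "b \<noteq> 0" using annihilating_pairD(6)[OF V] by blast
  have r: "{..<r} \<subseteq> {..<n}" "insert z {..<r} \<subseteq> {..<n}" "{..<r} - {z} \<subseteq> {..<n}" using rn z by auto
  have "b \<in> vertex_shift z v \<B> {..<r}"
  proof (cases "z \<in> {..<r}")
    case True
    have "0 \<in> \<B> ({..<r} - {z})" by (rule fs.subspace_0[OF graded_familyD(1)[OF B r(3)]])
    moreover have "b = cont v 0 + b" by simp
    ultimately show ?thesis using True b(1) unfolding vertex_shift_def by (simp only: if_True) blast
  next
    case False
    have "cont v b = 0" by (rule apex_scalar(2)[OF B b(1) rn])
    then show ?thesis using False b(1) fs.subspace_0[OF graded_familyD(1)[OF B r(2)]] by (simp add: vertex_shift_def)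
  qed
  then show "\<exists>b\<in>vertex_shift z v \<B> {..<r}. b \<noteq> 0" using b(2) by blast
qed

lemma position_shift_i: "i \<in> P \<Longrightarrow> j \<notin> P \<Longrightarrow> position_shift i j \<F> P = {x + y |x y. x \<in> \<F> (insert j (P - {i})) \<and> y \<in> \<F> P}"
  and position_shift_j: "j \<in> P \<Longrightarrow> i \<notin> P \<Longrightarrow> position_shift i j \<F> P = {x \<in> \<F> P. x \<in> \<F> (insert i (P - {j}))}"
  and position_shift_eq: "i \<in> P \<longleftrightarrow> j \<in> P \<Longrightarrow> position_shift i j \<F> P = \<F> P"
  by (auto simp: position_shift_def)

text \<open>When a set with \<open>i\<close> draws a summand from the piece with \<open>j\<close>
  instead, the elements at a disjoint set with \<open>j\<close> also lie in the piece with
  \<open>i\<close> instead, and the two modified sets are disjoint again.\<close>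

lemma annihilating_pair_position_shift:
  assumes V: "annihilating_pair n r D \<B> \<A>" and ij: "i < j" "j < n" and rn: "r \<le> n"
  shows "annihilating_pair n r D (position_shift i j \<B>) (position_shift i j \<A>)"
  unfolding annihilating_pair_def
proof (intro conjI allI impI ballI)
  note B = annihilating_pairD(1)[OF V] and A = annihilating_pairD(2)[OF V] and cr = annihilating_pairD(3)[OF V]
    and sc = annihilating_pairD(4)[OF V] and sm = annihilating_pairD(5)[OF V]
  have i: "i < n" using ij by simp
  have inej: "i \<noteq> j" using ij by simp
  show "graded_family n r D (position_shift i j \<B>)" by (rule graded_family_position_shift[OF B i ij(2)])
  show "graded_family n (r - 1) D (position_shift i j \<A>)" by (rule graded_family_position_shift[OF A i ij(2)])
  have ins: "insert x (P - {y}) \<subseteq> {..<n}" if "P \<subseteq> {..<n}" "x < n" for P x y using that by auto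
  {
    fix P S b a assume P: "P \<subseteq> {..<n}" and S: "S \<subseteq> {..<n}" and PS: "P \<inter> S = {}"
      and b: "b \<in> position_shift i j \<B> P" and a: "a \<in> position_shift i j \<A> S"
    consider "i \<in> P" "j \<notin> P" | "j \<in> P" "i \<notin> P" | "i \<in> P" "j \<in> P" | "i \<notin> P" "j \<notin> P" by blast
    then show "wedge b a = 0"
    proof cases
      case 1
      then obtain x y where xy: "b = x + y" "x \<in> \<B> (insert j (P - {i}))" "y \<in> \<B> P"
        using b unfolding position_shift_i[OF 1] by blast
      have P': "insert j (P - {i}) \<subseteq> {..<n}" by (rule ins[OF P ij(2)])
      have iS: "i \<notin> S" using 1 PS by blast
      have "a \<in> \<A> S" using a iS by (simp add: position_shift_def split: if_splits)
      then have "wedge y a = 0" by (rule cr[OF P S PS xy(3)])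
      moreover have "wedge x a = 0"
      proof (cases "j \<in> S")
        case True
        then have aj: "a \<in> \<A> (insert i (S - {j}))" using a iS by (simp add: position_shift_j)
        show ?thesis by (rule cr[OF P' ins[OF S i] _ xy(2) aj]) (use PS 1 iS inej in auto)
      next
        case False
        then show ?thesis by (intro cr[OF P' S _ xy(2) \<open>a \<in> \<A> S\<close>]) (use PS in auto)
      qed
      ultimately show ?thesis unfolding xy(1) wedge_add_left by simp
    next
      case 2
      then have b': "b \<in> \<B> P" "b \<in> \<B> (insert i (P - {j}))" using b by (simp_all add: position_shift_j)
      have jS: "j \<notin> S" using 2 PS by blast
      show ?thesis
      proof (cases "i \<in> S")
        case True
        then obtain x y where xy: "a = x + y" "x \<in> \<A> (insert j (S - {i}))" "y \<in> \<A> S"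
          using a unfolding position_shift_i[OF True jS] by blast
        have "wedge b x = 0"
          by (rule cr[OF ins[OF P i] ins[OF S ij(2)] _ b'(2) xy(2)]) (use PS 2 jS inej in auto)
        moreover have "wedge b y = 0" by (rule cr[OF P S PS b'(1) xy(3)])
        ultimately show ?thesis unfolding xy(1) wedge_add_right by simp
      next
        case False
        then have "a \<in> \<A> S" using a jS by (simp add: position_shift_eq)
        then show ?thesis by (rule cr[OF P S PS b'(1)])
      qed
    next
      case 3
      then have "i \<notin> S" "j \<notin> S" using PS by auto
      then show ?thesis using a b 3 by (intro cr[OF P S PS]) (simp_all add: position_shift_eq)
    next
      case 4
      then have b': "b \<in> \<B> P" using b by (simp add: position_shift_eq)
      show ?thesis
      proof (cases "i \<in> S \<and> j \<notin> S")
        case True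
        then have T: "i \<in> S" "j \<notin> S" by auto
        then obtain x y where xy: "a = x + y" "x \<in> \<A> (insert j (S - {i}))" "y \<in> \<A> S"
          using a unfolding position_shift_i[OF T] by blast
        have "wedge b x = 0" by (rule cr[OF P ins[OF S ij(2)] _ b' xy(2)]) (use PS 4 in auto)
        moreover have "wedge b y = 0" by (rule cr[OF P S PS b' xy(3)])
        ultimately show ?thesis unfolding xy(1) wedge_add_right by simp
      next
        case False
        then have "a \<in> \<A> S" using a by (auto simp: position_shift_def split: if_splits)
        then show ?thesis by (rule cr[OF P S PS b'])
      qed
    qed
  }
  {
    fix P b w assume P: "P \<subseteq> {..<n}" and b: "b \<in> position_shift i j \<B> P"
    consider "i \<in> P" "j \<notin> P" | "j \<in> P" "i \<notin> P" | "i \<in> P \<longleftrightarrow> j \<in> P" by blast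
    then show "cont w b \<in> position_shift i j \<A> P"
    proof cases
      case 1
      then obtain x y where xy: "b = x + y" "x \<in> \<B> (insert j (P - {i}))" "y \<in> \<B> P"
        using b unfolding position_shift_i[OF 1] by blast
      show ?thesis unfolding position_shift_i[OF 1] xy(1) cont_add
        using sc[OF P xy(3), of w] sc[OF ins[OF P ij(2)] xy(2), of w] by blast
    next
      case 2
      then show ?thesis using b sc[OF P, of b w] sc[OF ins[OF P i], of b j w] by (simp add: position_shift_j)
    next
      case 3
      then show ?thesis using b sc[OF P, of b w] by (simp add: position_shift_eq)
    qed
  }
  {
    fix P b u assume P: "P \<subseteq> {..<n}" and b: "b \<in> position_shift i j \<B> P" and u: "u \<in> P"
    have Pu: "P - {u} \<subseteq> {..<n}" using P by blast
    consider "i \<in> P" "j \<notin> P" | "j \<in> P" "i \<notin> P" | "i \<in> P" "j \<in> P" | "i \<notin> P" "j \<notin> P" by blast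
    then show "b \<in> position_shift i j \<A> (P - {u})"
    proof cases
      case 1
      then obtain x y where xy: "b = x + y" "x \<in> \<B> (insert j (P - {i}))" "y \<in> \<B> P"
        using b unfolding position_shift_i[OF 1] by blast
      have y: "y \<in> \<A> (P - {u})" by (rule sm[OF P xy(3) u])
      show ?thesis
      proof (cases "u = i")
        case True
        have "x \<in> \<A> (insert j (P - {i}) - {j})" by (rule sm[OF ins[OF P ij(2)] xy(2)]) simp
        moreover have "insert j (P - {i}) - {j} = P - {i}" using 1 by auto
        ultimately have "b \<in> \<A> (P - {u})"
          unfolding xy(1) using y True fs.subspace_add[OF graded_familyD(1)[OF A Pu]] by simp
        then show ?thesis using True 1 by (simp add: position_shift_eq)
      next
        case False
        have "x \<in> \<A> (insert j (P - {i}) - {u})" by (rule sm[OF ins[OF P ij(2)] xy(2)]) (use u False in blast)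
        moreover have "insert j (P - {i}) - {u} = insert j (P - {u} - {i})" using u 1 False by auto
        moreover have "i \<in> P - {u}" "j \<notin> P - {u}" using 1 False by auto
        ultimately show ?thesis unfolding position_shift_i[OF \<open>i \<in> P - {u}\<close> \<open>j \<notin> P - {u}\<close>] xy(1) using y by auto
      qed
    next
      case 2
      then have b': "b \<in> \<B> P" "b \<in> \<B> (insert i (P - {j}))" using b by (simp_all add: position_shift_j)
      have b1: "b \<in> \<A> (P - {u})" by (rule sm[OF P b'(1) u])
      show ?thesis
      proof (cases "u = j")
        case True
        then show ?thesis using b1 2 by (simp add: position_shift_eq)
      next
        case False
        have "b \<in> \<A> (insert i (P - {j}) - {u})" by (rule sm[OF ins[OF P i] b'(2)]) (use u False in blast)
        moreover have "insert i (P - {j}) - {u} = insert i (P - {u} - {j})" using u 2 False by auto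
        ultimately show ?thesis using b1 2 False by (simp add: position_shift_j)
      qed
    next
      case 3
      then have b': "b \<in> \<B> P" using b by (simp add: position_shift_eq)
      have b1: "b \<in> \<A> (P - {u})" by (rule sm[OF P b' u])
      have bij: "b \<in> \<A> (P - {i})" "b \<in> \<A> (P - {j})" using sm[OF P b'] 3 by auto
      consider "u = i" | "u = j" | "u \<noteq> i" "u \<noteq> j" by blast
      then show ?thesis
      proof cases
        case 1
        have "insert i (P - {u} - {j}) = P - {j}" using 3 1 inej by auto
        then show ?thesis using 1 3 bij inej by (simp add: position_shift_j)
      next
        case 2
        have T: "i \<in> P - {u}" "j \<notin> P - {u}" using 2 3 inej by auto
        have "insert j (P - {u} - {i}) = P - {i}" using 2 3 inej by auto
        moreover have "b = b + 0" by simp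
        ultimately show ?thesis
          unfolding position_shift_i[OF T] using bij(1) fs.subspace_0[OF graded_familyD(1)[OF A Pu]] by auto
      next
        case other: 3
        then show ?thesis using 3 b1 by (simp add: position_shift_eq)
      qed
    next
      case 4
      then show ?thesis using b sm[OF P, of b u] u by (simp add: position_shift_eq)
    qed
  }
  obtain b where b: "b \<in> \<B> {..<r}" "b \<noteq> 0" using annihilating_pairD(6)[OF V] by blast
  have "b \<in> position_shift i j \<B> {..<r}"
  proof (cases "i < r \<and> \<not> j < r")
    case True
    then have T: "i \<in> {..<r}" "j \<notin> {..<r}" by auto
    have "insert j ({..<r} - {i}) \<subseteq> {..<n}" using rn ij by auto
    from fs.subspace_0[OF graded_familyD(1)[OF B this]]
    have "0 \<in> \<B> (insert j ({..<r} - {i}))" .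
    moreover have "b = 0 + b" by simp
    ultimately show ?thesis unfolding position_shift_i[OF T] using b(1) by blast
  next
    case False
    then have "i \<in> {..<r} \<longleftrightarrow> j \<in> {..<r}" using ij by auto
    then show ?thesis using b(1) by (simp only: position_shift_eq)
  qed
  then show "\<exists>b\<in>position_shift i j \<B> {..<r}. b \<noteq> 0" using b(2) by blast
qed

end

text \<open>Within each pair \<open>P\<close>, \<open>\<tau> P\<close> the total is preserved, and
  what moves to \<open>\<tau> P\<close> does not lose weight.\<close>

lemma weight_shift:
  fixes \<omega> old new :: "'i \<Rightarrow> nat"
  assumes U: "finite U" "Src \<subseteq> U" "\<tau> ` Src \<subseteq> U" "inj_on \<tau> Src" "Src \<inter> \<tau> ` Src = {}"
    and sum: "\<And>P. P \<in> Src \<Longrightarrow> new P + new (\<tau> P) = old P + old (\<tau> P)"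
    and grow: "\<And>P. P \<in> Src \<Longrightarrow> old (\<tau> P) \<le> new (\<tau> P)"
    and rest: "\<And>P. P \<in> U \<Longrightarrow> P \<notin> Src \<Longrightarrow> P \<notin> \<tau> ` Src \<Longrightarrow> new P = old P"
    and mono: "\<And>P. P \<in> Src \<Longrightarrow> \<omega> P \<le> \<omega> (\<tau> P)"
  shows "(\<Sum>P\<in>U. \<omega> P * old P) \<le> (\<Sum>P\<in>U. \<omega> P * new P)"
    and "P0 \<in> Src \<Longrightarrow> \<omega> P0 < \<omega> (\<tau> P0) \<Longrightarrow> old (\<tau> P0) < new (\<tau> P0) \<Longrightarrow>
      (\<Sum>P\<in>U. \<omega> P * old P) < (\<Sum>P\<in>U. \<omega> P * new P)"
proof -
  have finS: "finite Src" using U finite_subset by blast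
  have split: "(\<Sum>P\<in>U. \<omega> P * h P) = (\<Sum>P\<in>Src. \<omega> P * h P + \<omega> (\<tau> P) * h (\<tau> P))
      + (\<Sum>P\<in>U - (Src \<union> \<tau> ` Src). \<omega> P * h P)" for h :: "'i \<Rightarrow> nat"
  proof -
    have "(\<Sum>P\<in>U. \<omega> P * h P) = (\<Sum>P\<in>Src \<union> \<tau> ` Src. \<omega> P * h P) + (\<Sum>P\<in>U - (Src \<union> \<tau> ` Src). \<omega> P * h P)"
      using sum.subset_diff[of "Src \<union> \<tau> ` Src" U] U by (simp add: add.commute)
    also have "(\<Sum>P\<in>Src \<union> \<tau> ` Src. \<omega> P * h P) = (\<Sum>P\<in>Src. \<omega> P * h P) + (\<Sum>P\<in>\<tau> ` Src. \<omega> P * h P)"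
      by (rule sum.union_disjoint) (use finS U(5) in auto)
    also have "(\<Sum>P\<in>\<tau> ` Src. \<omega> P * h P) = (\<Sum>P\<in>Src. \<omega> (\<tau> P) * h (\<tau> P))"
      by (simp add: sum.reindex[OF U(4)])
    finally show ?thesis by (simp add: sum.distrib)
  qed
  have rest': "(\<Sum>P\<in>U - (Src \<union> \<tau> ` Src). \<omega> P * old P) = (\<Sum>P\<in>U - (Src \<union> \<tau> ` Src). \<omega> P * new P)"
    by (rule sum.cong) (use rest in auto)
  have diff: "\<omega> P * new P + \<omega> (\<tau> P) * new (\<tau> P) = \<omega> P * old P + \<omega> (\<tau> P) * old (\<tau> P)
      + (\<omega> (\<tau> P) - \<omega> P) * (new (\<tau> P) - old (\<tau> P))" if P: "P \<in> Src" for P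
  proof -
    obtain e where e: "\<omega> (\<tau> P) = \<omega> P + e" using mono[OF P] le_Suc_ex by blast
    obtain d where d: "new (\<tau> P) = old (\<tau> P) + d" using grow[OF P] le_Suc_ex by blast
    have "old P = new P + d" using sum[OF P] d by simp
    then show ?thesis using e d by (simp add: algebra_simps)
  qed
  show "(\<Sum>P\<in>U. \<omega> P * old P) \<le> (\<Sum>P\<in>U. \<omega> P * new P)"
    unfolding split rest' by (rule add_right_mono, rule sum_mono) (simp add: diff)
  show "(\<Sum>P\<in>U. \<omega> P * old P) < (\<Sum>P\<in>U. \<omega> P * new P)"
    if "P0 \<in> Src" "\<omega> P0 < \<omega> (\<tau> P0)" "old (\<tau> P0) < new (\<tau> P0)"
    unfolding split rest'
    by (rule add_strict_right_mono, rule sum_strict_mono_ex1[OF finS]) (use that in \<open>auto simp: diff\<close>)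
qed

definition mono_weight :: "nat \<Rightarrow> (nat set \<Rightarrow> nat) \<Rightarrow> bool" where
  "mono_weight n \<omega> \<longleftrightarrow> (\<forall>P\<subseteq>{..<n}. (\<forall>z<n. z \<notin> P \<longrightarrow> \<omega> P \<le> \<omega> (insert z P)) \<and>
     (\<forall>i j. i < j \<longrightarrow> j \<in> P \<longrightarrow> i \<notin> P \<longrightarrow> \<omega> P \<le> \<omega> (insert i (P - {j}))))"

definition weighted_dim :: "nat \<Rightarrow> (nat set \<Rightarrow> nat) \<Rightarrow> (nat set \<Rightarrow> ('a set \<Rightarrow> 'f::field) set) \<Rightarrow> nat" where
  "weighted_dim n \<omega> \<F> = (\<Sum>P\<in>Pow {..<n}. \<omega> P * fs.dim (\<F> P))"

definition stable :: "nat \<Rightarrow> (nat set \<Rightarrow> ('a::linorder set \<Rightarrow> 'f::field) set) \<Rightarrow> bool" where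
  "stable n \<B> \<longleftrightarrow> (\<forall>P\<subseteq>{..<n}. (\<forall>z<n. z \<notin> P \<longrightarrow> (\<forall>v. \<forall>b\<in>\<B> P. cont v b \<in> \<B> (insert z P))) \<and>
     (\<forall>i j. i < j \<longrightarrow> j \<in> P \<longrightarrow> i \<notin> P \<longrightarrow> \<B> P \<subseteq> \<B> (insert i (P - {j}))))"

context
  fixes Y :: "'a::linorder set" and D :: "nat \<Rightarrow> ('a set \<Rightarrow> 'f::field) set"
  assumes D: "contraction_closed Y D"
begin

lemma weighted_dim_vertex_shift:
  assumes F: "graded_family n R D \<F>" and z: "z < n" and \<omega>: "mono_weight n \<omega>"
  shows "weighted_dim n \<omega> \<F> \<le> weighted_dim n \<omega> (vertex_shift z v \<F>)"
    and "P0 \<subseteq> {..<n} \<Longrightarrow> z \<notin> P0 \<Longrightarrow> b \<in> \<F> P0 \<Longrightarrow> cont v b \<notin> \<F> (insert z P0) \<Longrightarrow>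
      \<omega> P0 < \<omega> (insert z P0) \<Longrightarrow> weighted_dim n \<omega> \<F> < weighted_dim n \<omega> (vertex_shift z v \<F>)"
proof -
  let ?Src = "{P \<in> Pow {..<n}. z \<notin> P}"
  note G = graded_familyD[OF D F]
  note fin = finite_Pow_Y[OF D]
  have new: "vertex_shift z v \<F> P = {x \<in> \<F> P. cont v x \<in> \<F> (insert z P)}"
    "vertex_shift z v \<F> (insert z P) = {cont v x + y |x y. x \<in> \<F> P \<and> y \<in> \<F> (insert z P)}" if "P \<in> ?Src" for P
    using that by (auto simp: vertex_shift_def)
  have sub: "P \<subseteq> {..<n}" "insert z P \<subseteq> {..<n}" if "P \<in> ?Src" for P using that z by auto
  have sum: "fs.dim (vertex_shift z v \<F> P) + fs.dim (vertex_shift z v \<F> (insert z P)) = fs.dim (\<F> P) + fs.dim (\<F> (insert z P))"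
    if "P \<in> ?Src" for P
    unfolding new[OF that] using sub[OF that] by (intro dim_shift[OF lin_cont G(1) G(3) fin G(1) G(3) fin])
  have inc: "\<F> (insert z P) \<subseteq> vertex_shift z v \<F> (insert z P)" if "P \<in> ?Src" for P
  proof
    fix y assume "y \<in> \<F> (insert z P)"
    moreover have "y = cont v 0 + y" by simp
    ultimately show "y \<in> vertex_shift z v \<F> (insert z P)"
      unfolding new(2)[OF that] using fs.subspace_0[OF G(1)[OF sub(1)[OF that]]] by blast
  qed
  have supp: "vertex_shift z v \<F> (insert z P) \<subseteq> supp_on (Pow Y)" if "P \<in> ?Src" for P
    by (rule graded_familyD(3)[OF D graded_family_vertex_shift[OF D F z] sub(2)[OF that]])
  have grow: "fs.dim (\<F> (insert z P)) \<le> fs.dim (vertex_shift z v \<F> (insert z P))" if "P \<in> ?Src" for P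
    by (rule dim_mono[OF inc[OF that] supp[OF that] fin])
  have m: "\<omega> P \<le> \<omega> (insert z P)" if "P \<in> ?Src" for P
    using \<omega> that z unfolding mono_weight_def by blast
  have im: "insert z ` ?Src = {P \<in> Pow {..<n}. z \<in> P}"
  proof (intro equalityI subsetI)
    fix P assume "P \<in> {P \<in> Pow {..<n}. z \<in> P}"
    then have "P = insert z (P - {z})" "P - {z} \<in> ?Src" by auto
    then show "P \<in> insert z ` ?Src" by blast
  qed (use z in auto)
  have inj: "inj_on (insert z) ?Src" by (rule inj_onI) (auto simp: insert_ident)
  note w = weight_shift[of "Pow {..<n}" ?Src "insert z" "\<lambda>P. fs.dim (vertex_shift z v \<F> P)" "\<lambda>P. fs.dim (\<F> P)" \<omega>,
      OF _ _ _ inj _ sum grow _ m, unfolded im]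
  show "weighted_dim n \<omega> \<F> \<le> weighted_dim n \<omega> (vertex_shift z v \<F>)" unfolding weighted_dim_def by (rule w(1)) auto
  show "weighted_dim n \<omega> \<F> < weighted_dim n \<omega> (vertex_shift z v \<F>)"
    if P0: "P0 \<subseteq> {..<n}" "z \<notin> P0" and b: "b \<in> \<F> P0" "cont v b \<notin> \<F> (insert z P0)" and lt: "\<omega> P0 < \<omega> (insert z P0)"
  proof -
    have S: "P0 \<in> ?Src" using P0 by simp
    have "cont v b + 0 \<in> vertex_shift z v \<F> (insert z P0)"
      unfolding new(2)[OF S] using b(1) fs.subspace_0[OF G(1)[OF sub(2)[OF S]]] by blast
    then have "\<F> (insert z P0) \<subset> vertex_shift z v \<F> (insert z P0)" using inc[OF S] b(2) by auto
    then have d: "fs.dim (\<F> (insert z P0)) < fs.dim (vertex_shift z v \<F> (insert z P0))"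
      by (rule dim_strict_mono[OF G(1)[OF sub(2)[OF S]] _ supp[OF S] fin])
    show ?thesis unfolding weighted_dim_def by (rule w(2)[where ?P0.0 = P0]) (use S lt d in auto)
  qed
qed

lemma weighted_dim_position_shift:
  assumes F: "graded_family n R D \<F>" and ij: "i < j" "j < n" and \<omega>: "mono_weight n \<omega>"
  shows "weighted_dim n \<omega> \<F> \<le> weighted_dim n \<omega> (position_shift i j \<F>)"
    and "P0 \<subseteq> {..<n} \<Longrightarrow> j \<in> P0 \<Longrightarrow> i \<notin> P0 \<Longrightarrow> \<not> \<F> P0 \<subseteq> \<F> (insert i (P0 - {j})) \<Longrightarrow>
      \<omega> P0 < \<omega> (insert i (P0 - {j})) \<Longrightarrow> weighted_dim n \<omega> \<F> < weighted_dim n \<omega> (position_shift i j \<F>)"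
proof -
  let ?Src = "{P \<in> Pow {..<n}. j \<in> P \<and> i \<notin> P}"
  let ?\<tau> = "\<lambda>P. insert i (P - {j})"
  note G = graded_familyD[OF D F]
  note fin = finite_Pow_Y[OF D]
  have i: "i < n" using ij by simp
  have new: "position_shift i j \<F> P = {x \<in> \<F> P. x \<in> \<F> (?\<tau> P)}"
    "position_shift i j \<F> (?\<tau> P) = {x + y |x y. x \<in> \<F> P \<and> y \<in> \<F> (?\<tau> P)}" if "P \<in> ?Src" for P
  proof -
    show "position_shift i j \<F> P = {x \<in> \<F> P. x \<in> \<F> (?\<tau> P)}" by (rule position_shift_j[OF D]) (use that in auto)
    have T: "i \<in> ?\<tau> P" "j \<notin> ?\<tau> P" using that ij by auto
    have "insert j (?\<tau> P - {i}) = P" using that by auto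
    then show "position_shift i j \<F> (?\<tau> P) = {x + y |x y. x \<in> \<F> P \<and> y \<in> \<F> (?\<tau> P)}"
      using position_shift_i[OF D T, of \<F>] by simp
  qed
  have sub: "P \<subseteq> {..<n}" "?\<tau> P \<subseteq> {..<n}" if "P \<in> ?Src" for P using that i by auto
  have sum: "fs.dim (position_shift i j \<F> P) + fs.dim (position_shift i j \<F> (?\<tau> P)) = fs.dim (\<F> P) + fs.dim (\<F> (?\<tau> P))"
    if "P \<in> ?Src" for P
    unfolding new[OF that] using sub[OF that] by (intro dim_shift[OF lin_id[OF D] G(1) G(3) fin G(1) G(3) fin])
  have inc: "\<F> (?\<tau> P) \<subseteq> position_shift i j \<F> (?\<tau> P)" if "P \<in> ?Src" for P
  proof
    fix y assume "y \<in> \<F> (?\<tau> P)"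
    moreover have "y = 0 + y" by simp
    ultimately show "y \<in> position_shift i j \<F> (?\<tau> P)"
      unfolding new(2)[OF that] using fs.subspace_0[OF G(1)[OF sub(1)[OF that]]] by blast
  qed
  have supp: "position_shift i j \<F> (?\<tau> P) \<subseteq> supp_on (Pow Y)" if "P \<in> ?Src" for P
    by (rule graded_familyD(3)[OF D graded_family_position_shift[OF D F i ij(2)] sub(2)[OF that]])
  have grow: "fs.dim (\<F> (?\<tau> P)) \<le> fs.dim (position_shift i j \<F> (?\<tau> P))" if "P \<in> ?Src" for P
    by (rule dim_mono[OF inc[OF that] supp[OF that] fin])
  have m: "\<omega> P \<le> \<omega> (?\<tau> P)" if "P \<in> ?Src" for P
    using \<omega> that ij unfolding mono_weight_def by blast
  have im: "?\<tau> ` ?Src = {P \<in> Pow {..<n}. i \<in> P \<and> j \<notin> P}"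
  proof (intro equalityI subsetI)
    fix P assume "P \<in> {P \<in> Pow {..<n}. i \<in> P \<and> j \<notin> P}"
    then have "P = ?\<tau> (insert j (P - {i}))" "insert j (P - {i}) \<in> ?Src" using ij by auto
    then show "P \<in> ?\<tau> ` ?Src" by blast
  qed (use ij i in auto)
  have inj: "inj_on ?\<tau> ?Src"
  proof (rule inj_onI)
    fix P Q assume a: "P \<in> ?Src" "Q \<in> ?Src" "?\<tau> P = ?\<tau> Q"
    have "P = insert j (?\<tau> P - {i})" "Q = insert j (?\<tau> Q - {i})" using a(1,2) by auto
    then show "P = Q" using a(3) by simp
  qed
  note w = weight_shift[of "Pow {..<n}" ?Src ?\<tau> "\<lambda>P. fs.dim (position_shift i j \<F> P)" "\<lambda>P. fs.dim (\<F> P)" \<omega>,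
      OF _ _ _ inj _ sum grow _ m, unfolded im]
  have rest: "fs.dim (position_shift i j \<F> P) = fs.dim (\<F> P)"
    if "P \<notin> ?Src" "P \<notin> {P \<in> Pow {..<n}. i \<in> P \<and> j \<notin> P}" "P \<in> Pow {..<n}" for P
    using that by (subst position_shift_eq[OF D]) auto
  show "weighted_dim n \<omega> \<F> \<le> weighted_dim n \<omega> (position_shift i j \<F>)" unfolding weighted_dim_def by (rule w(1)) (use rest in auto)
  show "weighted_dim n \<omega> \<F> < weighted_dim n \<omega> (position_shift i j \<F>)"
    if P0: "P0 \<subseteq> {..<n}" "j \<in> P0" "i \<notin> P0" and b: "\<not> \<F> P0 \<subseteq> \<F> (?\<tau> P0)" and lt: "\<omega> P0 < \<omega> (?\<tau> P0)"
  proof -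
    have S: "P0 \<in> ?Src" using P0 by simp
    obtain b where b: "b \<in> \<F> P0" "b \<notin> \<F> (?\<tau> P0)" using b by blast
    have "b + 0 \<in> position_shift i j \<F> (?\<tau> P0)"
      unfolding new(2)[OF S] using b(1) fs.subspace_0[OF G(1)[OF sub(2)[OF S]]] by blast
    then have "\<F> (?\<tau> P0) \<subset> position_shift i j \<F> (?\<tau> P0)" using inc[OF S] b(2) by auto
    then have d: "fs.dim (\<F> (?\<tau> P0)) < fs.dim (position_shift i j \<F> (?\<tau> P0))"
      by (rule dim_strict_mono[OF G(1)[OF sub(2)[OF S]] _ supp[OF S] fin])
    show ?thesis unfolding weighted_dim_def by (rule w(2)[where ?P0.0 = P0]) (use S lt d rest in auto)
  qed
qed

text \<open>Every failure of stability allows a shift that strictly increases one particular bounded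
  weighted dimension. Since the shifts decrease no monotone weighted dimension, the pair reached
  serves all monotone weights at once. Stability is sought for \<open>\<B>\<close> only;
  \<open>\<A>\<close> is shifted along.\<close>

lemma exists_stable:
  assumes V: "annihilating_pair n r D \<B> \<A>" and rn: "r \<le> n"
  shows "\<exists>\<B>' \<A>'. annihilating_pair n r D \<B>' \<A>' \<and> stable n \<B>' \<and>
    (\<forall>\<omega>. mono_weight n \<omega> \<longrightarrow> weighted_dim n \<omega> \<B> \<le> weighted_dim n \<omega> \<B>' \<and> weighted_dim n \<omega> \<A> \<le> weighted_dim n \<omega> \<A>')"
proof -
  \<comment> \<open>Small positions are heavy: adding \<open>z\<close> gains
    \<open>n - z > 0\<close>, and replacing \<open>j\<close> by \<open>i < j\<close> gains
    \<open>j - i\<close>.\<close>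
  define rk where "rk P = (\<Sum>z\<in>P. n - z)" for P
  have rk1: "rk P < rk (insert z P)" if "P \<subseteq> {..<n}" "z < n" "z \<notin> P" for P z
    using that finite_subset[of P "{..<n}"] by (simp add: rk_def)
  have rk2: "rk P < rk (insert i (P - {j}))" if "P \<subseteq> {..<n}" "i < j" "j \<in> P" "i \<notin> P" for P i j
  proof -
    have fin: "finite P" using that(1) finite_subset by blast
    have "rk P = (n - j) + rk (P - {j})" unfolding rk_def by (rule sum.remove[OF fin that(3)])
    moreover have "rk (insert i (P - {j})) = (n - i) + rk (P - {j})" using fin that by (simp add: rk_def)
    moreover have "j < n" using that by blast
    ultimately show ?thesis using that(2) by simp
  qed
  have rkm: "mono_weight n rk" unfolding mono_weight_def using rk1 rk2 by (auto intro: less_imp_le)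
  define M where "M = (\<Sum>P\<in>Pow {..<n}. rk P * fs.dim (supp_on (Pow Y) :: ('a set \<Rightarrow> 'f) set))"
  have bound: "weighted_dim n rk \<B> \<le> M" if "graded_family n r D \<B>" for \<B>
    unfolding weighted_dim_def M_def
    by (intro sum_mono mult_le_mono2 dim_mono[OF _ order_refl finite_Pow_Y[OF D]])
      (use graded_familyD(3)[OF D that] in blast)
  show ?thesis
    using V
  proof (induction "M - weighted_dim n rk \<B>" arbitrary: \<B> \<A> rule: less_induct)
    case less
    note B = annihilating_pairD(1)[OF D less.prems] and A = annihilating_pairD(2)[OF D less.prems]
    have step: ?case if v': "annihilating_pair n r D \<B>1 \<A>1" and lt: "weighted_dim n rk \<B> < weighted_dim n rk \<B>1"
      and le: "\<And>\<omega>. mono_weight n \<omega> \<Longrightarrow> weighted_dim n \<omega> \<B> \<le> weighted_dim n \<omega> \<B>1 \<and> weighted_dim n \<omega> \<A> \<le> weighted_dim n \<omega> \<A>1" for \<B>1 \<A>1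
    proof -
      have "M - weighted_dim n rk \<B>1 < M - weighted_dim n rk \<B>"
        using lt bound[OF annihilating_pairD(1)[OF D v']] by simp
      from less.hyps[OF this v'] show ?thesis using le by (meson order_trans)
    qed
    show ?case
    proof (cases "stable n \<B>")
      case True
      then show ?thesis using less.prems by blast
    next
      case False
      then consider (h) P z v b where "P \<subseteq> {..<n}" "z < n" "z \<notin> P" "b \<in> \<B> P" "cont v b \<notin> \<B> (insert z P)"
        | (w) P i j where "P \<subseteq> {..<n}" "i < j" "j \<in> P" "i \<notin> P" "\<not> \<B> P \<subseteq> \<B> (insert i (P - {j}))"
        unfolding stable_def by blast
      then show ?thesis
      proof cases
        case h
        show ?thesis
        proof (rule step[OF annihilating_pair_vertex_shift[OF D less.prems h(2) rn, of v]])
          show "weighted_dim n rk \<B> < weighted_dim n rk (vertex_shift z v \<B>)"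
            by (rule weighted_dim_vertex_shift(2)[OF B h(2) rkm h(1,3,4,5) rk1[OF h(1-3)]])
        qed (use weighted_dim_vertex_shift(1)[OF B h(2)] weighted_dim_vertex_shift(1)[OF A h(2)] in blast)
      next
        case w
        have j: "j < n" using w by blast
        show ?thesis
        proof (rule step[OF annihilating_pair_position_shift[OF D less.prems w(2) j rn]])
          show "weighted_dim n rk \<B> < weighted_dim n rk (position_shift i j \<B>)"
            by (rule weighted_dim_position_shift(2)[OF B w(2) j rkm w(1,3,4,5) rk2[OF w(1-4)]])
        qed (use weighted_dim_position_shift(1)[OF B w(2) j] weighted_dim_position_shift(1)[OF A w(2) j] in blast)
      qed
    qed
  qed
qed

end

section \<open>The dimension bound\<close>

lemma homog_0_nonzero: "homog 0 b \<Longrightarrow> b \<noteq> 0 \<Longrightarrow> b {} \<noteq> 0"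
  unfolding homog_def by (metis card_eq_0_iff ext zero_fun_apply)

lemma fcon_mem:
  assumes "fs.subspace X" "\<And>v. cont v c \<in> X"
  shows "fcon Y \<alpha> c \<in> X"
proof -
  have "fcon Y \<alpha> c = (\<Sum>v\<in>Y. (\<lambda>F. \<alpha> v * cont v c F))"
    by (simp add: fcon_def sum_fun_def fun_eq_iff)
  also have "\<dots> \<in> X" by (intro fs.subspace_sum[OF assms(1)] fs.subspace_scale[OF assms(1)] assms(2))
  finally show ?thesis .
qed

section \<open>Vanishing forced by stability\<close>

context
  fixes Y :: "'a::linorder set" and D :: "nat \<Rightarrow> ('a set \<Rightarrow> 'f::field) set"
    and n r and \<B> \<A> :: "nat set \<Rightarrow> ('a set \<Rightarrow> 'f) set"
  assumes D: "contraction_closed Y D" and V: "annihilating_pair n r D \<B> \<A>" and st: "stable n \<B>" and r: "1 \<le> r" "r \<le> n"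
begin

lemma nonzero_card_le:
  assumes "P \<subseteq> {..<n}" "b \<in> \<B> P" "b \<noteq> 0" shows "card P \<le> r"
proof (rule ccontr)
  assume "\<not> card P \<le> r"
  then have "piece r D P = {0}" by (simp add: piece_def)
  then show False using graded_familyD(2)[OF D annihilating_pairD(1)[OF D V] assms(1)] assms(2,3) by blast
qed

text \<open>Stability trades link vertices for arbitrary free positions, and contraction by a vertex
  of a set in the support of a chain is nonzero.\<close>

lemma extend_to_card:
  assumes "finite X" "P \<subseteq> {..<n}" "X \<subseteq> {..<n} - P" "card P + card X = r" "b \<in> \<B> P" "b \<noteq> 0"
  shows "\<exists>b'\<in>\<B> (P \<union> X). b' \<noteq> 0"
  using assms
proof (induction X arbitrary: P b rule: finite_induct)
  case (insert x X)
  have "homog (r - card P) b" by (rule graded_familyD(4)[OF D annihilating_pairD(1)[OF D V] insert.prems(1) insert.prems(4)])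
  moreover obtain W where W: "b W \<noteq> 0" using insert.prems(5) by (auto simp: fun_eq_iff)
  ultimately have "finite W" "card W = r - card P" by (auto simp: homog_def)
  moreover have "r - card P \<noteq> 0" using insert.prems(3) insert.hyps by simp
  ultimately obtain v where v: "v \<in> W" by fastforce
  have "cont v b (W - {v}) \<noteq> 0" using W v \<open>finite W\<close> by (simp add: cont_def insert_absorb)
  then have nz: "cont v b \<noteq> 0" by (auto simp: fun_eq_iff)
  have x: "x < n" "x \<notin> P" using insert.prems(2) by auto
  have mem: "cont v b \<in> \<B> (insert x P)" using st insert.prems(1,4) x unfolding stable_def by blast
  have fin: "finite P" using insert.prems(1) finite_subset by blast
  have "\<exists>b'\<in>\<B> (insert x P \<union> X). b' \<noteq> 0"
  proof (rule insert.IH[OF _ _ _ mem nz])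
    show "insert x P \<subseteq> {..<n}" using insert.prems(1) x by simp
    show "X \<subseteq> {..<n} - insert x P" using insert.prems(2) insert.hyps by blast
    show "card (insert x P) + card X = r" using insert.prems(3) insert.hyps x fin by simp
  qed
  then show ?case by (simp only: Un_insert_left Un_insert_right)
qed auto

text \<open>Once \<open>r\<close> positions are used, \<open>b\<close> is a nonzero scalar and the
  wedge is multiplication by it.\<close>

lemma scalar_annihilates:
  assumes P: "P \<subseteq> {..<n}" "card P = r" "b \<in> \<B> P" "b \<noteq> 0"
    and S: "S \<subseteq> {..<n}" "P \<inter> S = {}" "a \<in> \<A> S"
  shows "a = 0"
proof
  fix F
  have "homog 0 b" using graded_familyD(4)[OF D annihilating_pairD(1)[OF D V] P(1,3)] P(2) by simp
  then have b: "b {} \<noteq> 0" "\<And>F. finite F \<Longrightarrow> wedge b a F = b {} * a F"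
    using homog_0_nonzero P(4) wedge_unit_left by blast+
  have "wedge b a = 0" by (rule annihilating_pairD(3)[OF D V P(1) S(1,2) P(3) S(3)])
  then have "a F = 0" if "finite F" using b that by (metis mult_eq_0_iff zero_fun_apply)
  moreover have "a F = 0" if "infinite F"
    using graded_familyD(4)[OF D annihilating_pairD(2)[OF D V] S(1,3)] that by (auto simp: homog_def)
  ultimately show "a F = 0 F" by fastforce
qed

text \<open>Fill \<open>P\<close> up to \<open>r\<close> positions avoiding \<open>S\<close>; the
  hypothesis \<open>card\<close> provides the room.\<close>

lemma disjoint_annihilates:
  assumes P: "P \<subseteq> {..<n}" "b \<in> \<B> P" "b \<noteq> 0" and S: "S \<subseteq> {..<n}" "P \<inter> S = {}" "a \<in> \<A> S"
    and card: "card (P \<union> S) + (r - card P) \<le> n"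
  shows "a = 0"
proof -
  have fin: "finite (P \<union> S)" using P(1) S(1) finite_subset by blast
  have "r - card P \<le> card ({..<n} - (P \<union> S))"
    using card card_Diff_subset[OF fin, of "{..<n}"] P(1) S(1) by simp
  then obtain X where X: "X \<subseteq> {..<n} - (P \<union> S)" "card X = r - card P" "finite X"
    by (rule obtain_subset_with_card_n)
  have "\<exists>b'\<in>\<B> (P \<union> X). b' \<noteq> 0"
    by (rule extend_to_card[OF X(3) P(1) _ _ P(2,3)]) (use X nonzero_card_le[OF P] in auto)
  then obtain b' where b': "b' \<in> \<B> (P \<union> X)" "b' \<noteq> 0" by blast
  have "card (P \<union> X) = r"
    using X nonzero_card_le[OF P] fin by (subst card_Un_disjoint) auto
  then show ?thesis
    by (intro scalar_annihilates[OF _ _ b' S(1) _ S(3)]) (use X P S in auto)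
qed

text \<open>Fill \<open>Q\<close> up to \<open>r\<close> positions without meeting \<open>P\<close>
  any further. If at most one position were shared, deleting it would put the resulting scalar into
  \<open>\<A>\<close> at a set disjoint from \<open>P\<close>, and its vanishing wedge with
  \<open>b\<close> would force \<open>b = 0\<close>.\<close>

lemma two_intersecting:
  assumes P: "P \<subseteq> {..<n}" "b \<in> \<B> P" "b \<noteq> 0" and Q: "Q \<subseteq> {..<n}" "c \<in> \<B> Q" "c \<noteq> 0"
    and card: "card (P \<union> Q) + (r - card Q) \<le> n"
  shows "2 \<le> card (P \<inter> Q)"
proof (rule ccontr)
  assume no: "\<not> 2 \<le> card (P \<inter> Q)"
  have fin: "finite (P \<union> Q)" using P(1) Q(1) finite_subset by blast
  have "r - card Q \<le> card ({..<n} - (P \<union> Q))"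
    using card card_Diff_subset[OF fin, of "{..<n}"] P(1) Q(1) by simp
  then obtain X where X: "X \<subseteq> {..<n} - (P \<union> Q)" "card X = r - card Q" "finite X"
    by (rule obtain_subset_with_card_n)
  have "\<exists>b'\<in>\<B> (Q \<union> X). b' \<noteq> 0"
    by (rule extend_to_card[OF X(3) Q(1) _ _ Q(2,3)]) (use X nonzero_card_le[OF Q] in auto)
  then obtain b' where b': "b' \<in> \<B> (Q \<union> X)" "b' \<noteq> 0" by blast
  have QX: "Q \<union> X \<subseteq> {..<n}" using Q X by blast
  have cQX: "card (Q \<union> X) = r"
    using X nonzero_card_le[OF Q] fin by (subst card_Un_disjoint) auto
  have PQX: "P \<inter> (Q \<union> X) = P \<inter> Q" using X by blast
  obtain z where z: "z \<in> Q \<union> X" "P \<inter> Q \<subseteq> {z}"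
  proof (cases "P \<inter> Q = {}")
    case True
    have "Q \<union> X \<noteq> {}" using cQX r(1) by auto
    then show ?thesis using True that by blast
  next
    case False
    then have "card (P \<inter> Q) > 0" using fin by (simp add: card_gt_0_iff)
    then have "card (P \<inter> Q) = 1" using no by linarith
    then obtain z where "P \<inter> Q = {z}" by (rule card_1_singletonE)
    then show ?thesis using that[of z] by blast
  qed
  have "b' \<in> \<A> (Q \<union> X - {z})" by (rule annihilating_pairD(5)[OF D V QX b'(1) z(1)])
  moreover have "P \<inter> (Q \<union> X - {z}) = {}" using PQX z(2) by blast
  ultimately have w: "wedge b b' = 0"
    by (intro annihilating_pairD(3)[OF D V P(1) _ _ P(2)]) (use QX in auto)
  have h: "homog 0 b'" using graded_familyD(4)[OF D annihilating_pairD(1)[OF D V] QX b'(1)] cQX by simp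
  have "b F = 0" for F
  proof (cases "finite F")
    case True
    then show ?thesis using wedge_unit_right[OF h True, of b] w homog_0_nonzero[OF h b'(2)] by simp
  next
    case False
    then show ?thesis using graded_familyD(4)[OF D annihilating_pairD(1)[OF D V] P(1,2)] by (auto simp: homog_def)
  qed
  then show False using P(3) by (simp add: fun_eq_iff)
qed

text \<open>All pieces of the layer are bounded by the same dimension \<open>?t\<close>, so it
  suffices to count sets. A nonzero piece of \<open>\<B>\<close> away from \<open>{..<r}\<close> is
  paid for by a set \<open>S\<close> at which \<open>\<A>\<close> must vanish. The layer uses the
  first \<open>n0\<close> positions only, but all \<open>n\<close> are available for filling sets
  up.\<close>

lemma layer_bound:
  assumes n0: "n0 \<le> n" and k: "1 \<le> k" "k \<le> r" "2 * k \<le> n0 + 1" "r + k \<le> n \<or> k = r"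
  shows "(\<Sum>P | P \<subseteq> {..<n0} \<and> card P = k. fs.dim (\<B> P)) + (\<Sum>S | S \<subseteq> {..<n0} \<and> Suc (card S) = k. fs.dim (\<A> S))
    \<le> (if k = r then 1 else 0) + (\<Sum>S | S \<subseteq> {..<n0} \<and> Suc (card S) = k \<and> S \<inter> {..<r} \<noteq> {}. fs.dim (D (r - k)))"
proof -
  let ?t = "fs.dim (D (r - k))"
  let ?LB = "{P. P \<subseteq> {..<n0} \<and> card P = k}" and ?LA = "{S. S \<subseteq> {..<n0} \<and> Suc (card S) = k}"
  let ?LV = "{S. S \<subseteq> {..<n0} \<and> Suc (card S) = k \<and> S \<inter> {..<r} \<noteq> {}}"
  define \<P> where "\<P> = {P \<in> ?LB. \<exists>b\<in>\<B> P. b \<noteq> 0}"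
  let ?Bad = "{S. S \<subseteq> {..<n0} \<and> Suc (card S) = k \<and> S \<inter> {..<r} \<noteq> {} \<and> (\<exists>P\<in>\<P>. P \<inter> S = {})}"
  have fin: "finite ?LB" "finite ?LA" "finite ?LV" "finite ?Bad"
    by (rule finite_subset[of _ "Pow {..<n0}"], auto)+
  have sub: "P \<subseteq> {..<n}" if "P \<subseteq> {..<n0}" for P using that n0 by auto
  \<comment> \<open>Two sets of size at most \<open>k\<close> cover at most \<open>2 * k\<close>
    positions and \<open>r - k\<close> more are needed, in total \<open>r + k\<close>. For
    \<open>k = r\<close> nothing has to be filled up.\<close>
  have un: "card (P \<union> Q) + (r - k) \<le> n" if "P \<subseteq> {..<n0}" "Q \<subseteq> {..<n0}" "card P \<le> k" "card Q \<le> k" for P Q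
  proof (cases "k = r")
    case True
    have "card (P \<union> Q) \<le> card {..<n}" by (rule card_mono) (use that sub in auto)
    then show ?thesis using True by simp
  next
    case False
    then show ?thesis using card_Un_le[of P Q] that k by linarith
  qed
  have dz: "fs.dim X = 0" if "\<And>x. x \<in> X \<Longrightarrow> x = 0" "0 \<in> X" for X :: "('a set \<Rightarrow> 'f) set"
  proof -
    have "X = {0}" using that by blast
    then show ?thesis using dim_zero by simp
  qed
  have supp: "D s \<subseteq> supp_on {W. W \<subseteq> Y \<and> card W = s}" "finite {W. W \<subseteq> Y \<and> card W = s}" for s
    using D by (auto simp: contraction_closed_def)
  have dB: "fs.dim (\<B> P) \<le> ?t" if "P \<in> ?LB" for P
  proof -
    have "\<B> P \<subseteq> piece r D P" using graded_familyD(2)[OF D annihilating_pairD(1)[OF D V] sub] that by blast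
    also have "piece r D P = D (r - k)" using that k by (simp add: piece_def)
    finally show ?thesis by (rule dim_mono[OF _ supp])
  qed
  have dA: "fs.dim (\<A> S) \<le> ?t" if "S \<in> ?LA" for S
  proof -
    have "\<A> S \<subseteq> piece (r - 1) D S" using graded_familyD(2)[OF D annihilating_pairD(2)[OF D V] sub] that by blast
    also have "piece (r - 1) D S = D (r - k)" using that k by (auto simp: piece_def)
    finally show ?thesis by (rule dim_mono[OF _ supp])
  qed
  have zA: "0 \<in> \<A> S" if "S \<subseteq> {..<n0}" for S
    by (rule fs.subspace_0[OF graded_familyD(1)[OF D annihilating_pairD(2)[OF D V] sub[OF that]]])
  have zB: "0 \<in> \<B> P" if "P \<subseteq> {..<n0}" for P
    by (rule fs.subspace_0[OF graded_familyD(1)[OF D annihilating_pairD(1)[OF D V] sub[OF that]]])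
  have "(\<Sum>P\<in>?LB. fs.dim (\<B> P)) = (\<Sum>P\<in>\<P>. fs.dim (\<B> P))"
  proof (rule sum.mono_neutral_right[OF fin(1)])
    show "\<forall>P\<in>?LB - \<P>. fs.dim (\<B> P) = 0"
    proof
      fix P assume P: "P \<in> ?LB - \<P>"
      show "fs.dim (\<B> P) = 0" by (rule dz[OF _ zB]) (use P in \<open>auto simp: \<P>_def\<close>)
    qed
  qed (auto simp: \<P>_def)
  also have "\<dots> \<le> card \<P> * ?t"
    using sum_bounded_above[of \<P> "\<lambda>P. fs.dim (\<B> P)" ?t] dB by (simp add: \<P>_def)
  finally have 1: "(\<Sum>P\<in>?LB. fs.dim (\<B> P)) \<le> card \<P> * ?t" .
  obtain b0 where b0: "b0 \<in> \<B> {..<r}" "b0 \<noteq> 0" using annihilating_pairD(6)[OF D V] by blast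
  \<comment> \<open>There are two ways to vanish: \<open>S\<close> is disjoint from
    \<open>{..<r}\<close>, where \<open>\<B>\<close> has a nonzero scalar, or from some
    \<open>P\<close> in \<open>\<P>\<close>.\<close>
  have A0: "fs.dim (\<A> S) = 0" if "S \<in> ?LA - (?LV - ?Bad)" for S
  proof (rule dz[OF _ zA])
    show "S \<subseteq> {..<n0}" using that by blast
    fix a assume a: "a \<in> \<A> S"
    show "a = 0"
    proof (cases "S \<inter> {..<r} = {}")
      case True
      show ?thesis
        by (rule scalar_annihilates[OF _ _ b0 _ _ a]) (use r that sub True in auto)
    next
      case False
      then have "S \<in> ?Bad" using that by blast
      then obtain P b where P: "P \<subseteq> {..<n0}" "card P = k" "b \<in> \<B> P" "b \<noteq> 0" "P \<inter> S = {}"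
        by (auto simp: \<P>_def)
      show ?thesis
        by (rule disjoint_annihilates[OF sub[OF P(1)] P(3,4) sub P(5) a])
          (use P that un[of P S] in auto)
    qed
  qed
  have "(\<Sum>S\<in>?LA. fs.dim (\<A> S)) = (\<Sum>S\<in>?LV - ?Bad. fs.dim (\<A> S))"
    by (rule sum.mono_neutral_right[OF fin(2)]) (use A0 in auto)
  also have "\<dots> \<le> card (?LV - ?Bad) * ?t"
    using sum_bounded_above[of "?LV - ?Bad" "\<lambda>S. fs.dim (\<A> S)" ?t] dA by simp
  finally have 2: "(\<Sum>S\<in>?LA. fs.dim (\<A> S)) \<le> card (?LV - ?Bad) * ?t" .
  have "card (\<P> - {{..<r}}) \<le> card ?Bad"
  proof (rule shifted_two_intersecting)
    show "\<P> \<subseteq> {P. P \<subseteq> {..<n0} \<and> card P = k}" by (auto simp: \<P>_def)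
    show "insert i (P - {j}) \<in> \<P>" if P: "P \<in> \<P>" "j \<in> P" "i < j" "i \<notin> P" for P i j
    proof -
      obtain b where b: "b \<in> \<B> P" "b \<noteq> 0" "P \<subseteq> {..<n0}" "card P = k" using P(1) by (auto simp: \<P>_def)
      have "\<B> P \<subseteq> \<B> (insert i (P - {j}))"
        using st[unfolded stable_def, rule_format, OF sub[OF b(3)], THEN conjunct2] P(2-4) by blast
      then have "b \<in> \<B> (insert i (P - {j}))" using b(1) by blast
      moreover have "i < n0" using b(3) P(2,3) by (metis lessThan_iff less_trans subsetD)
      then have "insert i (P - {j}) \<subseteq> {..<n0}" using b(3) by auto
      moreover have "card (insert i (P - {j})) = k"
        using b(3,4) P(2,4) finite_subset[OF b(3)] card_Suc_Diff1[of P j] by simp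
      ultimately show ?thesis using b(2) by (auto simp: \<P>_def)
    qed
    show "2 \<le> card (P \<inter> Q)" if PQ: "P \<in> \<P>" "Q \<in> \<P>" for P Q
    proof -
      obtain b c where bc: "b \<in> \<B> P" "b \<noteq> 0" "P \<subseteq> {..<n0}" "card P = k" "c \<in> \<B> Q" "c \<noteq> 0" "Q \<subseteq> {..<n0}" "card Q = k"
        using PQ by (auto simp: \<P>_def)
      show ?thesis
        by (rule two_intersecting[OF sub[OF bc(3)] bc(1,2) sub[OF bc(7)] bc(5,6)])
          (use un[of P Q] bc in auto)
    qed
  qed (use k in auto)
  moreover have "card \<P> \<le> card (\<P> - {{..<r}}) + (if k = r then 1 else 0)"
  proof (cases "{..<r} \<in> \<P>")
    case True
    then have "k = r" by (auto simp: \<P>_def)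
    moreover have "finite \<P>" using fin(1) by (simp add: \<P>_def)
    ultimately show ?thesis using card_Suc_Diff1[of \<P> "{..<r}"] True by simp
  qed simp
  moreover have "card ?LV = card (?LV - ?Bad) + card ?Bad"
  proof -
    have sb: "?Bad \<subseteq> ?LV" by blast
    show ?thesis using card_Diff_subset[OF fin(4) sb] card_mono[OF fin(3) sb] by linarith
  qed
  ultimately have "card \<P> + card (?LV - ?Bad) \<le> (if k = r then 1 else 0) + card ?LV" by linarith
  then have "card \<P> * ?t + card (?LV - ?Bad) * ?t \<le> ((if k = r then 1 else 0) + card ?LV) * ?t"
    unfolding add_mult_distrib[of "card \<P>", symmetric] by (rule mult_le_mono1)
  \<comment> \<open>The excepted set \<open>{..<r}\<close> costs \<open>?t\<close>, and for
    \<open>k = r\<close> this is at most 1, as only the empty set has no vertices.\<close>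
  also have "\<dots> \<le> (if k = r then 1 else 0) + card ?LV * ?t"
  proof (cases "k = r")
    case True
    have "{W. W \<subseteq> Y \<and> card W = 0} = {{}}"
      using D finite_subset[of _ Y] by (auto simp: contraction_closed_def)
    then have "?t \<le> 1"
      using dim_mono[OF supp(1)[of 0] order_refl supp(2)] dim_supp_on[of "{{} :: 'a set}", where 'f = 'f] True by simp
    then show ?thesis using True by (simp add: add_mult_distrib)
  qed simp
  finally show ?thesis using 1 2 by simp
qed

end

section \<open>Adjoining a generic form as a new position\<close>

definition adjoin_form :: "nat \<Rightarrow> (('a set \<Rightarrow> 'f) \<Rightarrow> 'a set \<Rightarrow> 'f) \<Rightarrow> (nat set \<Rightarrow> ('a set \<Rightarrow> 'f::field) set) \<Rightarrow> nat set \<Rightarrow> ('a set \<Rightarrow> 'f) set" where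
  "adjoin_form n g \<F> P = (if n \<in> P then g ` \<F> (P - {n}) else {x \<in> \<F> P. g x = 0})"

lemma contraction_closed_kernel:
  assumes D: "contraction_closed Y D" shows "contraction_closed Y (\<lambda>s. {c \<in> D s. fcon Y \<alpha> c = 0})"
  unfolding contraction_closed_def
proof (intro conjI allI ballI)
  fix s
  show "finite Y" using D by (simp add: contraction_closed_def)
  have "fs.subspace (D s)" using D by (simp add: contraction_closed_def)
  from fs.subspace_inter[OF this fsp.linear_subspace_kernel[OF lin_fcon[unfolded lin_linear, of Y \<alpha>]]]
  show "fs.subspace {c \<in> D s. fcon Y \<alpha> c = 0}" by (simp add: Int_def)
  show "{c \<in> D s. fcon Y \<alpha> c = 0} \<subseteq> supp_on {W. W \<subseteq> Y \<and> card W = s}"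
    using D unfolding contraction_closed_def by blast
  fix c v assume c: "c \<in> {c \<in> D (Suc s). fcon Y \<alpha> c = 0}"
  then have "cont v c \<in> D s" using D unfolding contraction_closed_def by blast
  moreover have "fcon Y \<alpha> (cont v c) = 0"
  proof -
    have "fcon Y \<alpha> c = 0" using c by blast
    then have "- fcon Y \<alpha> (cont v c) = 0" using cont_fcon[of v Y \<alpha> c] by (simp only: cont_0)
    then show ?thesis by (simp only: neg_equal_0_iff_equal)
  qed
  ultimately show "cont v c \<in> {c \<in> D s. fcon Y \<alpha> c = 0}" by simp
qed

lemma piece_kernel: "piece R (\<lambda>s. {c \<in> D s. fcon Y \<alpha> c = 0}) P = {c \<in> piece R D P. fcon Y \<alpha> c = 0}"
  by (auto simp: piece_def)

lemma graded_family_adjoin_form: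
  assumes D: "contraction_closed Y D" and F: "graded_family n R D \<F>"
  shows "graded_family (Suc n) R (\<lambda>s. {c \<in> D s. fcon Y \<alpha> c = 0}) (adjoin_form n (fcon Y \<alpha>) \<F>)"
  unfolding graded_family_def
proof (intro allI impI)
  fix P assume P: "P \<subseteq> {..<Suc n}"
  note G = graded_familyD[OF D F]
  note lf = lin_fcon[unfolded lin_linear, of Y \<alpha>]
  show "fs.subspace (adjoin_form n (fcon Y \<alpha>) \<F> P) \<and>
    adjoin_form n (fcon Y \<alpha>) \<F> P \<subseteq> piece R (\<lambda>s. {c \<in> D s. fcon Y \<alpha> c = 0}) P"
  proof (cases "n \<in> P")
    case True
    have P': "P - {n} \<subseteq> {..<n}" using P by (auto simp: lessThan_Suc)
    have fin: "finite (P - {n})" using P' finite_subset by blast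
    have eq: "adjoin_form n (fcon Y \<alpha>) \<F> P = fcon Y \<alpha> ` \<F> (P - {n})" using True by (simp add: adjoin_form_def)
    have "fcon Y \<alpha> x \<in> piece R D P" if "x \<in> \<F> (P - {n})" for x
    proof (rule fcon_mem[OF subspace_piece[OF D]])
      fix v
      have "cont v x \<in> piece R D (insert n (P - {n}))"
        by (rule piece_cont_insert[OF D]) (use that G(2)[OF P'] fin in auto)
      then show "cont v x \<in> piece R D P" using True by (simp add: insert_absorb)
    qed
    then show ?thesis
      unfolding eq piece_kernel using fsp.linear_subspace_image[OF lf G(1)[OF P']] by auto
  next
    case False
    have P': "P \<subseteq> {..<n}" using P False by (auto simp: lessThan_Suc)
    have eq: "adjoin_form n (fcon Y \<alpha>) \<F> P = {x \<in> \<F> P. fcon Y \<alpha> x = 0}" using False by (simp add: adjoin_form_def)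
    from fs.subspace_inter[OF G(1)[OF P'] fsp.linear_subspace_kernel[OF lf]]
    have "fs.subspace {x \<in> \<F> P. fcon Y \<alpha> x = 0}" by (simp add: Int_def)
    then show ?thesis unfolding eq piece_kernel using G(2)[OF P'] by auto
  qed
qed

text \<open>If one of two disjoint sets uses the new position, the element at the other is in the
  kernel of the form, so the Leibniz rule leaves only the required term. Deleting the new position
  is covered because a form is a combination of contractions and squares to zero.\<close>

lemma annihilating_pair_adjoin_form:
  assumes D: "contraction_closed Y D" and V: "annihilating_pair n r D \<B> \<A>" and rn: "r \<le> n"
  shows "annihilating_pair (Suc n) r (\<lambda>s. {c \<in> D s. fcon Y \<alpha> c = 0}) (adjoin_form n (fcon Y \<alpha>) \<B>) (adjoin_form n (fcon Y \<alpha>) \<A>)"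
  unfolding annihilating_pair_def
proof (intro conjI allI impI ballI)
  let ?g = "fcon Y \<alpha>"
  note B = annihilating_pairD(1)[OF D V] and A = annihilating_pairD(2)[OF D V] and cr = annihilating_pairD(3)[OF D V]
    and sc = annihilating_pairD(4)[OF D V] and sm = annihilating_pairD(5)[OF D V]
  have Pn: "P - {n} \<subseteq> {..<n}" if "P \<subseteq> {..<Suc n}" for P using that by (auto simp: lessThan_Suc)
  have Pn': "P \<subseteq> {..<n}" if "P \<subseteq> {..<Suc n}" "n \<notin> P" for P using that by (auto simp: lessThan_Suc)
  show "graded_family (Suc n) r (\<lambda>s. {c \<in> D s. ?g c = 0}) (adjoin_form n ?g \<B>)" by (rule graded_family_adjoin_form[OF D B])
  show "graded_family (Suc n) (r - 1) (\<lambda>s. {c \<in> D s. ?g c = 0}) (adjoin_form n ?g \<A>)" by (rule graded_family_adjoin_form[OF D A])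
  {
    fix P S b a assume P: "P \<subseteq> {..<Suc n}" and S: "S \<subseteq> {..<Suc n}" and PS: "P \<inter> S = {}"
      and b: "b \<in> adjoin_form n ?g \<B> P" and a: "a \<in> adjoin_form n ?g \<A> S"
    show "wedge b a = 0"
    proof (cases "n \<in> P")
      case True
      then obtain x where x: "b = ?g x" "x \<in> \<B> (P - {n})" using b by (auto simp: adjoin_form_def)
      have nS: "n \<notin> S" using True PS by blast
      then have a': "a \<in> \<A> S" "?g a = 0" using a by (auto simp: adjoin_form_def)
      have "wedge x a = 0" by (rule cr[OF Pn[OF P] Pn'[OF S nS] _ x(2) a'(1)]) (use PS in blast)
      then have "wedge (?g x) a F = 0" for F
        using fun_cong[OF fcon_wedge[OF graded_familyD(4)[OF D B Pn[OF P] x(2)], of Y \<alpha> a], of F] a'(2) by simp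
      then show ?thesis unfolding x(1) by (intro ext) simp
    next
      case nP: False
      then have b': "b \<in> \<B> P" "?g b = 0" using b by (auto simp: adjoin_form_def)
      show ?thesis
      proof (cases "n \<in> S")
        case True
        then obtain x where x: "a = ?g x" "x \<in> \<A> (S - {n})" using a by (auto simp: adjoin_form_def)
        have "wedge b x = 0" by (rule cr[OF Pn'[OF P nP] Pn[OF S] _ b'(1) x(2)]) (use PS in blast)
        then have "wedge b (?g x) F = 0" for F
          using fun_cong[OF fcon_wedge[OF graded_familyD(4)[OF D B Pn'[OF P nP] b'(1)], of Y \<alpha> x], of F] b'(2) by simp
        then show ?thesis unfolding x(1) by (intro ext) simp
      next
        case False
        then have "a \<in> \<A> S" using a by (auto simp: adjoin_form_def)
        then show ?thesis by (rule cr[OF Pn'[OF P nP] Pn'[OF S False] PS b'(1)])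
      qed
    qed
  }
  {
    fix P b v assume P: "P \<subseteq> {..<Suc n}" and b: "b \<in> adjoin_form n ?g \<B> P"
    show "cont v b \<in> adjoin_form n ?g \<A> P"
    proof (cases "n \<in> P")
      case True
      then obtain x where x: "b = ?g x" "x \<in> \<B> (P - {n})" using b by (auto simp: adjoin_form_def)
      have "cont v x \<in> \<A> (P - {n})" by (rule sc[OF Pn[OF P] x(2)])
      then have "- cont v x \<in> \<A> (P - {n})" by (rule fs.subspace_neg[OF graded_familyD(1)[OF D A Pn[OF P]]])
      moreover have "cont v b = ?g (- cont v x)" unfolding x(1) cont_fcon fcon_neg ..
      ultimately show ?thesis using True by (simp add: adjoin_form_def)
    next
      case False
      then have b': "b \<in> \<B> P" "?g b = 0" using b by (auto simp: adjoin_form_def)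
      have "- ?g (cont v b) = 0" using cont_fcon[of v Y \<alpha> b] b'(2) by (simp only: cont_0)
      then have "?g (cont v b) = 0" by (simp only: neg_equal_0_iff_equal)
      then show ?thesis using False sc[OF Pn'[OF P False] b'(1)] by (simp add: adjoin_form_def)
    qed
  }
  {
    fix P b z assume P: "P \<subseteq> {..<Suc n}" and b: "b \<in> adjoin_form n ?g \<B> P" and z: "z \<in> P"
    show "b \<in> adjoin_form n ?g \<A> (P - {z})"
    proof (cases "n \<in> P")
      case True
      then obtain x where x: "b = ?g x" "x \<in> \<B> (P - {n})" using b by (auto simp: adjoin_form_def)
      show ?thesis
      proof (cases "z = n")
        case zn: True
        have "b \<in> \<A> (P - {n})"
          unfolding x(1) by (rule fcon_mem[OF graded_familyD(1)[OF D A Pn[OF P]] sc[OF Pn[OF P] x(2)]])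
        then show ?thesis using zn x(1) by (simp add: adjoin_form_def)
      next
        case False
        have "x \<in> \<A> (P - {n} - {z})" by (rule sm[OF Pn[OF P] x(2)]) (use z False in blast)
        moreover have "P - {n} - {z} = P - {z} - {n}" by blast
        ultimately show ?thesis using True False x(1) by (simp add: adjoin_form_def)
      qed
    next
      case False
      then have b': "b \<in> \<B> P" "?g b = 0" using b by (auto simp: adjoin_form_def)
      then show ?thesis using False sm[OF Pn'[OF P False] b'(1) z] by (simp add: adjoin_form_def)
    qed
  }
  obtain b where b: "b \<in> \<B> {..<r}" "b \<noteq> 0" using annihilating_pairD(6)[OF D V] by blast
  have "cont v b = 0" for v by (rule apex_scalar(2)[OF D B b(1) rn])
  then have "?g b = 0" by (simp add: fcon_def fun_eq_iff)
  then have "b \<in> adjoin_form n ?g \<B> {..<r}" using b(1) rn by (simp add: adjoin_form_def)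
  then show "\<exists>b\<in>adjoin_form n ?g \<B> {..<r}. b \<noteq> 0" using b(2) by blast
qed

text \<open>Room for \<open>k\<close> successive forms. The range of degrees shrinks along with the
  number of forms left, matching the bound on further vertices in
  \<open>graded_bound\<close>.\<close>

fun exact_tail :: "'a::linorder set \<Rightarrow> nat \<Rightarrow> (nat \<Rightarrow> ('a set \<Rightarrow> 'f::field) set) \<Rightarrow> bool" where
  "exact_tail Y 0 D \<longleftrightarrow> True"
| "exact_tail Y (Suc k) D \<longleftrightarrow> (\<exists>\<alpha>. (\<forall>s\<le>k. {c \<in> D s. fcon Y \<alpha> c = 0} \<subseteq> fcon Y \<alpha> ` D (Suc s)) \<and>
     exact_tail Y k (\<lambda>s. {c \<in> D s. fcon Y \<alpha> c = 0}))"

lemma weighted_dim_filter: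
  "weighted_dim n (\<lambda>P. if Q P then 1 else 0) \<F> = (\<Sum>P | P \<subseteq> {..<n} \<and> Q P. fs.dim (\<F> P))"
proof -
  have "weighted_dim n (\<lambda>P. if Q P then 1 else 0) \<F> = (\<Sum>P\<in>Pow {..<n}. if Q P then fs.dim (\<F> P) else 0)"
    unfolding weighted_dim_def by (rule sum.cong) auto
  also have "\<dots> = (\<Sum>P\<in>{P \<in> Pow {..<n}. Q P}. fs.dim (\<F> P))"
    by (rule sum.inter_filter[symmetric]) simp
  finally show ?thesis by simp
qed

text \<open>Sizes of faces against positions: at stage k the prefix has length 2 r - 1 - k, and only the
  pieces with at most k further vertices are counted. One more form splits every piece into its
  kernel and its image; the pieces with exactly k + 1 further vertices that do not use the new
  position can no longer be continued exactly and are disposed of by the bound for a single layer.\<close>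
lemma graded_bound:
  fixes \<B> \<A> :: "nat set \<Rightarrow> ('a::linorder set \<Rightarrow> 'f::field) set"
  assumes "contraction_closed Y D" "annihilating_pair n r D \<B> \<A>" "n + k + 1 = 2 * r" "k < r" "exact_tail Y k D"
  shows "weighted_dim n (\<lambda>P. if r \<le> card P + k then 1 else 0) \<B> + weighted_dim n (\<lambda>S. if r - 1 \<le> card S + k then 1 else 0) \<A>
    \<le> 1 + (\<Sum>S | S \<subseteq> {..<n} \<and> r - 1 \<le> card S + k \<and> card S \<le> r - 1 \<and> S \<inter> {..<r} \<noteq> {}. fs.dim (D (r - 1 - card S)))"
  using assms
proof (induction k arbitrary: n D \<B> \<A>)
  case 0
  note D = "0.prems"(1) and V = "0.prems"(2)
  have r: "1 \<le> r" "r \<le> n" "n + 1 = 2 * r" using "0.prems"(3,4) by auto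
  have mono: "mono_weight n (\<lambda>P. if R \<le> card P + 0 then 1 else 0)" for R
    unfolding mono_weight_def
  proof (intro allI impI conjI)
    fix P z assume P: "P \<subseteq> {..<n}"
    have fin: "finite P" using P finite_subset by blast
    show "(if R \<le> card P + 0 then 1 else 0) \<le> (if R \<le> card (insert z P) + 0 then 1 else (0::nat))"
      using fin card_insert_le[of P z] by auto
    fix i j assume "j \<in> P" "i \<notin> P"
    then show "(if R \<le> card P + 0 then 1 else 0) \<le> (if R \<le> card (insert i (P - {j})) + 0 then 1 else (0::nat))"
      using fin card_Suc_Diff1[of P j] by auto
  qed
  obtain \<B>' \<A>' where V': "annihilating_pair n r D \<B>' \<A>'" "stable n \<B>'"
    and le: "\<And>\<omega>. mono_weight n \<omega> \<Longrightarrow> weighted_dim n \<omega> \<B> \<le> weighted_dim n \<omega> \<B>' \<and> weighted_dim n \<omega> \<A> \<le> weighted_dim n \<omega> \<A>'"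
    using exists_stable[OF D V r(2)] by blast
  have zero: "fs.dim (\<F> P) = 0" if "graded_family n R D \<F>" "P \<subseteq> {..<n}" "R < card P" for R \<F> P
  proof -
    have "\<F> P \<subseteq> {0}" using graded_familyD(2)[OF D that(1,2)] that(3) by (simp add: piece_def)
    then have "\<F> P = {0}" using fs.subspace_0[OF graded_familyD(1)[OF D that(1,2)]] by blast
    then show ?thesis using dim_zero by simp
  qed
  have tot: "weighted_dim n (\<lambda>P. if R \<le> card P + 0 then 1 else 0) \<F> = (\<Sum>P | P \<subseteq> {..<n} \<and> card P = R. fs.dim (\<F> P))"
    if F: "graded_family n R D \<F>" for R \<F>
    unfolding weighted_dim_filter
  proof (rule sum.mono_neutral_right)
    show "finite {P. P \<subseteq> {..<n} \<and> R \<le> card P + 0}" by (rule finite_subset[of _ "Pow {..<n}"]) auto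
    show "\<forall>P\<in>{P. P \<subseteq> {..<n} \<and> R \<le> card P + 0} - {P. P \<subseteq> {..<n} \<and> card P = R}. fs.dim (\<F> P) = 0"
    proof
      fix P assume "P \<in> {P. P \<subseteq> {..<n} \<and> R \<le> card P + 0} - {P. P \<subseteq> {..<n} \<and> card P = R}"
      then have "P \<subseteq> {..<n}" "R < card P" by auto
      then show "fs.dim (\<F> P) = 0" by (rule zero[OF F])
    qed
  qed auto
  have r1: "card S = r - 1 \<longleftrightarrow> Suc (card S) = r" for S :: "nat set" using r(1) by auto
  \<comment> \<open>Only the top layers are left, and \<open>layer_bound\<close> applies in its
    borderline case \<open>2 * k = n0 + 1\<close>.\<close>
  have "(\<Sum>P | P \<subseteq> {..<n} \<and> card P = r. fs.dim (\<B>' P)) + (\<Sum>S | S \<subseteq> {..<n} \<and> card S = r - 1. fs.dim (\<A>' S))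
    \<le> 1 + (\<Sum>S | S \<subseteq> {..<n} \<and> card S = r - 1 \<and> S \<inter> {..<r} \<noteq> {}. fs.dim (D 0))"
    using layer_bound[OF D V' r(1,2), of n r] r unfolding r1 by simp
  also have "(\<Sum>S | S \<subseteq> {..<n} \<and> card S = r - 1 \<and> S \<inter> {..<r} \<noteq> {}. fs.dim (D 0))
    = (\<Sum>S | S \<subseteq> {..<n} \<and> r - 1 \<le> card S + 0 \<and> card S \<le> r - 1 \<and> S \<inter> {..<r} \<noteq> {}. fs.dim (D (r - 1 - card S)))"
    by (rule sum.cong) auto
  finally show ?case
    using le[OF mono, of r] le[OF mono, of "r - 1"]
    unfolding tot[OF annihilating_pairD(1)[OF D V'(1)]] tot[OF annihilating_pairD(2)[OF D V'(1)]] by linarith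
next
  case (Suc k)
  note D = Suc.prems(1) and V = Suc.prems(2)
  have r: "1 \<le> r" "r \<le> n" "Suc k < r" "n + k + 2 = 2 * r" using Suc.prems(3,4) by auto
  obtain \<alpha> where ex: "\<And>s. s \<le> k \<Longrightarrow> {c \<in> D s. fcon Y \<alpha> c = 0} \<subseteq> fcon Y \<alpha> ` D (Suc s)"
    and tl: "exact_tail Y k (\<lambda>s. {c \<in> D s. fcon Y \<alpha> c = 0})" using Suc.prems(5) by auto
  let ?g = "fcon Y \<alpha>"
  define D' where "D' s = {c \<in> D s. ?g c = 0}" for s
  have D': "contraction_closed Y D'" unfolding D'_def by (rule contraction_closed_kernel[OF D])
  have V1: "annihilating_pair (Suc n) r D' (adjoin_form n ?g \<B>) (adjoin_form n ?g \<A>)"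
    unfolding D'_def by (rule annihilating_pair_adjoin_form[OF D V r(2)])
  \<comment> \<open>A position \<open>n\<close> replaces one further vertex, so both branches are
    the old cut applied to \<open>P - {n}\<close>. The weight stays monotone because a replacement
    by some \<open>i < j\<close> never brings \<open>n\<close> in.\<close>
  define wc where "wc R P = (if n \<in> P then R \<le> card P + k else R \<le> card P + Suc k)" for R and P :: "nat set"
  have mono: "mono_weight (Suc n) (\<lambda>P. if wc R P then 1 else 0)" for R
    unfolding mono_weight_def
  proof (intro allI impI conjI)
    fix P z assume P: "P \<subseteq> {..<Suc n}"
    have fin: "finite P" using P finite_subset by blast
    show "(if wc R P then 1 else 0) \<le> (if wc R (insert z P) then 1 else (0::nat))" if "z < Suc n" "z \<notin> P"
      using fin that by (auto simp: wc_def)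
    fix i j assume "i < j" "j \<in> P" "i \<notin> P"
    moreover from this have "i \<noteq> n" using P by auto
    ultimately show "(if wc R P then 1 else 0) \<le> (if wc R (insert i (P - {j})) then 1 else (0::nat))"
      using fin card_Suc_Diff1[of P j] by (auto simp: wc_def)
  qed
  obtain \<B>' \<A>' where V': "annihilating_pair (Suc n) r D' \<B>' \<A>'" "stable (Suc n) \<B>'"
    and le: "\<And>\<omega>. mono_weight (Suc n) \<omega> \<Longrightarrow> weighted_dim (Suc n) \<omega> (adjoin_form n ?g \<B>) \<le> weighted_dim (Suc n) \<omega> \<B>' \<and>
      weighted_dim (Suc n) \<omega> (adjoin_form n ?g \<A>) \<le> weighted_dim (Suc n) \<omega> \<A>'"
    using exists_stable[OF D' V1] r(2) by (meson le_SucI)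
  have Pow: "Pow {..<Suc n} = Pow (insert n {..<n})" by (simp add: lessThan_Suc)
  have old: "weighted_dim n (\<lambda>P. if R \<le> card P + Suc k then 1 else 0) \<F> = weighted_dim (Suc n) (\<lambda>P. if wc R P then 1 else 0) (adjoin_form n ?g \<F>)"
    if F: "graded_family n R' D \<F>" for R R' \<F>
  proof -
    have nP: "n \<notin> P" "finite P" if "P \<in> Pow {..<n}" for P using that finite_subset[of P] by auto
    have d: "fs.dim (\<F> P) = fs.dim (adjoin_form n ?g \<F> P) + fs.dim (adjoin_form n ?g \<F> (insert n P))" if "P \<in> Pow {..<n}" for P
    proof -
      have P: "P \<subseteq> {..<n}" using that by blast
      show ?thesis
        using dim_kernel_image[OF lin_fcon[of Y \<alpha>] graded_familyD(1)[OF D F P] finite_Pow_Y[OF D] graded_familyD(3)[OF D F P]]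
          nP[OF that] by (simp add: adjoin_form_def)
    qed
    have w: "wc R P \<longleftrightarrow> R \<le> card P + Suc k" "wc R (insert n P) \<longleftrightarrow> R \<le> card P + Suc k" if "P \<in> Pow {..<n}" for P
      using nP[OF that] by (auto simp: wc_def)
    show ?thesis
      unfolding weighted_dim_def Pow sum_Pow_insert[OF finite_lessThan, of n n, simplified] sum.distrib[symmetric]
      by (rule sum.cong) (use d w in auto)
  qed
  have new: "weighted_dim (Suc n) (\<lambda>P. if wc R P then 1 else 0) \<F> = weighted_dim (Suc n) (\<lambda>P. if R \<le> card P + k then 1 else 0) \<F>
      + (\<Sum>P | P \<subseteq> {..<n} \<and> card P + Suc k = R. fs.dim (\<F> P))" for R and \<F> :: "nat set \<Rightarrow> ('a set \<Rightarrow> 'f) set"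
  proof -
    have "{P. P \<subseteq> {..<Suc n} \<and> wc R P} = {P. P \<subseteq> {..<Suc n} \<and> R \<le> card P + k} \<union> {P. P \<subseteq> {..<n} \<and> card P + Suc k = R}"
      unfolding wc_def lessThan_Suc by (auto split: if_splits)
    moreover have "{P. P \<subseteq> {..<Suc n} \<and> R \<le> card P + k} \<inter> {P. P \<subseteq> {..<n} \<and> card P + Suc k = R} = {}" by auto
    ultimately show ?thesis
      unfolding weighted_dim_filter by (simp add: sum.union_disjoint)
  qed
  have IH: "weighted_dim (Suc n) (\<lambda>P. if r \<le> card P + k then 1 else 0) \<B>' + weighted_dim (Suc n) (\<lambda>S. if r - 1 \<le> card S + k then 1 else 0) \<A>'
    \<le> 1 + (\<Sum>S | S \<subseteq> {..<Suc n} \<and> r - 1 \<le> card S + k \<and> card S \<le> r - 1 \<and> S \<inter> {..<r} \<noteq> {}. fs.dim (D' (r - 1 - card S)))"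
    by (rule Suc.IH[OF D' V'(1)]) (use r tl in \<open>auto simp: D'_def[abs_def]\<close>)
  have eqs: "card P = r - Suc k \<longleftrightarrow> card P + Suc k = r" "Suc (card P) = r - Suc k \<longleftrightarrow> card P + Suc k = r - 1" for P :: "nat set"
    using r(3) by auto
  \<comment> \<open>\<open>layer_bound\<close> for sets of size \<open>r - Suc k\<close> inside the
    first \<open>n\<close> of \<open>Suc n\<close> positions. The room needed is met with equality:
    \<open>r + (r - Suc k) = Suc n\<close>.\<close>
  have lay: "(\<Sum>P | P \<subseteq> {..<n} \<and> card P + Suc k = r. fs.dim (\<B>' P)) + (\<Sum>S | S \<subseteq> {..<n} \<and> card S + Suc k = r - 1. fs.dim (\<A>' S))
    \<le> (\<Sum>S | S \<subseteq> {..<n} \<and> card S + Suc k = r - 1 \<and> S \<inter> {..<r} \<noteq> {}. fs.dim (D' (r - 1 - card S)))"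
  proof -
    have "(\<Sum>P | P \<subseteq> {..<n} \<and> card P = r - Suc k. fs.dim (\<B>' P)) + (\<Sum>S | S \<subseteq> {..<n} \<and> Suc (card S) = r - Suc k. fs.dim (\<A>' S))
      \<le> (if r - Suc k = r then 1 else 0) + (\<Sum>S | S \<subseteq> {..<n} \<and> Suc (card S) = r - Suc k \<and> S \<inter> {..<r} \<noteq> {}. fs.dim (D' (r - (r - Suc k))))"
      by (rule layer_bound[OF D' V' r(1)]) (use r in auto)
    also have "(if r - Suc k = r then 1 else (0::nat)) = 0" using r by auto
    also have "(\<Sum>S | S \<subseteq> {..<n} \<and> Suc (card S) = r - Suc k \<and> S \<inter> {..<r} \<noteq> {}. fs.dim (D' (r - (r - Suc k))))
        = (\<Sum>S | S \<subseteq> {..<n} \<and> card S + Suc k = r - 1 \<and> S \<inter> {..<r} \<noteq> {}. fs.dim (D' (r - 1 - card S)))"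
      unfolding eqs by (rule sum.cong[OF refl], rule arg_cong[of _ _ "\<lambda>s. fs.dim (D' s)"]) (use r in auto)
    finally show ?thesis unfolding eqs by simp
  qed
  define T where "T = {S. S \<subseteq> {..<n} \<and> r - 1 \<le> card S + Suc k \<and> card S \<le> r - 1 \<and> S \<inter> {..<r} \<noteq> {}}"
  \<comment> \<open>Below the full size \<open>r - 1\<close> there is a further vertex left that the
    position \<open>n\<close> can replace; these sets account for the ones containing
    \<open>n\<close>.\<close>
  define T' where "T' = {S \<in> T. card S < r - 1}"
  define h where "h S = fs.dim (D' (r - 1 - card S))" for S :: "nat set"
  let ?U1 = "{S. S \<subseteq> {..<Suc n} \<and> r - 1 \<le> card S + k \<and> card S \<le> r - 1 \<and> S \<inter> {..<r} \<noteq> {}}"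
  let ?U2 = "{S. S \<subseteq> {..<n} \<and> card S + Suc k = r - 1 \<and> S \<inter> {..<r} \<noteq> {}}"
  have finT: "finite T" by (rule finite_subset[of _ "Pow {..<n}"]) (auto simp: T_def)
  have nT: "n \<notin> S" "finite S" if "S \<in> T" for S using that finite_subset[of S "{..<n}"] by (auto simp: T_def)
  have fin: "finite ?U1" "finite ?U2" by (rule finite_subset[of _ "Pow {..<Suc n}"], auto)+
  have "?U1 \<union> ?U2 \<subseteq> T \<union> insert n ` T'"
  proof
    fix S assume S: "S \<in> ?U1 \<union> ?U2"
    show "S \<in> T \<union> insert n ` T'"
    proof (cases "n \<in> S")
      case False
      then show ?thesis using S by (auto simp: T_def lessThan_Suc)
    next
      case True
      then have S1: "S \<subseteq> {..<Suc n}" "r - 1 \<le> card S + k" "card S \<le> r - 1" "S \<inter> {..<r} \<noteq> {}" using S by auto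
      have "finite S" using S1(1) by (rule finite_subset) simp
      then have c: "card S = Suc (card (S - {n}))" using True by (rule card.remove)
      have "(S - {n}) \<inter> {..<r} = S \<inter> {..<r}" using r(2) by auto
      then have "S - {n} \<in> T'" using S1 c by (auto simp: T'_def T_def lessThan_Suc)
      moreover have "S = insert n (S - {n})" using True by blast
      ultimately show ?thesis by blast
    qed
  qed
  then have "(\<Sum>S\<in>?U1 \<union> ?U2. h S) \<le> (\<Sum>S\<in>T \<union> insert n ` T'. h S)"
    by (intro sum_mono2) (use finT in \<open>auto simp: T'_def\<close>)
  also have "\<dots> = (\<Sum>S\<in>T. h S) + (\<Sum>S\<in>insert n ` T'. h S)"
    by (rule sum.union_disjoint) (use finT nT in \<open>auto simp: T'_def\<close>)
  also have "(\<Sum>S\<in>insert n ` T'. h S) = (\<Sum>S\<in>T'. h (insert n S))"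
  proof -
    have "inj_on (insert n) T'"
    proof (rule inj_onI)
      fix x y assume "x \<in> T'" "y \<in> T'" "insert n x = insert n y"
      moreover from this have "n \<notin> x" "n \<notin> y" using nT(1) by (auto simp: T'_def)
      ultimately show "x = y" by (simp add: insert_ident)
    qed
    then show ?thesis by (simp add: sum.reindex)
  qed
  also have "(\<Sum>S\<in>T'. h (insert n S)) = (\<Sum>S\<in>T. if card S < r - 1 then h (insert n S) else 0)"
    unfolding T'_def by (rule sum.inter_filter[OF finT])
  also have "(\<Sum>S\<in>T. h S) + \<dots> = (\<Sum>S\<in>T. h S + (if card S < r - 1 then h (insert n S) else 0))"
    by (simp add: sum.distrib)
  also have "\<dots> \<le> (\<Sum>S\<in>T. fs.dim (D (r - 1 - card S)))"
  proof (rule sum_mono)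
    fix S assume S: "S \<in> T"
    let ?s = "r - 1 - card S"
    have Ds: "fs.subspace (D ?s)" "D ?s \<subseteq> supp_on {W. W \<subseteq> Y \<and> card W = ?s}" "finite {W. W \<subseteq> Y \<and> card W = ?s}"
      using D by (auto simp: contraction_closed_def)
    \<comment> \<open>Rank-nullity splits off the kernel; by exactness the image contains the kernel
      one degree lower, which is the contribution of \<open>insert n S\<close>.\<close>
    have dim: "fs.dim (D ?s) = h S + fs.dim (?g ` D ?s)"
      unfolding h_def D'_def by (rule dim_kernel_image[OF lin_fcon Ds(1,3,2)])
    show "h S + (if card S < r - 1 then h (insert n S) else 0) \<le> fs.dim (D ?s)"
    proof (cases "card S < r - 1")
      case True
      then obtain s where s: "?s = Suc s" by (metis Suc_diff_Suc)
      have sk: "s \<le> k" using S s by (auto simp: T_def)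
      have "r - 1 - card (insert n S) = s" using nT[OF S] s by simp
      then have "h (insert n S) = fs.dim (D' s)" by (simp add: h_def)
      also have "\<dots> \<le> fs.dim (?g ` D (Suc s))"
      proof (rule dim_mono[of _ _ "Pow Y"])
        show "D' s \<subseteq> ?g ` D (Suc s)" unfolding D'_def by (rule ex[OF sk])
        show "finite (Pow Y)" by (rule finite_Pow_Y[OF D])
        have Dss: "fs.subspace (D s)" "D s \<subseteq> supp_on {W. W \<subseteq> Y \<and> card W = s}" using D by (auto simp: contraction_closed_def)
        have "?g ` D (Suc s) \<subseteq> D s"
        proof (rule image_subsetI)
          fix c assume c: "c \<in> D (Suc s)"
          show "?g c \<in> D s" by (rule fcon_mem[OF Dss(1)]) (use D c in \<open>simp add: contraction_closed_def\<close>)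
        qed
        also note Dss(2)
        also have "supp_on {W. W \<subseteq> Y \<and> card W = s} \<subseteq> supp_on (Pow Y)" by (rule supp_on_mono) auto
        finally show "?g ` D (Suc s) \<subseteq> supp_on (Pow Y)" .
      qed
      finally show ?thesis using True dim s by simp
    next
      case False
      then show ?thesis using dim by simp
    qed
  qed
  finally have U: "(\<Sum>S\<in>?U1. h S) + (\<Sum>S\<in>?U2. h S) \<le> (\<Sum>S\<in>T. fs.dim (D (r - 1 - card S)))"
  proof -
    have "?U1 \<inter> ?U2 = {}" by auto
    from sum.union_disjoint[OF fin this, of h] show "(\<Sum>S\<in>?U1 \<union> ?U2. h S) \<le> (\<Sum>S\<in>T. fs.dim (D (r - 1 - card S))) \<Longrightarrow> ?thesis" by simp
  qed
  have "weighted_dim n (\<lambda>P. if r \<le> card P + Suc k then 1 else 0) \<B> + weighted_dim n (\<lambda>S. if r - 1 \<le> card S + Suc k then 1 else 0) \<A>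
      \<le> 1 + ((\<Sum>S\<in>?U1. h S) + (\<Sum>S\<in>?U2. h S))"
    using le[OF mono, of r] le[OF mono, of "r - 1"] IH lay
    unfolding old[OF annihilating_pairD(1)[OF D V]] old[OF annihilating_pairD(2)[OF D V]] new h_def by linarith
  also have "\<dots> \<le> 1 + (\<Sum>S\<in>T. fs.dim (D (r - 1 - card S)))" using U by simp
  finally show ?case unfolding T_def .
qed

section \<open>Cohen-Macaulay complexes\<close>

lemma face_finite:
  assumes "simplicial_complex \<Delta>" "B \<in> \<Delta>" shows "finite B"
proof -
  have "Pow B \<subseteq> \<Delta>" using assms by (auto simp: simplicial_complex_def)
  then have "finite (Pow B)" using assms(1) finite_subset unfolding simplicial_complex_def by blast
  then show ?thesis by simp
qed

lemma complex_down: "simplicial_complex \<Delta> \<Longrightarrow> \<forall>B\<in>\<Delta>. \<forall>A. A \<subseteq> B \<longrightarrow> A \<in> \<Delta>"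
  by (simp add: simplicial_complex_def)

lemma complex_empty: "simplicial_complex \<Delta> \<Longrightarrow> {} \<in> \<Delta>"
  unfolding simplicial_complex_def by blast

lemma simplicial_complex_link:
  assumes "simplicial_complex \<Delta>" "A \<in> \<Delta>" shows "simplicial_complex (link \<Delta> A)"
proof -
  have "{} \<in> link \<Delta> A" using assms complex_empty by (simp add: link_def)
  moreover have "finite (link \<Delta> A)" using assms by (simp add: link_def simplicial_complex_def)
  ultimately show ?thesis
    using link_down[OF complex_down[OF assms(1)]] unfolding simplicial_complex_def by blast
qed

lemma simplicial_complex_skeleton:
  assumes "simplicial_complex \<Delta>" "-1 \<le> k" shows "simplicial_complex (skeleton k \<Delta>)"
proof -
  have "{} \<in> skeleton k \<Delta>" using assms complex_empty by (simp add: skeleton_def)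
  moreover have "finite (skeleton k \<Delta>)" using assms by (simp add: skeleton_def simplicial_complex_def)
  moreover have "A \<in> skeleton k \<Delta>" if "B \<in> skeleton k \<Delta>" "A \<subseteq> B" for A B
  proof -
    have B: "B \<in> \<Delta>" "int (card B) - 1 \<le> k" using that(1) by (auto simp: skeleton_def)
    have "card A \<le> card B" by (rule card_mono[OF face_finite[OF assms(1) B(1)] that(2)])
    moreover have "A \<in> \<Delta>" using complex_down[OF assms(1)] B(1) that(2) by blast
    ultimately show ?thesis using B(2) by (simp add: skeleton_def)
  qed
  ultimately show ?thesis unfolding simplicial_complex_def by blast
qed

text \<open>The greatest value is attained: the skeleton of dimension -1 is the Cohen-Macaulay
  complex \<open>{{}}\<close>, and \<open>cdim \<Delta>\<close> bounds the candidates.\<close>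

lemma depth_cohen_macaulay:
  fixes \<Delta> :: "'a::linorder set set"
  assumes \<Delta>: "simplicial_complex \<Delta>"
  shows "-1 \<le> depth K \<Delta>" "depth K \<Delta> \<le> cdim \<Delta>" "cohen_macaulay K (skeleton (depth K \<Delta>) \<Delta>)"
proof -
  let ?Q = "\<lambda>k. -1 \<le> k \<and> k \<le> cdim \<Delta> \<and> cohen_macaulay K (skeleton k \<Delta>)"
  have "skeleton (-1) \<Delta> = {{}}"
    using face_finite[OF \<Delta>] complex_empty[OF \<Delta>] by (auto simp: skeleton_def)
  moreover have "link {{}} {} = {{} :: 'a set}" by (auto simp: link_def)
  ultimately have "cohen_macaulay K (skeleton (-1) \<Delta>)"
    by (simp add: cohen_macaulay_def cdim_def red_hom_zero_def)
  moreover have "-1 \<le> cdim \<Delta>" by (simp add: cdim_def)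
  ultimately have m1: "?Q (-1)" by simp
  have fin: "finite {k. ?Q k}" by (rule finite_subset[of _ "{-1..cdim \<Delta>}"]) auto
  have "?Q (Max {k. ?Q k})" using Max_in[OF fin] m1 by blast
  moreover have "depth K \<Delta> = Max {k. ?Q k}"
    unfolding depth_def by (rule Greatest_equality) (use calculation Max_ge[OF fin] in auto)
  ultimately have "?Q (depth K \<Delta>)" by simp
  then show "-1 \<le> depth K \<Delta>" "depth K \<Delta> \<le> cdim \<Delta>" "cohen_macaulay K (skeleton (depth K \<Delta>) \<Delta>)" by blast+
qed

lemma cohen_macaulay_link:
  assumes "simplicial_complex \<Gamma>" "cohen_macaulay K \<Gamma>" "A \<in> \<Gamma>"
  shows "cohen_macaulay K (link \<Gamma> A)"
  unfolding cohen_macaulay_def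
proof (intro ballI allI impI)
  fix B i assume B: "B \<in> link \<Gamma> A" and i: "i < cdim (link (link \<Gamma> A) B)"
  have "A \<union> B \<in> \<Gamma>" using B by (simp add: link_def)
  then show "red_hom_zero K (link (link \<Gamma> A) B) i"
    using assms(2) i unfolding link_link[OF complex_down[OF assms(1)] B] cohen_macaulay_def by blast
qed

text \<open>Cancelling each pair against its reverse, rather than showing the sum equal to its
  negative, keeps the argument valid in characteristic 2.\<close>

lemma sum_antisym_pairs:
  fixes h :: "'a::linorder \<Rightarrow> 'a \<Rightarrow> 'k::field"
  assumes "finite E" "sym E" "irrefl E" "\<And>x y. (x, y) \<in> E \<Longrightarrow> h y x = - h x y"
  shows "(\<Sum>(x, y)\<in>E. h x y) = 0"
proof -
  let ?E1 = "{(x, y) \<in> E. x < y}" and ?E2 = "{(x, y) \<in> E. y < x}"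
  have "E = ?E1 \<union> ?E2" using assms(3) by (auto simp: irrefl_def) (metis linorder_neqE)
  then have "(\<Sum>(x, y)\<in>E. h x y) = (\<Sum>(x, y)\<in>?E1 \<union> ?E2. h x y)" by simp
  also have "\<dots> = (\<Sum>(x, y)\<in>?E1. h x y) + (\<Sum>(x, y)\<in>?E2. h x y)"
  proof (rule sum.union_disjoint)
    show "finite ?E1" by (rule finite_subset[OF _ assms(1)]) auto
    show "finite ?E2" by (rule finite_subset[OF _ assms(1)]) auto
  qed auto
  also have "(\<Sum>(x, y)\<in>?E2. h x y) = (\<Sum>(x, y)\<in>?E1. h y x)"
    by (rule sum.reindex_bij_witness[of _ "\<lambda>(x, y). (y, x)" "\<lambda>(x, y). (y, x)"])
      (use assms(2) in \<open>auto simp: sym_def\<close>)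
  also have "\<dots> = - (\<Sum>(x, y)\<in>?E1. h x y)"
    unfolding sum_negf[symmetric] by (rule sum.cong) (use assms(4) in auto)
  finally show ?thesis by simp
qed

text \<open>The links of two adjacent vertices have the same dimension, because they share the link of the
  edge; vanishing of the reduced homology in dimension 0 makes the vertices connected.\<close>
lemma cohen_macaulay_pure:
  fixes \<Gamma> :: "'a::linorder set set" and K :: "'k::field itself"
  assumes "simplicial_complex \<Gamma>" "cohen_macaulay K \<Gamma>" "Max (card ` \<Gamma>) = N" "A \<in> \<Gamma>"
  shows "\<exists>F\<in>\<Gamma>. A \<subseteq> F \<and> card F = N"
  using assms
proof (induction N arbitrary: \<Gamma> A rule: less_induct)
  case (less N)
  note cx = less.prems(1) and cm = less.prems(2)
  have fin: "finite (card ` \<Gamma>)" "finite \<Gamma>" using cx by (auto simp: simplicial_complex_def)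
  have le: "card F \<le> N" if "F \<in> \<Gamma>" for F using less.prems(3) Max_ge[OF fin(1)] that by blast
  have "card ` \<Gamma> \<noteq> {}" using complex_empty[OF cx] by blast
  then have "N \<in> card ` \<Gamma>" using Max_in[OF fin(1)] less.prems(3) by simp
  then obtain F0 where F0: "F0 \<in> \<Gamma>" "card F0 = N" by blast
  define top where "top v \<longleftrightarrow> (\<exists>F\<in>\<Gamma>. v \<in> F \<and> card F = N)" for v
  \<comment> \<open>Since \<open>v\<close> lies in a face of size \<open>N\<close>, the largest
    faces of its link have \<open>N - 1\<close> vertices, and the induction hypothesis there extends
    \<open>B - {v}\<close>.\<close>
  have ext: "\<exists>F\<in>\<Gamma>. B \<subseteq> F \<and> card F = N" if v: "top v" "v \<in> B" "B \<in> \<Gamma>" for v B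
  proof -
    let ?L = "link \<Gamma> {v}"
    note lv = link_vertex[OF complex_down[OF cx]]
    obtain F where F: "F \<in> \<Gamma>" "v \<in> F" "card F = N" using v(1) by (auto simp: top_def)
    have sv: "{v} \<in> \<Gamma>" using complex_down[OF cx] F(1,2) by blast
    have L: "simplicial_complex ?L" "cohen_macaulay K ?L"
      using simplicial_complex_link[OF cx sv] cohen_macaulay_link[OF cx cm sv] by auto
    have mem: "C - {v} \<in> ?L" if "C \<in> \<Gamma>" "v \<in> C" for C
      using that by (simp add: lv insert_absorb)
    have N: "N > 0" using F face_finite[OF cx F(1)] by (auto simp: card_gt_0_iff)
    have finL: "finite (card ` ?L)" using L(1) by (auto simp: simplicial_complex_def)
    have "Max (card ` ?L) = N - 1"
    proof (rule Max_eqI[OF finL])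
      fix m assume "m \<in> card ` ?L"
      then obtain C where C: "C \<in> ?L" "m = card C" by blast
      then have "v \<notin> C" "insert v C \<in> \<Gamma>" by (simp_all add: lv)
      then show "m \<le> N - 1" using le[of "insert v C"] face_finite[OF cx, of "insert v C"] C(2) by simp
    next
      have "card (F - {v}) = N - 1" using F by simp
      then show "N - 1 \<in> card ` ?L" using mem[OF F(1,2)] by (metis imageI)
    qed
    then obtain F' where F': "F' \<in> ?L" "B - {v} \<subseteq> F'" "card F' = N - 1"
      using less.IH[OF _ L, of "N - 1" "B - {v}"] mem[OF v(3,2)] N by auto
    have "v \<notin> F'" "insert v F' \<in> \<Gamma>" using F'(1) by (simp_all add: lv)
    moreover from this have "card (insert v F') = N" using F'(3) N face_finite[OF cx, of "insert v F'"] by simp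
    ultimately show ?thesis using F'(2) by blast
  qed
  have all_top: "top v" if v: "{v} \<in> \<Gamma>" for v
  proof (rule ccontr)
    assume ntop: "\<not> top v"
    have N: "N \<ge> 2"
    proof (rule ccontr)
      assume "\<not> N \<ge> 2"
      then have "N = card {v}" using le[OF v] by simp
      then show False using ntop v by (auto simp: top_def)
    qed
    have "F0 \<noteq> {}" using F0(2) N by auto
    then obtain w where w: "w \<in> F0" by blast
    have tw: "top w" using w F0 by (auto simp: top_def)
    have vw: "v \<noteq> w" using ntop tw by blast
    have sw: "{w} \<in> \<Gamma>" using complex_down[OF cx] F0(1) w by blast
    \<comment> \<open>The difference of the two vertices is a reduced 0-cycle, hence the boundary of
      a chain \<open>b\<close> of edges.\<close>
    define c :: "'a set \<Rightarrow> 'k" where "c F = (if F = {w} then 1 else if F = {v} then -1 else 0)" for F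
    have "link \<Gamma> {} = \<Gamma>" by (auto simp: link_def)
    moreover have "0 < cdim \<Gamma>" using less.prems(3) N by (simp add: cdim_def)
    ultimately have h0: "red_hom_zero K \<Gamma> 0"
      using cm complex_empty[OF cx] unfolding cohen_macaulay_def by metis
    have chain: "is_chain \<Gamma> (nat (0 + 1)) c" using v sw by (auto simp: is_chain_def c_def)
    have cyc: "bd \<Gamma> c F = 0" for F
    proof (cases "F = {}")
      case True
      have finv: "finite {u. {u} \<in> \<Gamma>}"
        by (rule finite_imageD[of "\<lambda>u. {u}"], rule finite_subset[OF _ fin(2)]) auto
      have "bd \<Gamma> c F = (\<Sum>u\<in>{u. {u} \<in> \<Gamma>}. c {u})" using True by (simp add: bd_def)
      also have "\<dots> = (\<Sum>u\<in>{u. {u} \<in> \<Gamma>}. (if u = w then 1 else 0) + (if u = v then -1 else 0))"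
        by (rule sum.cong) (use vw in \<open>auto simp: c_def\<close>)
      also have "\<dots> = 0" using finv v sw by (simp add: sum.distrib)
      finally show ?thesis .
    next
      case False
      have "c (insert u F) = 0" if "u \<notin> F" for u
        using False that by (auto simp: c_def)
      then show ?thesis unfolding bd_def by (intro sum.neutral) auto
    qed
    obtain b :: "'a set \<Rightarrow> 'k" where b: "is_chain \<Gamma> (nat (0 + 2)) b" "bd \<Gamma> b = c"
      using h0 chain cyc unfolding red_hom_zero_def by force
    \<comment> \<open>By \<open>ext\<close> no edge leaves \<open>X\<close>, so the boundary of
      \<open>b\<close> sums to 0 over \<open>X\<close>. But \<open>c\<close> sums to 1, because
      \<open>X\<close> contains \<open>w\<close> and not \<open>v\<close>.\<close>
    define X where "X = {x. top x}"
    have XV: "{x} \<in> \<Gamma>" if "x \<in> X" for x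
      using that complex_down[OF cx] by (auto simp: X_def top_def)
    have finX: "finite X"
      by (rule finite_imageD[of "\<lambda>u. {u}"], rule finite_subset[OF _ fin(2)]) (use XV in auto)
    have adj: "y \<in> X" if "x \<in> X" "{y, x} \<in> \<Gamma>" for x y
      using ext[of x "{y, x}"] that by (auto simp: X_def top_def)
    define E where "E = {(x, y). x \<in> X \<and> y \<noteq> x \<and> {y, x} \<in> \<Gamma>}"
    have E: "E \<subseteq> X \<times> X" using adj by (auto simp: E_def)
    have finE: "finite E" using E finX finite_subset by blast
    let ?h = "\<lambda>x y. (if x < y then -1 else 1) * b {y, x}"
    have "(\<Sum>x\<in>X. c {x}) = (\<Sum>x\<in>X. \<Sum>y\<in>{y. y \<noteq> x \<and> {y, x} \<in> \<Gamma>}. ?h x y)"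
    proof (rule sum.cong[OF refl])
      fix x assume "x \<in> X"
      have "card {u. u = x \<and> u < y} = (if x < y then 1 else 0)" for y
      proof -
        have "{u. u = x \<and> u < y} = (if x < y then {x} else {})" by auto
        then show ?thesis by simp
      qed
      then show "c {x} = (\<Sum>y\<in>{y. y \<noteq> x \<and> {y, x} \<in> \<Gamma>}. ?h x y)"
        unfolding b(2)[symmetric] bd_def by (intro sum.cong) auto
    qed
    also have "\<dots> = (\<Sum>(x, y)\<in>(SIGMA x:X. {y. y \<noteq> x \<and> {y, x} \<in> \<Gamma>}). ?h x y)"
      by (rule sum.Sigma[OF finX]) (use adj finX in \<open>auto intro!: finite_subset[OF _ finX]\<close>)
    also have "(SIGMA x:X. {y. y \<noteq> x \<and> {y, x} \<in> \<Gamma>}) = E" by (auto simp: E_def)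
    also have "(\<Sum>(x, y)\<in>E. ?h x y) = 0"
      by (rule sum_antisym_pairs[OF finE]) (use adj in \<open>auto simp: E_def sym_def irrefl_def insert_commute\<close>)
    finally have "(\<Sum>x\<in>X. c {x}) = 0" .
    moreover have "(\<Sum>x\<in>X. c {x}) = (\<Sum>x\<in>X. if x = w then 1 else 0)"
      by (rule sum.cong) (use ntop in \<open>auto simp: c_def X_def\<close>)
    moreover have "\<dots> = (1 :: 'k)" using finX tw by (simp add: X_def)
    ultimately show False by simp
  qed
  show ?case
  proof (cases "A = {}")
    case True
    then show ?thesis using F0 by blast
  next
    case False
    then obtain v where v: "v \<in> A" by blast
    then have "{v} \<subseteq> A" by blast
    then have "{v} \<in> \<Gamma>" using complex_down[OF cx] less.prems(4) by blast
    from ext[OF all_top[OF this] v less.prems(4)] show ?thesis .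
  qed
qed

lemma Max_card_skeleton:
  assumes "simplicial_complex \<Delta>" "int m - 1 \<le> cdim \<Delta>"
  shows "Max (card ` skeleton (int m - 1) \<Delta>) = m"
proof (rule Max_eqI)
  have fin: "finite \<Delta>" using assms by (simp add: simplicial_complex_def)
  show "finite (card ` skeleton (int m - 1) \<Delta>)" using fin by (simp add: skeleton_def)
  show "y \<le> m" if "y \<in> card ` skeleton (int m - 1) \<Delta>" for y using that by (auto simp: skeleton_def)
  have "Max (card ` \<Delta>) \<in> card ` \<Delta>" using fin complex_empty[OF assms(1)] by (intro Max_in) auto
  then obtain F where F: "F \<in> \<Delta>" "card F = Max (card ` \<Delta>)" by auto
  then have "m \<le> card F" using assms(2) by (simp add: cdim_def)
  then obtain G where G: "G \<subseteq> F" "card G = m" by (meson obtain_subset_with_card_n)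
  then have "G \<in> \<Delta>" using F(1) complex_down[OF assms(1)] by blast
  then show "m \<in> card ` skeleton (int m - 1) \<Delta>" using G(2) by (auto simp: skeleton_def)
qed

text \<open>By purity \<open>B\<close> lies in a face of size \<open>N\<close>, so its link has
  dimension at least \<open>N - card B - 1\<close>, which exceeds \<open>q - 1\<close>.\<close>

lemma acyclic_link:
  fixes \<Gamma> :: "'a::linorder set set"
  assumes cx: "simplicial_complex \<Gamma>" and cm: "cohen_macaulay TYPE('k::field) \<Gamma>" and N: "Max (card ` \<Gamma>) = N"
    and B: "B \<in> \<Gamma>" and q: "q + card B < N" and Y: "finite Y" "\<Gamma> \<subseteq> Pow Y"
  shows "acyclic_at TYPE('k poly fract) Y (link \<Gamma> B) q"
proof (rule acyclic_at_red_hom_zero[OF Y(1)])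
  show "link \<Gamma> B \<subseteq> Pow Y" using Y(2) by (auto simp: link_def)
  obtain F where F: "F \<in> \<Gamma>" "B \<subseteq> F" "card F = N" using cohen_macaulay_pure[OF cx cm N B] by blast
  have fF: "finite F" by (rule face_finite[OF cx F(1)])
  have "B \<union> (F - B) = F" using F(2) by blast
  then have FB: "F - B \<in> link \<Gamma> B" using F(1) complex_down[OF cx] by (auto simp: link_def)
  have "card (F - B) = N - card B" using F(2,3) fF finite_subset by (subst card_Diff_subset) auto
  moreover have "card (F - B) \<le> Max (card ` link \<Gamma> B)"
    using simplicial_complex_link[OF cx B] FB by (intro Max_ge) (auto simp: simplicial_complex_def)
  ultimately have "int q - 1 < cdim (link \<Gamma> B)" using q by (simp add: cdim_def)
  then show "red_hom_zero TYPE('k) (link \<Gamma> B) (int q - 1)"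
    using cm B unfolding cohen_macaulay_def by blast
qed

text \<open>The index \<open>j\<close> counts the forms already used, whose joint kernel is the
  current space. The next step, in degrees \<open>s \<le> k\<close>, asks for acyclic links of the
  faces of size at most \<open>j\<close>; hence the bound on \<open>j + k\<close>.\<close>

lemma exact_tail_complex:
  fixes \<Gamma> :: "'a::linorder set set" and \<alpha> :: "'a \<Rightarrow> 'f::field"
  assumes inf: "infinite (UNIV :: 'f set)" and Y: "finite Y" "\<Gamma> \<subseteq> Pow Y"
    and down: "\<forall>B\<in>\<Gamma>. \<forall>A. A \<subseteq> B \<longrightarrow> A \<in> \<Gamma>"
    and acyc: "\<And>A q. A \<in> \<Gamma> \<Longrightarrow> q + card A < N \<Longrightarrow> acyclic_at TYPE('f) Y (link \<Gamma> A) q"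
    and inj: "inj_on \<alpha> Y"
  shows "j + k \<le> N \<Longrightarrow> exact_tail Y k
    (\<lambda>s. {c \<in> supp_on {W \<in> \<Gamma>. card W = s}. \<forall>l<j. fcon Y (\<lambda>v. \<alpha> v ^ l) c = 0})"
proof (induction k arbitrary: j)
  case (Suc k)
  let ?D = "\<lambda>j s. {c \<in> supp_on {W \<in> \<Gamma>. card W = s}. \<forall>l<j. fcon Y (\<lambda>v. \<alpha> v ^ l) c = 0}"
  have next_eq: "{c \<in> ?D j s. fcon Y (\<lambda>v. \<alpha> v ^ j) c = 0} = ?D (Suc j) s" for s
    by (auto simp: less_Suc_eq)
  have "exact_tail Y k (?D (Suc j))" by (rule Suc.IH) (use Suc.prems in simp)
  moreover have "?D (Suc j) s \<subseteq> fcon Y (\<lambda>v. \<alpha> v ^ j) ` ?D j (Suc s)" if s: "s \<le> k" for s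
  proof
    fix c assume c: "c \<in> ?D (Suc j) s"
    then have c': "c \<in> supp_on {W \<in> \<Gamma>. card W = s}" "\<And>l. l \<le> j \<Longrightarrow> fcon Y (\<lambda>v. \<alpha> v ^ l) c = 0"
      by (auto simp: less_Suc_eq_le)
    have ac: "\<forall>A\<in>\<Gamma>. card A \<le> j \<longrightarrow> acyclic_at TYPE('f) Y (link \<Gamma> A) s"
      using acyc s Suc.prems by auto
    obtain b where "b \<in> supp_on {W \<in> \<Gamma>. card W = Suc s}" "fcon Y (\<lambda>v. \<alpha> v ^ j) b = c"
      "\<And>l. l < j \<Longrightarrow> fcon Y (\<lambda>v. \<alpha> v ^ l) b = 0"
      using exact_forms[OF inf Y down ac inj c'] by blast
    then show "c \<in> fcon Y (\<lambda>v. \<alpha> v ^ j) ` ?D j (Suc s)" by blast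
  qed
  ultimately show ?case
    unfolding exact_tail.simps by (intro exI[of _ "\<lambda>v. \<alpha> v ^ j"]) (simp only: next_eq, blast)
qed simp

text \<open>As long as \<open>G\<close> lacks a vertex of \<open>V\<close>, the cardinality
  condition yields a vertex of \<open>G\<close> outside \<open>F \<union> V\<close> to give up for
  it.\<close>

lemma swap_into_face:
  assumes cx: "simplicial_complex \<Delta>" and V: "finite V"
    and sh: "\<And>B v w. B \<in> \<Delta> \<Longrightarrow> w \<in> B \<Longrightarrow> w \<notin> V \<Longrightarrow> v \<in> V \<Longrightarrow> v \<notin> B \<Longrightarrow> insert v (B - {w}) \<in> \<Delta>"
  shows "G \<in> \<Delta> \<Longrightarrow> F \<subseteq> G \<Longrightarrow> card (F \<union> V) \<le> card G \<Longrightarrow> F \<union> V \<in> \<Delta>"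
proof (induction "card (V - G)" arbitrary: G rule: less_induct)
  case less
  have fG: "finite G" by (rule face_finite[OF cx less.prems(1)])
  have fFV: "finite (F \<union> V)" using fG less.prems(2) V finite_subset by blast
  show ?case
  proof (cases "V \<subseteq> G")
    case True
    then have "F \<union> V \<subseteq> G" using less.prems(2) by simp
    then show ?thesis using complex_down[OF cx, rule_format, OF less.prems(1)] by simp
  next
    case False
    then obtain v where v: "v \<in> V" "v \<notin> G" by blast
    have "\<not> G \<subseteq> F \<union> V"
    proof
      assume "G \<subseteq> F \<union> V"
      then have "G = F \<union> V" using card_seteq[OF fFV _ less.prems(3)] by simp
      then show False using v by blast
    qed
    then obtain w where w: "w \<in> G" "w \<notin> F" "w \<notin> V" by blast
    let ?G = "insert v (G - {w})"
    have G': "?G \<in> \<Delta>" by (rule sh[OF less.prems(1) w(1,3) v])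
    show ?thesis
    proof (rule less.hyps[OF _ G'])
      have "V - ?G = (V - G) - {v}" using w(3) by auto
      then show "card (V - ?G) < card (V - G)" using card_Diff1_less[of "V - G" v] V v by (simp only:) auto
      show "F \<subseteq> ?G" using less.prems(2) w(2) by blast
      show "card (F \<union> V) \<le> card ?G" using less.prems(3) fG w(1) v(2) card_Suc_Diff1[of G w] by simp
    qed
  qed
qed

theorem theorem1p7:
  fixes \<Delta> :: "'a::linorder set set" and K :: "'k::field itself"
    and d :: int and r :: nat and vs :: "'a list" and \<A> \<B> :: "'a set set"
  assumes "simplicial_complex \<Delta>"
    and "depth K \<Delta> = d - 1"
    and "2 \<le> r" and "2 * int r \<le> d + 1"
    and "\<A> \<noteq> {}" and "\<B> \<noteq> {}"
    and "\<A> \<subseteq> {F \<in> \<Delta>. card F = r - 1}" and "\<B> \<subseteq> {F \<in> \<Delta>. card F = r}"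
    and "cross_intersecting \<A> \<B>"
    and "shadow \<B> \<subseteq> \<A>"
    and "distinct vs" and "length vs = r"
    and "shifted_wrt \<Delta> vs"
  shows "int (card \<A>) + int (card \<B>)
    \<le> int (fcount (r - 1) \<Delta>) - int (card {F \<in> \<Delta>. card F = r - 1 \<and> F \<inter> set vs = {}}) + 1"
proof -
  note cx = assms(1)
  have Kt: "cohen_macaulay K = cohen_macaulay TYPE('k)"
    by (simp add: fun_eq_iff cohen_macaulay_def red_hom_zero_def)
  define V where "V = set vs"
  have V: "finite V" "card V = r" using assms(11,12) by (auto simp: V_def distinct_card)
  \<comment> \<open>A vertex outside V avoids every initial segment of \<open>vs\<close>, so it may
    be replaced by any vertex of V, whatever the order.\<close>
  have sh: "insert v (B - {w}) \<in> \<Delta>" if a: "B \<in> \<Delta>" "w \<in> B" "w \<notin> V" "v \<in> V" "v \<notin> B" for B v w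
  proof -
    obtain i where i: "i < length vs" "vs ! i = v" using a(4) by (auto simp: V_def in_set_conv_nth)
    have "w \<notin> set (take (Suc i) vs)" using a(3) by (auto simp: V_def dest: in_set_takeD)
    then show ?thesis using assms(13) i a(1,2,5) unfolding shifted_wrt_def by blast
  qed
  have finF: "finite F" if "F \<in> \<Delta>" for F using face_finite[OF cx that] .
  have fin\<Delta>: "finite \<Delta>" using cx by (simp add: simplicial_complex_def)

  obtain m where m: "d = int m" "2 * r \<le> m + 1"
    using that[of "nat d"] assms(3,4) by linarith
  define \<Sigma> where "\<Sigma> = skeleton (int m - 1) \<Delta>"
  have dep: "int m - 1 \<le> cdim \<Delta>" "cohen_macaulay TYPE('k) \<Sigma>"
    using depth_cohen_macaulay[OF cx, of K] assms(2) m(1) unfolding \<Sigma>_def Kt by simp_all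
  have cx\<Sigma>: "simplicial_complex \<Sigma>" unfolding \<Sigma>_def by (rule simplicial_complex_skeleton[OF cx]) simp
  have Max\<Sigma>: "Max (card ` \<Sigma>) = m" unfolding \<Sigma>_def by (rule Max_card_skeleton[OF cx dep(1)])
  have \<Sigma>: "F \<in> \<Sigma> \<longleftrightarrow> F \<in> \<Delta> \<and> card F \<le> m" for F by (auto simp: \<Sigma>_def skeleton_def)
  \<comment> \<open>Purity enlarges \<open>F\<close> to a face with \<open>m\<close> vertices, into
    which the rest of V is swapped.\<close>
  have join: "F \<union> V \<in> \<Sigma>" if F: "F \<in> \<Delta>" "card F \<le> m" "card (F \<union> V) \<le> m" for F
  proof -
    obtain G where G: "G \<in> \<Sigma>" "F \<subseteq> G" "card G = m"
      using cohen_macaulay_pure[OF cx\<Sigma> dep(2) Max\<Sigma>, of F] F \<Sigma> by blast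
    then show ?thesis using swap_into_face[OF cx V(1) sh, of G F] F(3) \<Sigma> by simp
  qed
  have V\<Sigma>: "V \<in> \<Sigma>" using join[of "{}"] complex_empty[OF cx] V m(2) assms(3) by simp
  define \<Gamma> where "\<Gamma> = link \<Sigma> V"
  have cx\<Gamma>: "simplicial_complex \<Gamma>" unfolding \<Gamma>_def by (rule simplicial_complex_link[OF cx\<Sigma> V\<Sigma>])
  have \<Gamma>I: "F - V \<in> \<Gamma>" if F: "F \<in> \<Delta>" "card F \<le> m" "card (F \<union> V) \<le> m" for F
  proof -
    have "V \<union> (F - V) = F \<union> V" by blast
    then have "V \<union> (F - V) \<in> \<Sigma>" using join[OF F] by simp
    then show ?thesis using complex_down[OF cx\<Sigma>] unfolding \<Gamma>_def link_def by blast
  qed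
  have \<Gamma>D: "T \<union> W \<in> \<Delta>" "W \<inter> V = {}" "W \<in> \<Delta>" if "W \<in> \<Gamma>" "T \<subseteq> V" for W T
  proof -
    have "V \<union> W \<in> \<Delta>" using that(1) \<Sigma> by (simp add: \<Gamma>_def link_def)
    then show "T \<union> W \<in> \<Delta>" using complex_down[OF cx, rule_format, of "V \<union> W" "T \<union> W"] that(2) by blast
    show "W \<inter> V = {}" "W \<in> \<Delta>" using that(1) \<Sigma> by (auto simp: \<Gamma>_def link_def)
  qed
  define Y where "Y = \<Union>\<Delta>"
  have Y: "finite Y" "\<Sigma> \<subseteq> Pow Y" "\<Gamma> \<subseteq> Pow Y"
    using fin\<Delta> finF \<Sigma> by (auto simp: Y_def \<Gamma>_def link_def)

  obtain \<A>' \<B>' where AB: "\<A>' \<subseteq> {F \<in> \<Delta>. card F = r - 1}" "\<B>' \<subseteq> {F \<in> \<Delta>. card F = r}" "V \<in> \<B>'"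
    "\<forall>A\<in>\<A>'. \<forall>B\<in>\<B>'. A \<inter> B \<noteq> {}" "\<forall>B\<in>\<B>'. \<forall>x\<in>B. B - {x} \<in> \<A>'"
    "card \<A>' = card \<A>" "card \<B>' = card \<B>"
  proof -
    have "\<forall>B\<in>\<B>. \<forall>x\<in>B. B - {x} \<in> \<A>"
    proof (intro ballI)
      fix B x assume B: "B \<in> \<B>" "x \<in> B"
      then have "finite B" using assms(8) finF by blast
      then have "card (B - {x}) + 1 = card B" using B(2) card_Suc_Diff1[of B x] by simp
      then have "B - {x} \<in> shadow \<B>" using B(1) unfolding shadow_def by blast
      then show "B - {x} \<in> \<A>" using assms(10) by blast
    qed
    from compress_to_apex[OF fin\<Delta> finF V sh assms(7,8,6) assms(9)[unfolded cross_intersecting_def] this]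
    show thesis using that by blast
  qed
  \<comment> \<open>V without one vertex lies in the shadow, hence in \<open>\<A>'\<close>, and must
    meet \<open>B\<close>.\<close>
  have meet: "B \<inter> V \<noteq> {}" if "B \<in> \<B>'" for B
  proof -
    obtain x where "x \<in> V" using V(2) assms(3) by fastforce
    then have "(V - {x}) \<inter> B \<noteq> {}" using AB(3,4,5) that by blast
    then show ?thesis by blast
  qed
  have \<B>\<Gamma>: "B - V \<in> \<Gamma>" if "B \<in> \<B>'" for B
  proof (rule \<Gamma>I)
    have B: "B \<in> \<Delta>" "card B = r" using that AB(2) by auto
    then show "B \<in> \<Delta>" "card B \<le> m" using m(2) assms(3) by auto
    \<comment> \<open>The shared vertex saves one: the union with V has at most
      \<open>2 * r - 1\<close> elements, exactly what the bound on \<open>r\<close> permits.\<close>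
    have "0 < card (B \<inter> V)" using meet[OF that] V(1) by (simp add: card_gt_0_iff)
    then show "card (B \<union> V) \<le> m" using card_Un_Int[of B V] finF[OF B(1)] V B(2) m(2) by simp
  qed
  have \<A>\<Gamma>: "S - V \<in> \<Gamma>" if "S \<in> \<A>'" for S
  proof (rule \<Gamma>I)
    have S: "S \<in> \<Delta>" "card S = r - 1" using that AB(1) by auto
    then show "S \<in> \<Delta>" "card S \<le> m" using m(2) assms(3) by auto
    show "card (S \<union> V) \<le> m" using card_Un_le[of S V] V(2) S(2) m(2) assms(3) by simp
  qed

  \<comment> \<open>Positions below \<open>r\<close> name the vertices of V; index sets can later be
    enlarged by positions that stand for generic forms.\<close>
  define e where "e P = (!) vs ` P" for P
  have inj: "inj_on ((!) vs) {..<r}" using assms(11,12) by (auto simp: inj_on_def nth_eq_iff_index_eq)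
  have eV: "e P \<subseteq> V" if "P \<subseteq> {..<r}" for P using that assms(12) by (auto simp: e_def V_def)
  have ecard: "card (e P) = card P" if "P \<subseteq> {..<r}" for P
    unfolding e_def by (rule card_image[OF inj_on_subset[OF inj that]])
  have einter: "e P \<inter> e S = e (P \<inter> S)" if "P \<subseteq> {..<r}" "S \<subseteq> {..<r}" for P S
    unfolding e_def by (rule inj_on_image_Int[OF inj that, symmetric])
  have eall: "e {..<r} = V" using assms(12) by (auto simp: e_def V_def in_set_conv_nth image_iff lessThan_def)
  have epre: "\<exists>P\<subseteq>{..<r}. T = e P" if "T \<subseteq> V" for T
    using that unfolding eall[symmetric] e_def by (rule subset_imageE) blast

  define M where "M \<F> P = {W. W \<inter> V = {} \<and> e P \<union> W \<in> \<F>}" for \<F> :: "'a set set" and P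
  have Mcard: "card W = n - card P" "card P \<le> n" if "P \<subseteq> {..<r}" "W \<in> M \<F> P" "\<F> \<subseteq> {F \<in> \<Delta>. card F = n}" for W P \<F> n
  proof -
    have W: "e P \<union> W \<in> \<Delta>" "card (e P \<union> W) = n" "e P \<inter> W = {}" using that eV[OF that(1)] by (auto simp: M_def)
    have "finite (e P)" "finite W" using finF[OF W(1)] by auto
    then have "n = card P + card W" using W(2,3) card_Un_disjoint[of "e P" W] ecard[OF that(1)] by simp
    then show "card W = n - card P" "card P \<le> n" by auto
  qed
  have M\<Gamma>: "W \<in> \<Gamma>" if "P \<subseteq> {..<r}" "W \<in> M \<F> P" "\<And>F. F \<in> \<F> \<Longrightarrow> F - V \<in> \<Gamma>" for W P \<F>
  proof -
    have "(e P \<union> W) - V = W" using that(2) eV[OF that(1)] by (auto simp: M_def)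
    then show ?thesis using that(2,3) unfolding M_def by (metis (mono_tags, lifting) mem_Collect_eq)
  qed
  define D where "D s = (supp_on {W \<in> \<Gamma>. card W = s} :: ('a set \<Rightarrow> 'k poly fract) set)" for s
  define \<B>f where "\<B>f P = (supp_on (M \<B>' P) :: ('a set \<Rightarrow> 'k poly fract) set)" for P
  define \<A>f where "\<A>f P = (supp_on (M \<A>' P) :: ('a set \<Rightarrow> 'k poly fract) set)" for P
  have graded: "graded_family r n D (\<lambda>P. supp_on (M \<F> P))"
    if "\<F> \<subseteq> {F \<in> \<Delta>. card F = n}" "\<And>F. F \<in> \<F> \<Longrightarrow> F - V \<in> \<Gamma>" for \<F> n
    unfolding graded_family_def
  proof (intro allI impI conjI)
    fix P assume P: "P \<subseteq> {..<r}"
    show "fs.subspace (supp_on (M \<F> P))" by (rule subspace_supp_on)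
    show "supp_on (M \<F> P) \<subseteq> piece n D P"
    proof (cases "card P \<le> n")
      case True
      have "M \<F> P \<subseteq> {W \<in> \<Gamma>. card W = n - card P}"
        using Mcard(1)[OF P _ that(1)] M\<Gamma>[OF P _ that(2)] by blast
      then show ?thesis using True by (simp add: piece_def D_def supp_on_mono)
    next
      case False
      then have "M \<F> P = {}" using Mcard(2)[OF P _ that(1)] by blast
      then show ?thesis using False by (auto simp: piece_def supp_on_def fun_eq_iff)
    qed
  qed
  have contraction_closed: "contraction_closed Y D"
    unfolding contraction_closed_def D_def
  proof (intro conjI allI ballI)
    fix s
    show "finite Y" by (rule Y(1))
    show "fs.subspace (supp_on {W \<in> \<Gamma>. card W = s})" by (rule subspace_supp_on)
    show "supp_on {W \<in> \<Gamma>. card W = s} \<subseteq> supp_on {W. W \<subseteq> Y \<and> card W = s}"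
      by (rule supp_on_mono) (use Y(3) in blast)
    fix c :: "'a set \<Rightarrow> 'k poly fract" and v assume c: "c \<in> supp_on {W \<in> \<Gamma>. card W = Suc s}"
    show "cont v c \<in> supp_on {W \<in> \<Gamma>. card W = s}"
      unfolding supp_on_def
    proof (intro CollectI allI impI)
      fix W assume "cont v c W \<noteq> 0"
      then have W: "v \<notin> W" "finite W" "c (insert v W) \<noteq> 0" by (auto simp: cont_def split: if_splits)
      then have "insert v W \<in> \<Gamma>" "card (insert v W) = Suc s" using c by (auto simp: supp_on_def)
      then show "W \<in> \<Gamma> \<and> card W = s"
        using W(1,2) complex_down[OF cx\<Gamma>] subset_insertI[of W v] by auto
    qed
  qed
  \<comment> \<open>For spaces of all chains on given sets, every condition reduces to the
    corresponding condition on the sets in the supports.\<close>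
  have "annihilating_pair r r D \<B>f \<A>f"
    unfolding annihilating_pair_def
  proof (intro conjI allI impI ballI)
    show "graded_family r r D \<B>f" unfolding \<B>f_def[abs_def] by (rule graded[OF AB(2) \<B>\<Gamma>])
    show "graded_family r (r - 1) D \<A>f" unfolding \<A>f_def[abs_def] by (rule graded[OF AB(1) \<A>\<Gamma>])
  next
    fix P S b a assume P: "P \<subseteq> {..<r}" and S: "S \<subseteq> {..<r}" and PS: "P \<inter> S = {}"
      and b: "b \<in> \<B>f P" and a: "a \<in> \<A>f S"
    show "wedge b a = 0"
    proof
      fix F
      have "wsign W (F - W) * b W * a (F - W) = 0" for W
      proof (rule ccontr)
        assume "wsign W (F - W) * b W * a (F - W) \<noteq> 0"
        then have "b W \<noteq> 0" "a (F - W) \<noteq> 0" by auto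
        then have W: "W \<in> M \<B>' P" "F - W \<in> M \<A>' S"
          using a b unfolding \<A>f_def \<B>f_def supp_on_def by blast+
        then have "(e S \<union> (F - W)) \<inter> (e P \<union> W) \<noteq> {}" using AB(4) unfolding M_def by blast
        moreover have "e P \<inter> e S = {}" using einter[OF P S] PS by (simp add: e_def)
        moreover have "W \<inter> V = {}" "(F - W) \<inter> V = {}" using W by (auto simp: M_def)
        ultimately show False using eV[OF P] eV[OF S] by blast
      qed
      then show "wedge b a F = 0 F" by (simp add: wedge_def del: mult_eq_0_iff)
    qed
  next
    fix P b v assume P: "P \<subseteq> {..<r}" and b: "b \<in> \<B>f P"
    show "cont v b \<in> \<A>f P"
      unfolding \<A>f_def supp_on_def
    proof (intro CollectI allI impI)
      fix W assume "cont v b W \<noteq> 0"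
      then have W: "v \<notin> W" "b (insert v W) \<noteq> 0" by (auto simp: cont_def split: if_splits)
      then have I: "insert v W \<in> M \<B>' P" using b unfolding \<B>f_def supp_on_def by blast
      then have J: "insert v W \<inter> V = {}" "e P \<union> insert v W \<in> \<B>'" unfolding M_def by auto
      then have "(e P \<union> insert v W) - {v} \<in> \<A>'" using AB(5) by blast
      moreover have "(e P \<union> insert v W) - {v} = e P \<union> W" using J(1) eV[OF P] W(1) by blast
      ultimately show "W \<in> M \<A>' P" using J(1) by (simp add: M_def)
    qed
  next
    fix P b z assume P: "P \<subseteq> {..<r}" and b: "b \<in> \<B>f P" and z: "z \<in> P"
    show "b \<in> \<A>f (P - {z})"
      unfolding \<A>f_def supp_on_def
    proof (intro CollectI allI impI)
      fix W assume "b W \<noteq> 0"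
      then have W: "W \<inter> V = {}" "e P \<union> W \<in> \<B>'" using b unfolding \<B>f_def supp_on_def M_def by blast+
      have zP: "vs ! z \<in> e P" "vs ! z \<in> V" using z eV[OF P] by (auto simp: e_def)
      have "(e P \<union> W) - {vs ! z} \<in> \<A>'" using AB(5) W(2) zP(1) by blast
      moreover have "e (P - {z}) = e P - {vs ! z}"
        unfolding e_def using inj_on_image_set_diff[OF inj, of P "{z}"] P z by auto
      then have "(e P \<union> W) - {vs ! z} = e (P - {z}) \<union> W" using W(1) zP(2) by blast
      ultimately show "W \<in> M \<A>' (P - {z})" using W(1) by (simp add: M_def)
    qed
  next
    have "{} \<in> M \<B>' {..<r}" using AB(3) eall by (simp add: M_def)
    then have "delta {} \<in> \<B>f {..<r}" by (auto simp: \<B>f_def supp_on_def delta_def)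
    moreover have "delta {} \<noteq> (0 :: 'a set \<Rightarrow> 'k poly fract)"
      by (auto simp: delta_def fun_eq_iff)
    ultimately show "\<exists>b\<in>\<B>f {..<r}. b \<noteq> 0" by blast
  qed
  note annihilating_pair = this

  obtain \<alpha> :: "'a \<Rightarrow> 'k poly fract" where \<alpha>: "inj_on \<alpha> Y"
  proof -
    obtain X :: "'k poly fract set" where "finite X" "card X = card Y"
      using infinite_arbitrarily_large[OF infinite_poly_fract] by blast
    then obtain h where "bij_betw h Y X" using finite_same_card_bij[OF Y(1)] by metis
    then show thesis by (intro that bij_betw_imp_inj_on)
  qed
  \<comment> \<open>The link of \<open>A\<close> in \<Gamma> is the link of
    \<open>V \<union> A\<close> in \<Sigma>; the \<open>r\<close> vertices of V leave
    \<open>m - r \<ge> r - 1\<close>.\<close>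
  have acyc: "acyclic_at TYPE('k poly fract) Y (link \<Gamma> A) q" if A: "A \<in> \<Gamma>" "q + card A < r - 1" for A q
  proof -
    have VA: "V \<union> A \<in> \<Sigma>" "V \<inter> A = {}" using A(1) by (auto simp: \<Gamma>_def link_def)
    have "finite A" using face_finite[OF cx\<Gamma> A(1)] .
    then have "card (V \<union> A) = r + card A" using VA(2) V by (simp add: card_Un_disjoint)
    then have "q + card (V \<union> A) < m" using A(2) m(2) assms(3) by linarith
    from acyclic_link[OF cx\<Sigma> dep(2) Max\<Sigma> VA(1) this Y(1,2)] show ?thesis
      using link_link[OF complex_down[OF cx\<Sigma>], of A V] A(1) unfolding \<Gamma>_def by simp
  qed
  have tail: "exact_tail Y (r - 1) D"
  proof -
    have "exact_tail Y (r - 1)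
      (\<lambda>s. {c \<in> supp_on {W \<in> \<Gamma>. card W = s}. \<forall>l<0. fcon Y (\<lambda>v. \<alpha> v ^ l) c = 0})"
      by (rule exact_tail_complex[where N = "r - 1",
            OF infinite_poly_fract Y(1,3) complex_down[OF cx\<Gamma>] _ \<alpha>])
        (simp_all add: acyc del: One_nat_def)
    then show ?thesis by (simp add: D_def[abs_def])
  qed
  \<comment> \<open>The start is \<open>n = r\<close>, \<open>k = r - 1\<close>. The cuts keep all
    of \<open>\<A>f\<close>, and all of \<open>\<B>f\<close> except the piece at the empty set,
    which is zero because every member of \<open>\<B>'\<close> meets V.\<close>
  have bound: "weighted_dim r (\<lambda>P. if r \<le> card P + (r - 1) then 1 else 0) \<B>f + weighted_dim r (\<lambda>S. if r - 1 \<le> card S + (r - 1) then 1 else 0) \<A>f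
    \<le> 1 + (\<Sum>S | S \<subseteq> {..<r} \<and> r - 1 \<le> card S + (r - 1) \<and> card S \<le> r - 1 \<and> S \<inter> {..<r} \<noteq> {}. fs.dim (D (r - 1 - card S)))"
    by (rule graded_bound[OF contraction_closed annihilating_pair _ _ tail]) (use assms(3) in auto)

  have finM: "finite (M \<F> P)" if "\<F> \<subseteq> \<Delta>" for \<F> P
  proof (rule finite_subset)
    show "M \<F> P \<subseteq> Pow Y"
      using that unfolding M_def Y_def by blast
  qed (use Y(1) in simp)
  have count: "card \<F> \<le> (\<Sum>P | P \<subseteq> {..<r} \<and> Q P. card (M \<F> P))"
    if \<F>: "\<F> \<subseteq> \<Delta>" and Q: "\<And>P. P \<subseteq> {..<r} \<Longrightarrow> P = {} \<Longrightarrow> M \<F> P \<noteq> {} \<Longrightarrow> Q P" "\<And>P. P \<subseteq> {..<r} \<Longrightarrow> P \<noteq> {} \<Longrightarrow> Q P" for \<F> Q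
  proof -
    have fin: "finite {P. P \<subseteq> {..<r} \<and> Q P}" by (rule finite_subset[of _ "Pow {..<r}"]) auto
    have "\<F> \<subseteq> (\<Union>P\<in>{P. P \<subseteq> {..<r} \<and> Q P}. (\<union>) (e P) ` M \<F> P)"
    proof
      fix F assume F: "F \<in> \<F>"
      obtain P where P: "P \<subseteq> {..<r}" "F \<inter> V = e P" using epre[of "F \<inter> V"] by blast
      have eq: "e P \<union> (F - V) = F" using P(2) by blast
      then have W: "F - V \<in> M \<F> P" using F by (auto simp: M_def)
      then have "Q P" using Q[OF P(1)] by blast
      then show "F \<in> (\<Union>P\<in>{P. P \<subseteq> {..<r} \<and> Q P}. (\<union>) (e P) ` M \<F> P)"
        using P(1) W eq by blast
    qed
    then have "card \<F> \<le> card (\<Union>P\<in>{P. P \<subseteq> {..<r} \<and> Q P}. (\<union>) (e P) ` M \<F> P)"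
      by (rule card_mono[rotated]) (use fin finM[OF \<F>] in auto)
    also have "\<dots> \<le> (\<Sum>P | P \<subseteq> {..<r} \<and> Q P. card ((\<union>) (e P) ` M \<F> P))" by (rule card_UN_le[OF fin])
    also have "\<dots> \<le> (\<Sum>P | P \<subseteq> {..<r} \<and> Q P. card (M \<F> P))"
      by (intro sum_mono card_image_le finM[OF \<F>])
    finally show ?thesis .
  qed
  have \<F>\<Delta>: "\<A>' \<subseteq> \<Delta>" "\<B>' \<subseteq> \<Delta>" using AB by auto
  have cB: "card \<B>' \<le> weighted_dim r (\<lambda>P. if r \<le> card P + (r - 1) then 1 else 0) \<B>f"
    unfolding weighted_dim_filter \<B>f_def dim_supp_on[OF finM[OF \<F>\<Delta>(2)]]
  proof (rule count[OF \<F>\<Delta>(2)])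
    fix P :: "nat set" assume P: "P \<subseteq> {..<r}"
    show "r \<le> card P + (r - 1)" if e: "P = {}" "M \<B>' P \<noteq> {}"
    proof -
      obtain W where "W \<inter> V = {}" "W \<in> \<B>'" using e by (auto simp: M_def e_def)
      then show ?thesis using meet by blast
    qed
    show "r \<le> card P + (r - 1)" if "P \<noteq> {}"
    proof -
      have "0 < card P" using that P finite_subset by (auto simp: card_gt_0_iff)
      then show ?thesis by simp
    qed
  qed
  have cA: "card \<A>' \<le> weighted_dim r (\<lambda>P. if r - 1 \<le> card P + (r - 1) then 1 else 0) \<A>f"
    unfolding weighted_dim_filter \<A>f_def dim_supp_on[OF finM[OF \<F>\<Delta>(1)]] by (rule count[OF \<F>\<Delta>(1)]) simp_all
  let ?I = "{S. S \<subseteq> {..<r} \<and> r - 1 \<le> card S + (r - 1) \<and> card S \<le> r - 1 \<and> S \<inter> {..<r} \<noteq> {}}"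
  let ?N = "{F \<in> \<Delta>. card F = r - 1 \<and> F \<inter> V \<noteq> {}}"
  have fin\<Gamma>: "finite {W \<in> \<Gamma>. card W = s}" for s using cx\<Gamma> by (simp add: simplicial_complex_def)
  have finI: "finite ?I" by (rule finite_subset[of _ "Pow {..<r}"]) auto
  \<comment> \<open>The right-hand side counts pairs of a nonempty set of positions and a face of
    \<Gamma>; their unions are distinct \<open>(r - 1)\<close>-element faces meeting V.\<close>
  have "(\<Sum>S\<in>?I. fs.dim (D (r - 1 - card S))) = (\<Sum>S\<in>?I. card {W \<in> \<Gamma>. card W = r - 1 - card S})"
    unfolding D_def dim_supp_on[OF fin\<Gamma>] ..
  also have "\<dots> = card (SIGMA S:?I. {W \<in> \<Gamma>. card W = r - 1 - card S})"
    by (rule card_SigmaI[symmetric]) (use finI fin\<Gamma> in auto)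
  also have "\<dots> \<le> card ?N"
  proof (rule card_inj_on_le[of "\<lambda>(S, W). e S \<union> W"])
    show "inj_on (\<lambda>(S, W). e S \<union> W) (SIGMA S:?I. {W \<in> \<Gamma>. card W = r - 1 - card S})"
    proof (rule inj_onI, clarify)
      fix S W S' W' assume a: "S \<subseteq> {..<r}" "S' \<subseteq> {..<r}" "W \<in> \<Gamma>" "W' \<in> \<Gamma>" "e S \<union> W = e S' \<union> W'"
      have "W \<inter> V = {}" "W' \<inter> V = {}" using \<Gamma>D(2)[of _ "{}"] a by auto
      then have "e S = e S'" "W = W'" using a(5) eV[OF a(1)] eV[OF a(2)] by blast+
      then show "S = S' \<and> W = W'" using inj_on_image_eq_iff[OF inj a(1,2)] by (simp add: e_def)
    qed
    show "(\<lambda>(S, W). e S \<union> W) ` (SIGMA S:?I. {W \<in> \<Gamma>. card W = r - 1 - card S}) \<subseteq> ?N"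
    proof (rule image_subsetI, clarify)
      fix S W assume S: "S \<subseteq> {..<r}" "card S \<le> r - 1" "S \<inter> {..<r} \<noteq> {}" and W: "W \<in> \<Gamma>" "card W = r - 1 - card S"
      have mem: "e S \<union> W \<in> \<Delta>" "W \<inter> V = {}" using \<Gamma>D[OF W(1) eV[OF S(1)]] by auto
      have "e S \<inter> W = {}" using mem(2) eV[OF S(1)] by blast
      then have "card (e S \<union> W) = r - 1"
        using S(2) W(2) finF[OF mem(1)] ecard[OF S(1)] by (simp add: card_Un_disjoint)
      moreover have "e S \<noteq> {}" using S(3) by (auto simp: e_def)
      then have "(e S \<union> W) \<inter> V \<noteq> {}" using eV[OF S(1)] by blast
      ultimately show "e S \<union> W \<in> \<Delta> \<and> card (e S \<union> W) = r - 1 \<and> (e S \<union> W) \<inter> V \<noteq> {}" using mem(1) by blast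
    qed
    show "finite ?N" using fin\<Delta> by simp
  qed
  finally have "card \<B>' + card \<A>' \<le> 1 + card ?N" using bound cA cB by linarith
  moreover have "fcount (r - 1) \<Delta> = card ?N + card {F \<in> \<Delta>. card F = r - 1 \<and> F \<inter> V = {}}"
  proof -
    have "{F \<in> \<Delta>. card F = r - 1} = ?N \<union> {F \<in> \<Delta>. card F = r - 1 \<and> F \<inter> V = {}}" by blast
    then show ?thesis unfolding fcount_def
      using card_Un_disjoint[of ?N "{F \<in> \<Delta>. card F = r - 1 \<and> F \<inter> V = {}}"] fin\<Delta> by auto
  qed
  ultimately show ?thesis using AB(6,7) unfolding V_def by linarith
qed

end
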